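(* Let $p,q\geq2$ be integers with $p\equiv q\pmod2$ and $\gcd(p,(p-q)/2)=1$, let $c_{p,q}=\frac32\left(1-\frac{2(p-q)^2}{pq}\right)$, and let $L_{p,q}$ be the quotient of the Neveu–Schwarz Verma module $V(c_{p,q},0)$ by its maximal proper submodule, a super vertex algebra. Then $L_{p,q}/C_2L_{p,q}$ is spanned by the images of $L_{-2}^i\mathbf{1}$ and $G_{-3/2}L_{-2}^i\mathbf{1}$ for $0\leq i<N$, where $N=\frac{(p-1)(q-1)}4$ if $p,q$ are odd and $N=\frac{(p-1)(q-1)+1}4$ if $p,q$ are even. In particular $L_{p,q}$ satisfies the $C_2$-condition ($\dim L_{p,q}/C_2L_{p,q}<\infty$).
   Context: The $N=1$ Neveu–Schwarz algebra has basis $L_n$ ($n\in\mathbb{Z}$), $G_m$ ($m\in\frac12+\mathbb{Z}$) and a central element acting by $c_{p,q}$; $\mathbf{1}$ is the highest weight vector of weight $0$. For a (super) vertex algebra $V$ with vertex operators $Y(u,z)=\sum_n u_{(n)}z^{-n-1}$, $C_2V$ is the span of $u_{(-n)}v$ for $u,v\in V$, $n\geq2$ (the coefficients of $z^{\geq1}$ in $Y(u,z)v$). *)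

theory Defs
  imports Complex_Main
begin

text \<open>Conventions. A complex vector space is a type 'v with a scalar multiplication sc
  satisfying the locale vector_space. The mode u_(n) of Y(u,z) = sum_n u_(n) z^(-n-1)
  is written Y u n. The odd NS generators are indexed by integers: Gop k stands for
  G_(k+1/2); thus G_(-3/2) is Gop (-2).\<close>

definition homog :: "'v set \<Rightarrow> 'v set \<Rightarrow> nat \<Rightarrow> 'v \<Rightarrow> bool" where
  "homog V0 V1 i u \<longleftrightarrow> (if even i then u \<in> V0 else u \<in> V1)"

text \<open>Super vertex algebra (over the complex numbers), via vacuum axioms, truncation
  and the Borcherds (Jacobi) identity for homogeneous u, v.\<close>

definition super_vertex_algebra ::
  "(complex \<Rightarrow> 'v::ab_group_add \<Rightarrow> 'v) \<Rightarrow> 'v set \<Rightarrow> 'v set \<Rightarrow> ('v \<Rightarrow> int \<Rightarrow> 'v \<Rightarrow> 'v) \<Rightarrow> 'v \<Rightarrow> bool" where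
  "super_vertex_algebra sc V0 V1 Y vac \<longleftrightarrow>
     vector_space sc \<and>
     module.subspace sc V0 \<and> module.subspace sc V1 \<and> V0 \<inter> V1 = {0} \<and>
     (\<forall>x. \<exists>a\<in>V0. \<exists>b\<in>V1. x = a + b) \<and>
     (\<forall>u n. Vector_Spaces.linear sc sc (Y u n)) \<and>
     (\<forall>n v. Vector_Spaces.linear sc sc (\<lambda>u. Y u n v)) \<and>
     (\<forall>i j u v n. homog V0 V1 i u \<longrightarrow> homog V0 V1 j v \<longrightarrow> homog V0 V1 (i + j) (Y u n v)) \<and>
     (\<forall>u v. \<exists>N. \<forall>n\<ge>N. Y u n v = 0) \<and>
     vac \<in> V0 \<and>
     (\<forall>n v. Y vac n v = (if n = -1 then v else 0)) \<and>
     (\<forall>u n. n \<ge> 0 \<longrightarrow> Y u n vac = 0) \<and>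
     (\<forall>u. Y u (-1) vac = u) \<and>
     (\<forall>i j u v w m n k. homog V0 V1 i u \<longrightarrow> homog V0 V1 j v \<longrightarrow>
        (\<exists>N0. \<forall>N\<ge>N0.
          (\<Sum>l\<le>N. sc ((of_int m) gchoose l) (Y (Y u (k + int l) v) (m + n - int l) w))
          = (\<Sum>l\<le>N. sc ((-1) ^ l * ((of_int k) gchoose l))
               (Y u (m + k - int l) (Y v (n + int l) w)
                - sc (if even (k + int (i * j)) then 1 else -1) (Y v (n + k - int l) (Y u (m + int l) w))))))"

text \<open>A module over the N=1 Neveu-Schwarz algebra with central charge c.
  Lop n = L_n, Gop k = G_(k+1/2).\<close>

definition NS_module ::
  "(complex \<Rightarrow> 'v::ab_group_add \<Rightarrow> 'v) \<Rightarrow> complex \<Rightarrow> (int \<Rightarrow> 'v \<Rightarrow> 'v) \<Rightarrow> (int \<Rightarrow> 'v \<Rightarrow> 'v) \<Rightarrow> bool" where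
  "NS_module sc c Lop Gop \<longleftrightarrow>
     vector_space sc \<and>
     (\<forall>n. Vector_Spaces.linear sc sc (Lop n)) \<and>
     (\<forall>k. Vector_Spaces.linear sc sc (Gop k)) \<and>
     (\<forall>m n v. Lop m (Lop n v) - Lop n (Lop m v)
        = sc (of_int (m - n)) (Lop (m + n) v)
          + (if m + n = 0 then sc (c / 12 * of_int (m ^ 3 - m)) v else 0)) \<and>
     (\<forall>m a v. Lop m (Gop a v) - Gop a (Lop m v)
        = sc (of_int m / 2 - of_int a - 1 / 2) (Gop (m + a) v)) \<and>
     (\<forall>a b v. Gop a (Gop b v) + Gop b (Gop a v)
        = sc 2 (Lop (a + b + 1) v)
          + (if a + b + 1 = 0 then sc (c / 3 * of_int (a * (a + 1))) v else 0))"

definition C2 :: "(complex \<Rightarrow> 'v::ab_group_add \<Rightarrow> 'v) \<Rightarrow> ('v \<Rightarrow> int \<Rightarrow> 'v \<Rightarrow> 'v) \<Rightarrow> 'v set" where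
  "C2 sc Y = module.span sc {Y u (- int n) v | u v n. n \<ge> 2}"

definition c_pq :: "int \<Rightarrow> int \<Rightarrow> complex" where
  "c_pq p q = 3 / 2 * (1 - 2 * (of_int p - of_int q) ^ 2 / (of_int p * of_int q))"

definition N_pq :: "int \<Rightarrow> int \<Rightarrow> int" where
  "N_pq p q = (if odd p \<and> odd q then ((p - 1) * (q - 1)) div 4 else ((p - 1) * (q - 1) + 1) div 4)"

end

theory Submission
  imports Defs "HOL-Library.Poly_Mapping" "HOL-Library.Function_Algebras" "HOL-Library.Product_Plus" "HOL-Library.Multiset"
begin

text \<open>
  Let $n = (p-1)(q-1)$. The Verma module of weight 0 has a singular vector of level $n/2$ that is not in the
  submodule generated by $G_{-1/2}\mathbf 1$. Its image in the vacuum module is a nonzero singular vector, and every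
  such vector has a nonzero coefficient at the longest PBW monomial in $L_{-2}$ and $G_{-3/2}$ of its degree. In the simple
  quotient this expresses $L_{-2}^N\mathbf 1$ (after applying $G_{-1/2}$ if $p, q$ are even) by monomials that begin with
  a mode $L_{-k}$, $k \ge 3$, or $G_{-k}$, $k \ge 5/2$, and these lie in $C_2$.

  The singular vector is found without determinant formulas, by fusion with the degenerate field $\phi$ of
  label (1, 3), which satisfies a null vector equation of degree 3/2. Write $\tau = p/q$ and let $h(\sigma)$ be the weight with
  label $\sigma$. If no resonance occurs, the null vector equation determines recursively a highest weight vector of weight
  $h(\sigma)$ in the tensor product of the Verma module of weight $h(\sigma + 2\tau)$ and a density module. A singular vector of
  level $l$ at $h(\sigma)$ acts on it, and the leading coefficient $k$ of the result is again singular, of level $l + k$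
  with $k(k + \sigma) = 2\tau l$. Starting from the explicit singular vectors with labels (1, 1) or (2, 2) these steps, in both
  directions of the Kac table, reach the label $(p-1, q-1)$, which has weight 0. The same steps, applied to a hypothetical
  singular vector that comes from $G_{-1/2}\mathbf 1$, lead to negative levels.\<close>

section \<open>Neveu-Schwarz modules\<close>

text \<open>The danger in a fusion step is that the singular vector v might act as zero on the
  fusion vector. A functional excludes this: sending L_{-1} and G_{-1/2} to 1 and the other negative
  modes to 0 is a character of the negative part, and it is nonzero on singular vectors, since the
  longest word in these two modes occurs in them. Along the fusion vector it takes nonzero values
  that decay essentially like 1/(n!)^2. The differential part of a negative mode involves only later
  coefficients or the odd component, which are negligible against such decay, so in the limit only
  the character of v is seen.

  The relation for k is the indicial equation of the null vector equation: series that satisfy this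
  equation are stable under the negative modes, so it still holds after v has acted, with the weight
  raised by l. If the even component of the leading coefficient vanishes, the odd one is singular
  instead. Divisibility by a and b and the sign of the level decide between the candidates along the
  chain.\<close>

text \<open>All generators are indexed by one integer: J (2 n) is $L_n$ and J (2 n + 1) is $G_{n+1/2}$, so that J a has
  mode number a / 2. The functions below are the sign, the structure constant and the central term of the relation
  between J a and J b.\<close>

definition ns_sg :: "int \<Rightarrow> int \<Rightarrow> complex" where
  "ns_sg a b = (if odd a \<and> odd b then -1 else 1)"

definition ns_st :: "int \<Rightarrow> int \<Rightarrow> complex" where
  "ns_st a b = (if even a
     then (if even b then (of_int a - of_int b) / 2 else of_int a / 4 - of_int b / 2)
     else (if even b then of_int a / 2 - of_int b / 4 else 2))"

definition ns_ct :: "complex \<Rightarrow> int \<Rightarrow> int \<Rightarrow> complex" where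
  "ns_ct c a b = (if a + b = 0
     then (if even a then c / 12 * ((of_int a / 2) ^ 3 - of_int a / 2) else c / 3 * ((of_int a / 2) ^ 2 - 1 / 4))
     else 0)"

lemma ns_sg_commute: "ns_sg b a = ns_sg a b"
  by (auto simp: ns_sg_def)

lemma ns_sg_sq [simp]: "ns_sg a b * ns_sg a b = 1"
  by (auto simp: ns_sg_def)

lemma ns_sg_add: "ns_sg (a + b) d = ns_sg a d * ns_sg b d"
  by (auto simp: ns_sg_def)

lemma ns_st_commute: "ns_st b a = - ns_sg a b * ns_st a b"
  by (auto simp: ns_st_def ns_sg_def field_simps)

lemma ns_ct_commute: "ns_ct c b a = - ns_sg a b * ns_ct c a b"
proof (cases "a + b = 0")
  case True
  then have "b = - a" by simp
  then show ?thesis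
    by (auto simp: ns_ct_def ns_sg_def field_simps power2_eq_square power3_eq_cube)
qed (auto simp: ns_ct_def add.commute)

text \<open>The super Jacobi identity of the algebra in coordinates; with the cocycle identity below
  it makes the straightening of words consistent.\<close>

lemma ns_jacobi:
  "ns_st b d * ns_st a (b + d) = ns_sg a b * ns_st a d * ns_st b (a + d) + ns_st a b * ns_st (a + b) d"
  by (cases "even a"; cases "even b"; cases "even d")
     (simp_all add: ns_st_def ns_sg_def field_simps)

lemma ns_jacobi_central:
  "ns_st b d * ns_ct c a (b + d) = ns_sg a b * ns_st a d * ns_ct c b (a + d) + ns_st a b * ns_ct c (a + b) d"
proof (cases "a + b + d = 0")
  case True
  then have d: "d = - a - b" by simp
  show ?thesis
    unfolding d
    by (cases "even a"; cases "even b"; simp add: ns_st_def ns_sg_def ns_ct_def)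
       (simp_all add: power2_eq_square power3_eq_cube add_divide_distrib diff_divide_distrib algebra_simps)
qed (auto simp: ns_ct_def algebra_simps)

lemma ns_coeff_LL: "ns_sg (2 * m) (2 * n) = 1" "ns_st (2 * m) (2 * n) = of_int m - of_int n"
    "ns_ct c (2 * m) (2 * n) = (if m + n = 0 then c / 12 * (of_int m ^ 3 - of_int m) else 0)"
  by (auto simp: ns_sg_def ns_st_def ns_ct_def)

lemma ns_coeff_GL: "ns_sg (2 * a + 1) (2 * n) = 1" "ns_st (2 * a + 1) (2 * n) = of_int a + 1 / 2 - of_int n / 2"
    "ns_ct c (2 * a + 1) (2 * n) = 0"
  by (auto simp: ns_sg_def ns_st_def ns_ct_def add_divide_distrib) presburger

lemma ns_coeff_LG: "ns_sg (2 * n) (2 * a + 1) = 1" "ns_st (2 * n) (2 * a + 1) = of_int n / 2 - of_int a - 1 / 2"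
    "ns_ct c (2 * n) (2 * a + 1) = 0"
  by (auto simp: ns_sg_def ns_st_def ns_ct_def add_divide_distrib) presburger

lemma ns_coeff_GG: "ns_sg (2 * a + 1) (2 * b + 1) = -1" "ns_st (2 * a + 1) (2 * b + 1) = 2"
    "ns_ct c (2 * a + 1) (2 * b + 1) = (if a + b + 1 = 0 then c / 3 * of_int (a * (a + 1)) else 0)"
  by (auto simp: ns_sg_def ns_st_def ns_ct_def field_simps power2_eq_square)

lemma ns_index: "2 * m + 2 * n = 2 * (m + n)" "2 * a + 1 + 2 * n = 2 * (a + n) + 1" "2 * n + (2 * a + 1) = 2 * (a + n) + 1"
    "2 * a + 1 + (2 * b + 1) = 2 * (a + b + 1)" for m n a b :: int
  by simp_all

text \<open>The relations are required only on the stable subspace \<open>S\<close>: the operators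
  on words below act on a whole type, which also contains words out of order, and nothing is claimed
  for those.\<close>

locale ns_rep = vector_space sc
  for sc :: "complex \<Rightarrow> 'v::ab_group_add \<Rightarrow> 'v" +
  fixes S :: "'v set" and c :: complex and J :: "int \<Rightarrow> 'v \<Rightarrow> 'v"
  assumes S_subspace: "subspace S"
    and J_closed: "v \<in> S \<Longrightarrow> J a v \<in> S"
    and J_add: "J a (v + w) = J a v + J a w"
    and J_scale: "J a (sc x v) = sc x (J a v)"
    and J_rel: "v \<in> S \<Longrightarrow> J a (J b v) = sc (ns_sg a b) (J b (J a v)) + sc (ns_st a b) (J (a + b) v)
                  + sc (ns_ct c a b) v"
begin

lemma J_linear: "Vector_Spaces.linear sc sc (J a)"
  by unfold_locales (auto simp: J_add J_scale algebra_simps)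

lemma J_0 [simp]: "J a 0 = 0"
  using J_add[of a 0 0] by simp

lemma J_minus: "J a (- v) = - J a v"
  using J_add[of a v "- v"] by (simp add: eq_neg_iff_add_eq_0 add.commute)

lemma J_diff: "J a (v - w) = J a v - J a w"
  using J_add[of a v "- w"] by (simp add: J_minus)

lemma J_sum: "J a (sum f A) = (\<Sum>x\<in>A. J a (f x))"
  by (induct A rule: infinite_finite_induct) (auto simp: J_add)

abbreviation L :: "int \<Rightarrow> 'v \<Rightarrow> 'v" where "L n \<equiv> J (2 * n)"
abbreviation G :: "int \<Rightarrow> 'v \<Rightarrow> 'v" where "G j \<equiv> J (2 * j + 1)"

lemma GG:
  assumes "v \<in> S"
  shows "G a (G b v) = - G b (G a v) + sc 2 (L (a + b + 1) v)
           + sc (if a + b + 1 = 0 then c / 3 * of_int (a * (a + 1)) else 0) v"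
  using J_rel[OF assms, of "2*a+1" "2*b+1"] unfolding ns_coeff_GG ns_index by simp

lemma GL:
  assumes "v \<in> S"
  shows "G a (L n v) = L n (G a v) + sc (of_int a + 1 / 2 - of_int n / 2) (G (a + n) v)"
  using J_rel[OF assms, of "2*a+1" "2*n"] unfolding ns_coeff_GL ns_index by simp

lemma LG:
  assumes "v \<in> S"
  shows "L n (G a v) = G a (L n v) + sc (of_int n / 2 - of_int a - 1 / 2) (G (a + n) v)"
  using J_rel[OF assms, of "2*n" "2*a+1"] unfolding ns_coeff_LG ns_index by simp

lemma LL:
  assumes "v \<in> S"
  shows "L m (L n v) = L n (L m v) + sc (of_int m - of_int n) (L (m + n) v)
           + sc (if m + n = 0 then c / 12 * (of_int m ^ 3 - of_int m) else 0) v"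
  using J_rel[OF assms, of "2*m" "2*n"] unfolding ns_coeff_LL ns_index by simp

text \<open>The positive modes are generated by $G_{1/2}$ and $G_{3/2}$.\<close>

lemma positive_modes_vanish:
  assumes v: "v \<in> S" and g0: "J 1 v = 0" and g1: "J 3 v = 0"
  shows "a > 0 \<Longrightarrow> J a v = 0"
proof -
  have g0': "G 0 v = 0" and g1': "G 1 v = 0" using g0 g1 by simp_all
  have l1: "L 1 v = 0"
    using GG[OF v, of 0 0] g0' by simp
  have g: "G (int k) v = 0" for k
  proof (induct k rule: less_induct)
    case (less k)
    show ?case
    proof (cases "k \<le> 1")
      case True then show ?thesis using g0' g1' by (cases k) auto
    next
      case False
      then have k: "int (k - 1) \<ge> 1" "int (k-1) + 1 = int k" by auto
      have "G (int (k-1)) v = 0" using less[of "k-1"] False by simp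
      then have "sc (of_int 1 / 2 - of_int (int (k-1)) - 1 / 2) (G (int (k-1) + 1) v) = 0"
        using LG[OF v, of 1 "int (k-1)"] l1 by simp
      then show ?thesis using False unfolding k by auto
    qed
  qed
  have l: "L (int k) v = 0" if "k \<ge> 1" for k
  proof -
    have "G 0 (G (int k - 1) v) = 0" "G (int k - 1) (G 0 v) = 0"
      using g[of "k-1"] g0' that by (simp_all add: of_nat_diff)
    then show ?thesis using GG[OF v, of 0 "int k - 1"] that by simp
  qed
  assume "a > 0"
  show "J a v = 0"
  proof (cases "even a")
    case True
    then obtain m where "a = 2 * m" by blast
    then show ?thesis using l[of "nat m"] \<open>a > 0\<close> by simp
  next
    case False
    then obtain m where "a = 2 * m + 1" by (rule oddE)
    then show ?thesis using g[of "nat m"] \<open>a > 0\<close> by simp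
  qed
qed

end

section \<open>Highest weight modules on PBW words\<close>

type_synonym wvec = "int list \<Rightarrow>\<^sub>0 complex"

definition scv :: "complex \<Rightarrow> ('a \<Rightarrow>\<^sub>0 complex) \<Rightarrow> ('a \<Rightarrow>\<^sub>0 complex)" where
  "scv x v = Poly_Mapping.map ((*) x) v"

lemma lookup_scv [simp]: "Poly_Mapping.lookup (scv x v) W = x * Poly_Mapping.lookup v W"
  by (simp add: scv_def map.rep_eq when_def)

global_interpretation wv: vector_space scv
  by unfold_locales (auto intro!: poly_mapping_eqI simp: lookup_add algebra_simps)

definition ev :: "'a \<Rightarrow> ('a \<Rightarrow>\<^sub>0 complex)" where
  "ev W = Poly_Mapping.single W 1"

lemma lookup_ev: "Poly_Mapping.lookup (ev W) V = (if V = W then 1 else 0)"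
  by (simp add: ev_def lookup_single when_def)

lemma keys_ev [simp]: "Poly_Mapping.keys (ev W) = {W}"
  by (simp add: ev_def)

lemma ev_neq_0 [simp]: "ev W \<noteq> 0"
  by (metis keys_ev keys_zero insert_not_empty)

lemma keys_scv: "Poly_Mapping.keys (scv x v) \<subseteq> Poly_Mapping.keys v"
  by (auto simp: in_keys_iff)

lemma keys_sum_subset: "Poly_Mapping.keys (sum f A) \<subseteq> (\<Union>x\<in>A. Poly_Mapping.keys (f x))"
proof (induct A rule: infinite_finite_induct)
  case (insert x A)
  then show ?case using keys_add[of "f x" "sum f A"] by auto
qed auto

lemma wvec_expand: "v = (\<Sum>W\<in>Poly_Mapping.keys v. scv (Poly_Mapping.lookup v W) (ev W))"
proof (rule poly_mapping_eqI)
  fix V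
  have "(\<Sum>W\<in>Poly_Mapping.keys v. Poly_Mapping.lookup v W * (if V = W then 1 else 0))
     = Poly_Mapping.lookup v V"
    by (cases "V \<in> Poly_Mapping.keys v") (auto simp: in_keys_iff if_distrib sum.delta cong: if_cong)
  then show "Poly_Mapping.lookup v V = Poly_Mapping.lookup (\<Sum>W\<in>Poly_Mapping.keys v. scv (Poly_Mapping.lookup v W) (ev W)) V"
    by (simp add: lookup_sum lookup_ev)
qed

text \<open>Linear extension into an arbitrary space over the complex numbers, so that it yields the
  modes, the module maps and, with \<open>sc\<close> the product of numbers, functionals.\<close>

definition wlin :: "(complex \<Rightarrow> 'v::ab_group_add \<Rightarrow> 'v) \<Rightarrow> ('a \<Rightarrow> 'v) \<Rightarrow> ('a \<Rightarrow>\<^sub>0 complex) \<Rightarrow> 'v" where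
  "wlin sc g v = (\<Sum>W\<in>Poly_Mapping.keys v. sc (Poly_Mapping.lookup v W) (g W))"

lemma wlin_superset:
  assumes "vector_space sc" "finite A" "Poly_Mapping.keys v \<subseteq> A"
  shows "wlin sc g v = (\<Sum>W\<in>A. sc (Poly_Mapping.lookup v W) (g W))"
proof -
  interpret vector_space sc by fact
  show ?thesis
    unfolding wlin_def using assms(2,3)
    by (intro sum.mono_neutral_left) (auto simp: in_keys_iff)
qed

lemma wlin_linear:
  assumes "vector_space sc"
  shows "Vector_Spaces.linear scv sc (wlin sc (g :: 'a \<Rightarrow> 'v::ab_group_add))"
proof -
  interpret vector_space sc by fact
  show ?thesis
  proof unfold_locales
    fix v w :: "'a \<Rightarrow>\<^sub>0 complex" and x
    let ?A = "Poly_Mapping.keys v \<union> Poly_Mapping.keys w"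
    have "Poly_Mapping.keys (v + w) \<subseteq> ?A" by (rule keys_add)
    then show "wlin sc g (v + w) = wlin sc g v + wlin sc g w"
      by (simp add: wlin_superset[OF assms, where A = ?A] lookup_add scale_left_distrib sum.distrib)
    show "wlin sc g (scv x v) = sc x (wlin sc g v)"
      by (subst wlin_superset[OF assms finite_keys keys_scv]) (simp add: scale_sum_right wlin_def)
  qed
qed

lemma wlin_ev [simp]:
  assumes "vector_space sc"
  shows "wlin sc g (ev W) = g W"
proof -
  interpret vector_space sc by fact
  show ?thesis by (simp add: wlin_def lookup_ev)
qed

lemma linear_eq_on_keys:
  assumes f: "Vector_Spaces.linear scv sc f" and g: "Vector_Spaces.linear scv sc g"
    and eq: "\<And>W. W \<in> Poly_Mapping.keys v \<Longrightarrow> f (ev W) = g (ev W)"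
  shows "f v = g v"
proof -
  interpret f: Vector_Spaces.linear scv sc f by fact
  interpret g: Vector_Spaces.linear scv sc g by fact
  have "f (\<Sum>W\<in>Poly_Mapping.keys v. scv (Poly_Mapping.lookup v W) (ev W))
      = g (\<Sum>W\<in>Poly_Mapping.keys v. scv (Poly_Mapping.lookup v W) (ev W))"
    by (simp add: f.sum g.sum f.scale g.scale eq)
  then show ?thesis by (simp flip: wvec_expand)
qed

text \<open>The word $a_1 \dots a_k$ stands for $J_{a_1}\cdots J_{a_k}$ applied to a highest weight vector that is killed by J a
  for a at least th (up to the weight h): th = 0 gives the Verma module and th = -2 the vacuum module.\<close>

locale pbw =
  fixes c h :: complex and th :: int
  assumes th: "th = 0 \<or> (th = -2 \<and> h = 0)"
begin

text \<open>Straightening of J a applied to an ordered word: put a in front if this is in order,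
  replace the square of an odd mode by an even mode, or move a past b. In the last case a word N
  longer than M has no letters other than a and those of M, so \<open>b # N\<close> is already
  ordered; only the shorter N need a recursive call, and so the length decreases.\<close>

function act :: "int \<Rightarrow> int list \<Rightarrow> wvec" where
  "act a [] = (if a < th then ev [a] else scv (if a = 0 then h else 0) (ev []))"
| "act a (b # M) =
    (if a < th \<and> (a < b \<or> (a = b \<and> even a)) then ev (a # b # M)
     else if a = b then act (2 * a) M
     else scv (ns_sg a b) (\<Sum>N\<in>Poly_Mapping.keys (act a M). scv (Poly_Mapping.lookup (act a M) N)
              (if length N > length M then ev (b # N) else act b N))
          + scv (ns_st a b) (act (a + b) M) + scv (ns_ct c a b) (ev M))"
  by pat_completeness auto
termination by (relation "measure (\<lambda>(a, W). length W)") auto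

declare act.simps [simp del]

text \<open>Even letters may repeat and odd ones may not, because the square of an odd mode is an
  even mode.\<close>

fun valid :: "int list \<Rightarrow> bool" where
  "valid [] = True"
| "valid (a # W) = (a < th \<and> (\<forall>x\<in>set W. a < x \<or> (a = x \<and> even a)) \<and> valid W)"

definition carrier :: "wvec set" where
  "carrier = {v. \<forall>W\<in>Poly_Mapping.keys v. valid W}"

definition J :: "int \<Rightarrow> wvec \<Rightarrow> wvec" where
  "J a = wlin scv (act a)"

lemma wvs: "vector_space scv" ..

lemma J_linear: "Vector_Spaces.linear scv scv (J a)"
  unfolding J_def by (rule wlin_linear) (rule wvs)

lemma J_add: "J a (v + w) = J a v + J a w"
  using J_linear by (simp add: Vector_Spaces.linear_iff)

lemma J_scale: "J a (scv x v) = scv x (J a v)"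
  using J_linear by (simp add: Vector_Spaces.linear_iff)

lemma J_zero [simp]: "J a 0 = 0"
  by (simp add: J_def wlin_def)

lemma J_ev: "J a (ev W) = act a W"
  by (simp add: J_def wvs)

lemma valid_lt: "valid W \<Longrightarrow> x \<in> set W \<Longrightarrow> x < th"
  by (induct W) auto

text \<open>Justifies the shortcut in \<open>act\<close>: when straightening lengthens a word, no
  new letters appear, so a smaller letter can be put in front without further sorting.\<close>

lemma act_keys:
  assumes "valid M" "N \<in> Poly_Mapping.keys (act a M)"
  shows "valid N \<and> length N \<le> Suc (length M) \<and> (length N = Suc (length M) \<longrightarrow> set N \<subseteq> insert a (set M))"
  using assms
proof (induct M arbitrary: a N rule: length_induct)
  case (1 W)
  show ?case
  proof (cases W)
    case Nil
    have "Poly_Mapping.keys (scv x (ev [])) \<subseteq> {[]}" for x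
      using keys_scv[of x "ev []"] by simp
    with Nil show ?thesis using 1
      by (fastforce simp: act.simps split: if_splits)
  next
    case (Cons b M)
    have vM: "valid M" "b < th" and bM: "\<And>x. x \<in> set M \<Longrightarrow> b < x \<or> (b = x \<and> even b)"
      using 1 Cons by auto
    have IH: "valid N' \<and> length N' \<le> Suc (length M') \<and> (length N' = Suc (length M') \<longrightarrow> set N' \<subseteq> insert a' (set M'))"
      if "length M' \<le> length M" "valid M'" "N' \<in> Poly_Mapping.keys (act a' M')" for a' M' N'
      using 1(1)[rule_format, of M' N' a'] that Cons by simp
    consider (a) "a < th" "a < b \<or> (a = b \<and> even a)"
      | (b) "\<not> (a < th \<and> (a < b \<or> (a = b \<and> even a)))" "a = b"
      | (c) "\<not> (a < th \<and> (a < b \<or> (a = b \<and> even a)))" "a > b"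
      using vM by force
    then show ?thesis
    proof cases
      case a
      then show ?thesis using 1 Cons bM vM by (force simp: act.simps)
    next
      case b
      then have "N \<in> Poly_Mapping.keys (act (2 * a) M)" using 1 Cons by (simp add: act.simps)
      from IH[OF _ vM(1) this] show ?thesis using Cons by auto
    next
      case c
      let ?S = "\<Sum>N\<in>Poly_Mapping.keys (act a M). scv (Poly_Mapping.lookup (act a M) N)
              (if length N > length M then ev (b # N) else act b N)"
      have "N \<in> Poly_Mapping.keys (scv (ns_sg a b) ?S + scv (ns_st a b) (act (a + b) M) + scv (ns_ct c a b) (ev M))"
        using 1 Cons c by (auto simp: act.simps)
      then have "N \<in> Poly_Mapping.keys ?S \<or> N \<in> Poly_Mapping.keys (act (a + b) M) \<or> N = M"
        by (rule contrapos_pp) (auto simp: in_keys_iff lookup_add lookup_ev)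
      then show ?thesis
      proof (elim disjE)
        assume "N \<in> Poly_Mapping.keys ?S"
        then obtain N' where N': "N' \<in> Poly_Mapping.keys (act a M)"
          "N \<in> Poly_Mapping.keys (if length N' > length M then ev (b # N') else act b N')"
          using keys_sum_subset keys_scv by (smt (verit) UN_iff subset_iff)
        note I = IH[OF _ vM(1) N'(1), simplified]
        show ?thesis
        proof (cases "length N' > length M")
          case True
          then have "N = b # N'" "set N' \<subseteq> insert a (set M)" using N' I by auto
          then show ?thesis using I bM vM c Cons by auto
        next
          case False
          then show ?thesis using IH[of N' N b] N' I Cons by auto
        qed
      next
        assume "N \<in> Poly_Mapping.keys (act (a + b) M)"
        from IH[OF _ vM(1) this] show ?thesis using Cons by auto
      qed (use Cons vM in auto)
    qed
  qed
qed

lemma act_in_order: "valid (a # W) \<Longrightarrow> act a W = ev (a # W)"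
  by (cases W) (auto simp: act.simps)

lemma J_in_order: "valid (a # W) \<Longrightarrow> J a (ev W) = ev (a # W)"
  by (simp add: J_ev act_in_order)

lemma J_empty: "a \<ge> th \<Longrightarrow> J a (ev []) = scv (if a = 0 then h else 0) (ev [])"
  by (simp add: J_ev act.simps)

lemma valid_cases:
  assumes "valid (b # M)"
  obtains "valid (a # b # M)" | "a = b" "odd a" | "a > b"
proof -
  have "valid (a # b # M)" if "a < b \<or> (a = b \<and> even a)"
    using assms that by force
  then show ?thesis using that by linarith
qed

lemma J_square: "valid (a # W) \<Longrightarrow> odd a \<Longrightarrow> J a (J a (ev W)) = J (2 * a) (ev W)"
  by (simp add: J_ev act_in_order) (simp add: act.simps)

lemma J_swap:
  assumes v: "valid (b # M)" and ab: "a > b"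
  shows "J a (J b (ev M)) = scv (ns_sg a b) (J b (J a (ev M))) + scv (ns_st a b) (J (a + b) (ev M))
           + scv (ns_ct c a b) (ev M)"
proof -
  have "(if length N > length M then ev (b # N) else act b N) = act b N"
    if "N \<in> Poly_Mapping.keys (act a M)" for N
  proof (cases "length N > length M")
    case True
    have "valid M" using v by simp
    from act_keys[OF this that] True have "valid N" "set N \<subseteq> insert a (set M)" by auto
    then have "valid (b # N)" using v ab by auto
    then show ?thesis by (simp add: act_in_order)
  qed auto
  then have "(\<Sum>N\<in>Poly_Mapping.keys (act a M). scv (Poly_Mapping.lookup (act a M) N)
              (if length N > length M then ev (b # N) else act b N)) = J b (J a (ev M))"
    unfolding J_ev unfolding J_def wlin_def by (intro sum.cong) auto
  then show ?thesis
    using ab by (simp add: J_ev act_in_order[OF v] act.simps(2))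
qed

section \<open>Commutation relations on ordered words\<close>

definition rel :: "int \<Rightarrow> int \<Rightarrow> wvec \<Rightarrow> bool" where
  "rel a b v \<longleftrightarrow> J a (J b v) = scv (ns_sg a b) (J b (J a v)) + scv (ns_st a b) (J (a + b) v)
           + scv (ns_ct c a b) v"

lemma rel_lookup: "rel a b v \<longleftrightarrow> (\<forall>N. Poly_Mapping.lookup (J a (J b v)) N =
     ns_sg a b * Poly_Mapping.lookup (J b (J a v)) N + ns_st a b * Poly_Mapping.lookup (J (a + b) v) N
           + ns_ct c a b * Poly_Mapping.lookup v N)"
  by (auto simp: rel_def poly_mapping_eq_iff fun_eq_iff lookup_add)

lemma rel_sym:
  assumes "rel a b v"
  shows "rel b a v"
  unfolding rel_lookup ns_sg_commute[of b a] ns_st_commute[of b a] ns_ct_commute[of c b a] add.commute[of b a]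
proof
  fix N
  have "Poly_Mapping.lookup (J a (J b v)) N =
     ns_sg a b * Poly_Mapping.lookup (J b (J a v)) N + ns_st a b * Poly_Mapping.lookup (J (a + b) v) N
           + ns_ct c a b * Poly_Mapping.lookup v N" using assms by (simp add: rel_lookup)
  moreover have "ns_sg a b * ns_sg a b = 1" by simp
  ultimately show "Poly_Mapping.lookup (J b (J a v)) N =
     ns_sg a b * Poly_Mapping.lookup (J a (J b v)) N + (- ns_sg a b * ns_st a b) * Poly_Mapping.lookup (J (a + b) v) N
           + (- ns_sg a b * ns_ct c a b) * Poly_Mapping.lookup v N" by algebra
qed

lemma rel_on_keys:
  assumes "\<And>N. N \<in> Poly_Mapping.keys v \<Longrightarrow> rel a b (ev N)"
  shows "rel a b v"
proof -
  let ?f = "\<lambda>v. J a (J b v)"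
  let ?g = "\<lambda>v. scv (ns_sg a b) (J b (J a v)) + scv (ns_st a b) (J (a + b) v) + scv (ns_ct c a b) v"
  have "Vector_Spaces.linear scv scv ?f"
    by (simp add: Vector_Spaces.linear_iff wvs J_add J_scale)
  moreover have "Vector_Spaces.linear scv scv ?g"
    by (simp add: Vector_Spaces.linear_iff wvs J_add J_scale algebra_simps)
  ultimately show ?thesis
    unfolding rel_def by (rule linear_eq_on_keys) (use assms rel_def in auto)
qed

text \<open>Expanding all products by the relations on e, and moving d to the front by the two extra
  hypotheses, leaves exactly the super Jacobi identity of a, b and d.\<close>

lemma rel_step:
  assumes M: "\<And>x y. rel x y e" and 2: "rel a d (J b e)" and 4: "rel b d (J a e)"
  shows "rel a b (J d e)"
  unfolding rel_lookup
proof
  fix N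
  let ?l = "\<lambda>v :: wvec. Poly_Mapping.lookup v N"
  note r1 = M[of b d, unfolded rel_def] and r5 = M[of a d, unfolded rel_def]
  have E1: "?l (J a (J b (J d e))) = ns_sg b d * ?l (J a (J d (J b e))) + ns_st b d * ?l (J a (J (b + d) e)) + ns_ct c b d * ?l (J a e)"
    unfolding r1 by (simp add: J_add J_scale lookup_add)
  have E2: "?l (J a (J d (J b e))) = ns_sg a d * ?l (J d (J a (J b e))) + ns_st a d * ?l (J (a + d) (J b e)) + ns_ct c a d * ?l (J b e)"
    using 2 by (simp add: rel_lookup)
  have E3: "?l (J d (J a (J b e))) = ns_sg a b * ?l (J d (J b (J a e))) + ns_st a b * ?l (J d (J (a + b) e)) + ns_ct c a b * ?l (J d e)"
    unfolding M[of a b, unfolded rel_def] by (simp add: J_add J_scale lookup_add)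
  have E4: "?l (J b (J d (J a e))) = ns_sg b d * ?l (J d (J b (J a e))) + ns_st b d * ?l (J (b + d) (J a e)) + ns_ct c b d * ?l (J a e)"
    using 4 by (simp add: rel_lookup)
  have E5: "?l (J b (J a (J d e))) = ns_sg a d * ?l (J b (J d (J a e))) + ns_st a d * ?l (J b (J (a + d) e)) + ns_ct c a d * ?l (J b e)"
    unfolding r5 by (simp add: J_add J_scale lookup_add)
  have E6: "?l (J a (J (b + d) e)) = (ns_sg a b * ns_sg a d) * ?l (J (b + d) (J a e)) + ns_st a (b + d) * ?l (J (a + b + d) e) + ns_ct c a (b + d) * ?l e"
    using M[of a "b + d"] ns_sg_add[of b d a] by (simp add: rel_lookup ns_sg_commute[of _ a] add.assoc)
  have E7: "?l (J b (J (a + d) e)) = (ns_sg a b * ns_sg b d) * ?l (J (a + d) (J b e)) + ns_st b (a + d) * ?l (J (a + b + d) e) + ns_ct c b (a + d) * ?l e"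
    using M[of b "a + d"] ns_sg_add[of a d b] by (simp add: rel_lookup ns_sg_commute[of _ b] ac_simps)
  have E8: "?l (J (a + b) (J d e)) = (ns_sg a d * ns_sg b d) * ?l (J d (J (a + b) e)) + ns_st (a + b) d * ?l (J (a + b + d) e) + ns_ct c (a + b) d * ?l e"
    using M[of "a + b" d] ns_sg_add[of a b d] by (simp add: rel_lookup)
  have s: "ns_sg a b * ns_sg a b = 1" "ns_sg a d * ns_sg a d = 1" "ns_sg b d * ns_sg b d = 1" by simp_all
  \<comment> \<open>A central constant vanishes unless its two modes are opposite, hence of equal
    parity; the signs then agree.\<close>
  have z: "ns_sg a d * ns_sg b d * ns_ct c a b = ns_ct c a b"
    "ns_sg b d * ns_ct c a d = ns_sg a b * ns_ct c a d"
    "ns_sg a b * ns_sg a d * ns_ct c b d = ns_ct c b d"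
    by (auto simp: ns_ct_def ns_sg_def) (presburger+)?
  have "ns_st b d * ns_st a (b + d) * ?l (J (a + b + d) e) = (ns_sg a b * ns_st a d * ns_st b (a + d) + ns_st a b * ns_st (a + b) d) * ?l (J (a + b + d) e)"
    "ns_st b d * ns_ct c a (b + d) * ?l e = (ns_sg a b * ns_st a d * ns_ct c b (a + d) + ns_st a b * ns_ct c (a + b) d) * ?l e"
    by (simp_all only: ns_jacobi ns_jacobi_central)
  then show "?l (J a (J b (J d e))) = ns_sg a b * ?l (J b (J a (J d e))) + ns_st a b * ?l (J (a + b) (J d e)) + ns_ct c a b * ?l (J d e)"
    unfolding E1 E2 E3 E5 E4 E6 E7 E8 using s z by algebra
qed

text \<open>Here the odd letter d already stands in front. The normal form replaces its square by J
  (2 d), so the relation of a with d on J d e comes down to the relation of a with 2 d. The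
  constants match by the Jacobi identity for d, d, a.\<close>

lemma rel_step_odd:
  assumes d: "odd d" and F1: "J d (J d e) = J (2 * d) e" and F2: "rel d d (J a e)"
    and F3: "rel a (2 * d) e" and F4: "rel a d e" and F5: "rel d (a + d) e"
  shows "rel a d (J d e)"
  unfolding rel_lookup
proof
  fix N
  let ?l = "\<lambda>v :: wvec. Poly_Mapping.lookup v N"
  have d0: "d \<noteq> 0" "d + d = 2 * d" using d by auto
  have E1: "?l (J a (J d (J d e))) = ?l (J (2 * d) (J a e)) + ns_st a (2 * d) * ?l (J (a + 2 * d) e) + ns_ct c a (2 * d) * ?l e"
    using F3 by (simp add: F1 rel_lookup ns_sg_def)
  have E2: "?l (J d (J a (J d e))) = ns_sg a d * ?l (J d (J d (J a e))) + ns_st a d * ?l (J d (J (a + d) e)) + ns_ct c a d * ?l (J d e)"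
    unfolding F4[unfolded rel_def] by (simp add: J_add J_scale lookup_add)
  have E3: "?l (J d (J d (J a e))) = ?l (J (2 * d) (J a e))"
    using F2 d d0 by (auto simp: rel_lookup ns_sg_def ns_st_def ns_ct_def)
  have sg: "ns_sg d (a + d) = - ns_sg a d" using d by (auto simp: ns_sg_def)
  have E4: "?l (J d (J (a + d) e)) = - ns_sg a d * ?l (J (a + d) (J d e)) + ns_st d (a + d) * ?l (J (a + 2 * d) e) + ns_ct c d (a + d) * ?l e"
    using F5 sg d0 by (simp add: rel_lookup algebra_simps)
  have s: "ns_sg a d * ns_sg a d = 1" by simp
  have z: "ns_sg a d * ns_ct c a d + ns_ct c a d = 0"
  proof (cases "a + d = 0")
    case True
    then have "odd a" using d by presburger
    then show ?thesis using d by (simp add: ns_sg_def)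
  qed (simp add: ns_ct_def)
  have d2: "ns_st d d = 2" using d by (simp add: ns_st_def)
  have Z: "ns_st (a + d) d = ns_sg a d * ns_st d (a + d)" "ns_ct c (a + d) d = ns_sg a d * ns_ct c d (a + d)"
    using ns_st_commute[of "a + d" d] ns_ct_commute[of c "a + d" d] by (simp_all add: sg)
  have "2 * ns_st a (2 * d) = 2 * (ns_sg a d * ns_st a d * ns_st d (a + d))"
    using ns_jacobi[of d d a] by (simp add: d2 d0 Z)
  then have st: "ns_st a (2 * d) = ns_sg a d * ns_st a d * ns_st d (a + d)" by simp
  have "2 * ns_ct c a (2 * d) = 2 * (ns_sg a d * ns_st a d * ns_ct c d (a + d))"
    using ns_jacobi_central[of d d c a] by (simp add: d2 d0 Z)
  then have ct: "ns_ct c a (2 * d) = ns_sg a d * ns_st a d * ns_ct c d (a + d)" by simp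
  show "?l (J a (J d (J d e))) = ns_sg a d * ?l (J d (J a (J d e))) + ns_st a d * ?l (J (a + d) (J d e)) + ns_ct c a d * ?l (J d e)"
    unfolding E1 E2 E3 E4 st ct using s z by algebra
qed

lemma rel_head:
  assumes v: "valid (b # M)" and ab: "a \<ge> b"
  shows "rel a b (ev M)"
proof (cases "a = b")
  case True
  show ?thesis
  proof (cases "even b")
    case True
    then show ?thesis using \<open>a = b\<close> th v
      by (auto simp: rel_def ns_sg_def ns_st_def ns_ct_def)
  next
    case False
    have "J b (J b (ev M)) = J (2 * b) (ev M)" using J_square[OF v False] .
    moreover have "b + b = 2 * b" "b \<noteq> 0" using False by auto
    ultimately show ?thesis using \<open>a = b\<close> False
      by (auto simp: rel_lookup ns_sg_def ns_st_def ns_ct_def)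
  qed
next
  case False
  then show ?thesis using J_swap[OF v, of a] ab by (simp add: rel_def)
qed

text \<open>Words of the normal form that are one letter longer than M can be prefixed with b
  directly; all others fall under the induction hypothesis on the length.\<close>

lemma rel_J_ev:
  assumes v: "valid M" and b: "b < th" "\<And>x. x \<in> insert a (set M) \<Longrightarrow> b < x \<or> (b = x \<and> even b)"
    and IH: "\<And>N x y. valid N \<Longrightarrow> length N \<le> length M \<Longrightarrow> rel x y (ev N)"
    and d: "d \<ge> b"
  shows "rel d b (J a (ev M))"
proof (rule rel_on_keys)
  fix N assume "N \<in> Poly_Mapping.keys (J a (ev M))"
  then have N: "valid N" "length N \<le> Suc (length M)"
    "length N = Suc (length M) \<Longrightarrow> set N \<subseteq> insert a (set M)"
    using act_keys[OF v, of N a] by (auto simp: J_ev)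
  show "rel d b (ev N)"
  proof (cases "length N = Suc (length M)")
    case True
    then have "valid (b # N)" using N b by auto
    then show ?thesis using rel_head d by blast
  next
    case False
    then show ?thesis using N IH by simp
  qed
qed

lemma rel_ev: "valid W \<Longrightarrow> rel a b (ev W)"
proof (induct "length W" arbitrary: W a b rule: less_induct)
  case less
  have *: "rel a b (ev W)" if ab: "a \<ge> b" for a b
  proof (cases "valid (b # W)")
    case True
    then show ?thesis using rel_head ab by blast
  next
    case False
    show ?thesis
    proof (cases W)
      case Nil
      then have b: "b \<ge> th" "a \<ge> th" using False ab by auto
      consider "a + b \<ge> th" "a + b \<noteq> 0" | "a + b = 0" | "th = -2" "h = 0" "a + b < -2" using th b by fastforce
      then show ?thesis
      proof cases
        case 1
        then show ?thesis using th b Nil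
          by (auto simp: rel_lookup J_empty J_scale ns_sg_def ns_st_def ns_ct_def)
      next
        case 2
        then have "a = 0 \<and> b = 0 \<or> th = -2 \<and> h = 0 \<and> (a = 1 \<and> b = -1 \<or> a = 2 \<and> b = -2)"
          using th b ab by auto
        then show ?thesis using b Nil
          by (auto simp: rel_lookup J_empty J_scale ns_sg_def ns_st_def ns_ct_def field_simps)
      next
        \<comment> \<open>Here J (a + b) does not kill the vacuum, but its structure constant is
          zero: L_{-1} commutes with itself and with G_{-1/2}.\<close>
        case 3
        then have "(a = -1 \<and> b = -2) \<or> (a = -2 \<and> b = -2)" using ab b by auto
        moreover have "J x (ev []) = 0" if "x \<ge> -2" for x using J_empty[of x] 3 that by simp
        ultimately show ?thesis using Nil
          by (auto simp: rel_lookup ns_sg_def ns_st_def ns_ct_def)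
      qed
    next
      case (Cons d M)
      have vd: "valid (d # M)" "valid M" using less(2) Cons by auto
      have IH: "rel x y (ev N)" if "valid N" "length N \<le> length M" for N x y
        using less(1)[of N] that Cons by simp
      have bd: "b > d \<or> (b = d \<and> odd d)" using False vd Cons by force
      have e: "ev W = J d (ev M)" using J_in_order[OF vd(1)] Cons by simp
      show ?thesis
      proof (cases "b > d")
        case True
        have "rel a d (J b (ev M))" "rel b d (J a (ev M))"
          using True ab vd by (auto intro!: rel_J_ev IH)
        then show ?thesis unfolding e by (rule rel_step[OF IH[OF vd(2) order_refl]])
      next
        case False
        then have bd: "b = d" "odd d" using bd by auto
        have odd': "b \<noteq> 0" "d + d = 2 * d" using bd by auto
        show ?thesis
        proof (cases "a = b")
          case True
          have "rel d (2 * d) (ev M)" using IH vd by auto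
          then have "J d (J (2 * d) (ev M)) = J (2 * d) (J d (ev M))"
            using bd by (auto simp: rel_def ns_sg_def ns_st_def ns_ct_def)
          then have "J d (J d (J d (ev M))) = J (2 * d) (J d (ev M))"
            using J_square[OF vd(1) bd(2)] by simp
          then show ?thesis unfolding e using True bd odd'
            by (auto simp: rel_lookup ns_sg_def ns_st_def ns_ct_def)
        next
          case False
          then have ad: "a > d" using ab bd by simp
          have r: "rel d d (J a (ev M))"
            using vd ad bd by (auto intro!: rel_J_ev IH)
          have F: "rel a (2 * d) (ev M)" "rel a d (ev M)" "rel d (a + d) (ev M)"
            using IH vd by auto
          show ?thesis unfolding e bd(1) by (rule rel_step_odd[OF bd(2) J_square[OF vd(1) bd(2)] r F])
        qed
      qed
    qed
  qed
  show ?case using *[of a b] *[of b a] rel_sym by fastforce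
qed

lemma rel_carrier: "v \<in> carrier \<Longrightarrow> rel a b v"
  by (rule rel_on_keys) (auto simp: carrier_def rel_ev)

lemma carrier_subspace: "wv.subspace carrier"
proof (rule wv.subspaceI)
  show "0 \<in> carrier" by (simp add: carrier_def)
  show "v + w \<in> carrier" if "v \<in> carrier" "w \<in> carrier" for v w
    using that keys_add[of v w] unfolding carrier_def by blast
  show "scv x v \<in> carrier" if "v \<in> carrier" for x v
    using that keys_scv[of x v] unfolding carrier_def by blast
qed

lemma ev_in_carrier [simp]: "ev W \<in> carrier \<longleftrightarrow> valid W"
  by (simp add: carrier_def)

lemma J_in_carrier:
  assumes "v \<in> carrier"
  shows "J a v \<in> carrier"
proof -
  have "act a W \<in> carrier" if "W \<in> Poly_Mapping.keys v" for W
    using act_keys[of W _ a] that assms by (auto simp: carrier_def)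
  then show ?thesis
    unfolding J_def wlin_def
    by (intro wv.subspace_sum[OF carrier_subspace] wv.subspace_scale[OF carrier_subspace])
qed

sublocale ns_rep scv carrier c J
proof unfold_locales
  show "wv.subspace carrier" by (rule carrier_subspace)
  show "J a v \<in> carrier" if "v \<in> carrier" for a v using that by (rule J_in_carrier)
  show "J a (v + w) = J a v + J a w" for a v w by (rule J_add)
  show "J a (scv x v) = scv x (J a v)" for a x v by (rule J_scale)
  show "J a (J b v) = scv (ns_sg a b) (J b (J a v)) + scv (ns_st a b) (J (a + b) v) + scv (ns_ct c a b) v"
    if "v \<in> carrier" for a b v using rel_carrier[OF that] unfolding rel_def .
qed

end

section \<open>Universal property of the highest weight modules\<close>

locale pbw_map = pbw c h th + R: ns_rep sc S c K
  for c h th and sc :: "complex \<Rightarrow> 'v::ab_group_add \<Rightarrow> 'v" and S K +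
  fixes w :: 'v
  assumes w: "w \<in> S" and K_w: "a \<ge> th \<Longrightarrow> K a w = sc (if a = 0 then h else 0) w"
begin

definition hom :: "wvec \<Rightarrow> 'v" where
  "hom = wlin sc (\<lambda>W. foldr K W w)"

lemma hom_linear: "Vector_Spaces.linear scv sc hom"
  unfolding hom_def by (rule wlin_linear) (rule R.vector_space_axioms)

lemma hom_ev: "hom (ev W) = foldr K W w"
  by (simp add: hom_def R.vector_space_axioms)

lemma hom_add: "hom (v + v') = hom v + hom v'"
  and hom_scale: "hom (scv x v) = sc x (hom v)"
  using hom_linear by (simp_all add: Vector_Spaces.linear_iff)

lemma foldr_K_closed: "foldr K W w \<in> S"
  by (induct W) (auto intro: w R.J_closed)

lemma hom_closed: "hom v \<in> S"
  unfolding hom_def wlin_def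
  by (intro R.subspace_sum[OF R.S_subspace] R.subspace_scale[OF R.S_subspace] foldr_K_closed)

lemma hom_J_ev: "valid W \<Longrightarrow> hom (J a (ev W)) = K a (hom (ev W))"
proof (induct "length W" arbitrary: W a rule: less_induct)
  case less
  have lin: "Vector_Spaces.linear scv sc (\<lambda>v. hom (J b v))" "Vector_Spaces.linear scv sc (\<lambda>v. K b (hom v))" for b
    by (simp_all add: Vector_Spaces.linear_iff wvs R.vector_space_axioms J_add J_scale hom_add hom_scale R.J_add R.J_scale)
  show ?case
  proof (cases W)
    case Nil
    then show ?thesis
      by (cases "a < th") (simp_all add: J_in_order J_empty hom_ev hom_scale K_w)
  next
    case (Cons b M)
    have v: "valid (b # M)" "valid M" using less(2) Cons by auto
    have M: "foldr K M w \<in> S" by (rule foldr_K_closed)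
    have IH: "hom (J x (ev N)) = K x (hom (ev N))" if "valid N" "length N \<le> length M" for x N
      using less(1) that Cons by auto
    consider (a) "valid (a # b # M)" | (b) "a = b" "odd a" | (c) "a > b"
      using valid_cases[OF v(1)] by blast
    then show ?thesis
    proof cases
      case a
      then show ?thesis using Cons by (simp add: J_in_order[OF a] hom_ev)
    next
      case b
      have "hom (J a (ev W)) = hom (J (2 * a) (ev M))"
        using J_square[OF v(1)] J_in_order[OF v(1)] b Cons by simp
      also have "\<dots> = K (2 * a) (foldr K M w)" using IH v by (simp add: hom_ev)
      also have "\<dots> = K a (K a (foldr K M w))"
      proof -
        have "b + b \<noteq> 0" "b + b = 2 * b" using b by auto
        then have "K a (K a (foldr K M w)) + K a (K a (foldr K M w)) = sc 2 (K (2 * a) (foldr K M w))"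
          using R.J_rel[OF M, of a a] b by (simp add: ns_sg_def ns_st_def ns_ct_def eq_diff_eq)
        then have "sc 2 (K a (K a (foldr K M w))) = sc 2 (K (2 * a) (foldr K M w))"
          by (metis R.scale_left_distrib R.scale_one one_add_one)
        then show ?thesis by simp
      qed
      finally show ?thesis using Cons b by (simp add: hom_ev)
    next
      case c
      have swap: "hom (J b (J a (ev M))) = K b (hom (J a (ev M)))"
      proof (rule linear_eq_on_keys[OF lin])
        fix N assume "N \<in> Poly_Mapping.keys (J a (ev M))"
        then have N: "valid N" "length N \<le> Suc (length M)"
          "length N = Suc (length M) \<Longrightarrow> set N \<subseteq> insert a (set M)"
          using act_keys[OF v(2), of N a] by (auto simp: J_ev)
        show "hom (J b (ev N)) = K b (hom (ev N))"
        proof (cases "length N = Suc (length M)")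
          case True
          then have "valid (b # N)" using N v c by auto
          then show ?thesis by (simp add: J_in_order hom_ev)
        qed (use N IH in auto)
      qed
      have "hom (J a (ev W)) = hom (J a (J b (ev M)))" using J_in_order[OF v(1)] Cons by simp
      also have "\<dots> = sc (ns_sg a b) (K b (K a (foldr K M w))) + sc (ns_st a b) (K (a + b) (foldr K M w))
           + sc (ns_ct c a b) (foldr K M w)"
        by (simp add: J_swap[OF v(1) c] hom_add hom_scale swap IH v hom_ev)
      also have "\<dots> = K a (hom (ev W))"
        using R.J_rel[OF M, of a b] Cons by (simp add: hom_ev)
      finally show ?thesis .
    qed
  qed
qed

lemma hom_J:
  assumes "v \<in> carrier"
  shows "hom (J a v) = K a (hom v)"
proof -
  have "Vector_Spaces.linear scv sc (\<lambda>v. hom (J a v))" "Vector_Spaces.linear scv sc (\<lambda>v. K a (hom v))"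
    by (simp_all add: Vector_Spaces.linear_iff wvs R.vector_space_axioms J_add J_scale hom_add hom_scale R.J_add R.J_scale)
  then show ?thesis
    by (rule linear_eq_on_keys) (use assms in \<open>auto simp: carrier_def hom_J_ev\<close>)
qed

end

section \<open>Weights, leading words and singular vectors\<close>

context pbw
begin

definition wt :: "int list \<Rightarrow> complex" where
  "wt W = - of_int (sum_list W) / 2"

lemma th_le_0: "th \<le> 0"
  using th by auto

lemma even_th: "even th"
  using th by auto

lemma J0_ev: "valid W \<Longrightarrow> J 0 (ev W) = scv (h + wt W) (ev W)"
proof (induct W)
  case Nil
  then show ?case using th_le_0 by (simp add: J_empty wt_def)
next
  case (Cons b M)
  then have v: "valid M" "b < 0" using th_le_0 by auto
  have e: "ev (b # M) = J b (ev M)" using J_in_order[OF Cons(2)] by simp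
  have "ns_ct c 0 b = 0" "ns_sg 0 b = 1" "ns_st 0 b = - of_int b / 2"
    using v by (auto simp: ns_ct_def ns_sg_def ns_st_def)
  then have "J 0 (J b (ev M)) = J b (J 0 (ev M)) + scv (- of_int b / 2) (J b (ev M))"
    using J_rel[of "ev M" 0 b] v by simp
  moreover have "h + wt (b # M) = (h + wt M) + - of_int b / 2"
    by (simp add: wt_def field_simps)
  ultimately show ?case
    unfolding e using Cons(1)[OF v(1)] by (simp only: J_scale J_add wv.scale_left_distrib)
qed

lemma lookup_J0: "v \<in> carrier \<Longrightarrow> Poly_Mapping.lookup (J 0 v) W = (h + wt W) * Poly_Mapping.lookup v W"
proof -
  assume v: "v \<in> carrier"
  have "J 0 v = (\<Sum>W\<in>Poly_Mapping.keys v. scv (Poly_Mapping.lookup v W) (J 0 (ev W)))"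
    unfolding J_ev by (simp add: J_def wlin_def)
  also have "\<dots> = (\<Sum>W\<in>Poly_Mapping.keys v. scv (Poly_Mapping.lookup v W * (h + wt W)) (ev W))"
    by (rule sum.cong) (use v in \<open>auto simp: carrier_def J0_ev\<close>)
  finally have "J 0 v = \<dots>" .
  then show ?thesis
    by (cases "W \<in> Poly_Mapping.keys v")
       (auto simp: lookup_sum lookup_ev in_keys_iff if_distrib sum.delta cong: if_cong)
qed

lemma wt_eigen:
  assumes "v \<in> carrier" "J 0 v = scv (h + l) v" "W \<in> Poly_Mapping.keys v"
  shows "wt W = l"
  using lookup_J0[OF assms(1), of W] assms(2,3) by (auto simp: in_keys_iff)

lemma valid_sorted: "valid W \<Longrightarrow> sorted W"
  by (induct W) (auto intro: less_imp_le)

lemma valid_eqI: "valid V \<Longrightarrow> valid W \<Longrightarrow> mset V = mset W \<Longrightarrow> V = W"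
  by (metis properties_for_sort valid_sorted)

lemma lookup_J: "Poly_Mapping.lookup (J a v) V
    = (\<Sum>W\<in>Poly_Mapping.keys v. Poly_Mapping.lookup v W * Poly_Mapping.lookup (act a W) V)"
  by (simp add: J_def wlin_def lookup_sum)

lemma keys_J:
  assumes "V \<in> Poly_Mapping.keys (J a v)"
  obtains N where "N \<in> Poly_Mapping.keys v" "V \<in> Poly_Mapping.keys (act a N)"
proof -
  have "\<exists>N\<in>Poly_Mapping.keys v. Poly_Mapping.lookup (act a N) V \<noteq> 0"
  proof (rule ccontr)
    assume "\<not> ?thesis"
    then have "Poly_Mapping.lookup (J a v) V = 0" unfolding lookup_J by simp
    then show False using assms by (simp add: in_keys_iff)
  qed
  then show ?thesis using that by (auto simp: in_keys_iff)
qed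

text \<open>To highest order in the length the modes supercommute, so the longest words only
  rearrange the letters.\<close>

lemma act_keys_mset:
  assumes "valid M" "N \<in> Poly_Mapping.keys (act a M)" "length N = Suc (length M)"
  shows "a < th \<and> mset N = add_mset a (mset M)"
  using assms
proof (induct M arbitrary: a N rule: length_induct)
  case (1 W)
  show ?case
  proof (cases W)
    case Nil
    have "Poly_Mapping.keys (scv x (ev [])) \<subseteq> {[]}" for x
      using keys_scv[of x "ev []"] by simp
    with Nil show ?thesis using 1
      by (fastforce simp: act.simps split: if_splits)
  next
    case (Cons b M)
    have vM: "valid (b # M)" "valid M" "b < th" using 1 Cons by auto
    have IH: "a' < th \<and> mset N' = add_mset a' (mset M')"
      if "length M' \<le> length M" "valid M'" "N' \<in> Poly_Mapping.keys (act a' M')" "length N' = Suc (length M')" for a' M' N'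
      using 1(1)[rule_format, of M' N' a'] that Cons by simp
    have len: "length N' \<le> Suc (length M')" if "valid M'" "N' \<in> Poly_Mapping.keys (act a' M')" for a' M' N'
      using act_keys[OF that] by simp
    have lN: "length N = Suc (Suc (length M))" using 1 Cons by simp
    consider (a) "valid (a # b # M)" | (b) "a = b" "odd a" | (c) "a > b"
      using valid_cases[OF vM(1)] by blast
    then show ?thesis
    proof cases
      case a
      then show ?thesis using 1 Cons by (simp add: act_in_order[OF a])
    next
      case b
      then have "N \<in> Poly_Mapping.keys (act (2 * a) M)" using 1 Cons by (simp add: act.simps)
      from len[OF vM(2) this] lN show ?thesis by simp
    next
      case c
      have "N \<in> Poly_Mapping.keys (J a (J b (ev M)))"
        using 1 Cons act_in_order[OF vM(1)] by (simp add: J_ev)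
      then have "N \<in> Poly_Mapping.keys (J b (J a (ev M))) \<or> N \<in> Poly_Mapping.keys (act (a + b) M) \<or> N = M"
        unfolding J_swap[OF vM(1) c] by (rule contrapos_pp) (auto simp: in_keys_iff lookup_add lookup_ev J_ev)
      moreover have "\<not> N \<in> Poly_Mapping.keys (act (a + b) M)" "N \<noteq> M"
        using len[OF vM(2), of N] lN by auto
      ultimately have "N \<in> Poly_Mapping.keys (J b (J a (ev M)))" by blast
      then obtain N' where N': "N' \<in> Poly_Mapping.keys (act a M)" "N \<in> Poly_Mapping.keys (act b N')"
        by (rule keys_J) (simp add: J_ev)
      have I: "valid N'" "length N' \<le> Suc (length M)" using act_keys[OF vM(2) N'(1)] by auto
      from len[OF I(1) N'(2)] lN I have l': "length N' = Suc (length M)" by simp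
      have m: "a < th" "mset N' = add_mset a (mset M)" using IH[OF _ vM(2) N'(1) l'] by auto
      then have "set N' = insert a (set M)" by (metis set_mset_add_mset_insert set_mset_mset)
      then have "valid (b # N')" using I c vM by auto
      then show ?thesis using N'(2) m Cons by (simp add: act_in_order)
    qed
  qed
qed

lemma lookup_act_long: "valid W \<Longrightarrow> length V > Suc (length W) \<Longrightarrow> Poly_Mapping.lookup (act a W) V = 0"
  using act_keys[of W V a] by (auto simp: in_keys_iff)

text \<open>Only N0 itself can produce \<open>a # N0\<close>: another word N of the same length
  gives \<open>a # N\<close>, and shorter words give results that are too short.\<close>

lemma lookup_J_top:
  assumes "\<And>N. N \<in> Poly_Mapping.keys v \<Longrightarrow> valid N \<and> length N \<le> length N0 \<and> (length N = length N0 \<longrightarrow> valid (a # N))"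
  shows "Poly_Mapping.lookup (J a v) (a # N0) = Poly_Mapping.lookup v N0"
proof -
  have "Poly_Mapping.lookup (act a N) (a # N0) = (if N = N0 then 1 else 0)" if "N \<in> Poly_Mapping.keys v" for N
  proof (cases "length N = length N0")
    case True
    then show ?thesis using assms[OF that] by (auto simp: act_in_order lookup_ev)
  next
    case False
    then show ?thesis using assms[OF that] lookup_act_long[of N "a # N0"] by auto
  qed
  then have "Poly_Mapping.lookup (J a v) (a # N0)
      = (\<Sum>W\<in>Poly_Mapping.keys v. if W = N0 then Poly_Mapping.lookup v W else 0)"
    unfolding lookup_J by (intro sum.cong) auto
  then show ?thesis by (auto simp: sum.delta in_keys_iff)
qed

lemma lookup_insort:
  "valid M \<Longrightarrow> even b \<Longrightarrow> b < th \<Longrightarrow> Poly_Mapping.lookup (act b M) (insort b M) = 1"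
proof (induct M)
  case Nil
  then show ?case by (simp add: act.simps lookup_ev)
next
  case (Cons d M)
  show ?case
  proof (cases "b \<le> d")
    case True
    then have "valid (b # d # M)" using Cons by auto
    then show ?thesis using True by (simp add: act_in_order lookup_ev)
  next
    case False
    have v: "valid (d # M)" "valid M" using Cons by auto
    have "Poly_Mapping.lookup (J d (J b (ev M))) (d # insort b M) = Poly_Mapping.lookup (J b (ev M)) (insort b M)"
    proof (rule lookup_J_top)
      fix N assume N: "N \<in> Poly_Mapping.keys (J b (ev M))"
      note a = act_keys[OF v(2) N[unfolded J_ev]]
      then show "valid N \<and> length N \<le> length (insort b M) \<and> (length N = length (insort b M) \<longrightarrow> valid (d # N))"
        using v False by auto
    qed
    moreover have "Poly_Mapping.lookup (act (b + d) M) (d # insort b M) = 0"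
      using lookup_act_long[OF v(2)] by simp
    moreover have "ns_sg b d = 1" using Cons by (simp add: ns_sg_def)
    moreover have "M \<noteq> d # insort b M" by (metis impossible_Cons length_insort nat_le_linear not_less_eq_eq)
    ultimately show ?thesis
      using J_swap[OF v(1), of b] False Cons
      by (simp add: J_ev act_in_order[OF v(1)] lookup_add lookup_ev)
  qed
qed

text \<open>The positive mode moves to the right until it meets the generator. Each commutator
  merges it with one letter; the length survives only if the merged letter k + a is still below
  \<open>th\<close>, and the later reordering only permutes the longest words.\<close>

lemma keys_positive_mode:
  assumes "valid W" "a > 0" "V \<in> Poly_Mapping.keys (act a W)"
  shows "length V < length W \<or> (length V = length W \<and> (\<exists>k\<in>set W. k + a < th \<and>
           mset V = add_mset (k + a) (mset W - {#k#})))"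
  using assms
proof (induct W arbitrary: V)
  case Nil
  then show ?case using th_le_0 by (simp add: act.simps)
next
  case (Cons b M)
  have v: "valid (b # M)" "valid M" "b < 0" "b < th" using Cons th_le_0 by auto
  have len: "length N' \<le> Suc (length M')" if "valid M'" "N' \<in> Poly_Mapping.keys (act a' M')" for a' M' N'
    using act_keys[OF that] by simp
  have ab: "a > b" using v Cons by simp
  have "V \<in> Poly_Mapping.keys (J a (J b (ev M)))"
    using Cons(4) act_in_order[OF v(1)] by (simp add: J_ev)
  then have "V \<in> Poly_Mapping.keys (J b (J a (ev M))) \<or> V \<in> Poly_Mapping.keys (act (a + b) M) \<or> V = M"
    unfolding J_swap[OF v(1) ab] by (rule contrapos_pp) (auto simp: in_keys_iff lookup_add lookup_ev J_ev)
  then show ?case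
  proof (elim disjE)
    assume "V \<in> Poly_Mapping.keys (J b (J a (ev M)))"
    then obtain N where N: "N \<in> Poly_Mapping.keys (act a M)" "V \<in> Poly_Mapping.keys (act b N)"
      by (rule keys_J) (simp add: J_ev)
    have vN: "valid N" using act_keys[OF v(2) N(1)] by simp
    from Cons(1)[OF v(2) Cons(3) N(1)] show ?thesis
    proof (elim disjE conjE bexE)
      assume "length N < length M"
      then show ?thesis using len[OF vN N(2)] by simp
    next
      fix k assume k: "length N = length M" "k \<in> set M" "k + a < th" "mset N = add_mset (k + a) (mset M - {#k#})"
      show ?thesis
      proof (cases "length V = Suc (length N)")
        case True
        then have "mset V = add_mset b (mset N)" using act_keys_mset[OF vN N(2)] by simp
        then have "mset V = add_mset (k + a) (mset (b # M) - {#k#})"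
          using k by (auto simp: multiset_eq_iff)
        then show ?thesis using k True by auto
      next
        case False
        then show ?thesis using len[OF vN N(2)] k by simp
      qed
    qed
  next
    assume V: "V \<in> Poly_Mapping.keys (act (a + b) M)"
    show ?thesis
    proof (cases "length V = Suc (length M)")
      case True
      then show ?thesis using act_keys_mset[OF v(2) V] by (auto simp: add.commute)
    next
      case False
      then show ?thesis using len[OF v(2) V] by simp
    qed
  qed simp
qed

lemma act_keys_head:
  assumes "valid (b # M)" "a > 0" "N \<in> Poly_Mapping.keys (act a M)"
  shows "valid N \<and> length N \<le> length M \<and> (length N = length M \<longrightarrow> valid (b # N))"
proof -
  have v: "valid M" using assms by simp
  note N = act_keys[OF v assms(3)]
  from keys_positive_mode[OF v assms(2,3)] show ?thesis
  proof (elim disjE conjE bexE)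
    fix k assume k: "length N = length M" "k \<in> set M" "k + a < th" "mset N = add_mset (k + a) (mset M - {#k#})"
    have "set_mset (mset N) \<subseteq> insert (k + a) (set M)"
      unfolding k(4) by (auto dest: in_diffD)
    then have "x = k + a \<or> x \<in> set M" if "x \<in> set N" for x
      using that by auto
    moreover have "b \<le> k" using assms(1) k(2) by auto
    then have "b < k + a" using assms(2) by simp
    ultimately have "b < x \<or> (b = x \<and> even b)" if "x \<in> set N" for x
      using that assms(1) by fastforce
    then show ?thesis using N k assms(1) by auto
  qed (use N in auto)
qed

text \<open>Every copy of the first letter contributes when it is turned into \<open>th - 2\<close>.
  The contributions are real and positive and so cannot cancel; this is the reason for tracking a
  positive real instead of a nonzero complex number.\<close>

lemma lookup_lower_head:
  assumes "valid W" "W \<noteq> []" "hd W < th - 2"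
  shows "\<exists>r > 0. Poly_Mapping.lookup (act (th - 2 - hd W) W) (insort (th - 2) (tl W)) = of_real r"
  using assms
proof (induct W)
  case (Cons k M)
  let ?a = "th - 2 - k"
  have v: "valid (k # M)" "valid M" "k < th - 2" "?a > 0" "?a > k" using Cons th_le_0 by auto
  have e1: "even (th - 2)" using even_th by simp
  have len: "length (insort (th - 2) M) = Suc (length M)" by simp
  \<comment> \<open>As \<open>th - 2\<close> is even, the mode ?a and the letter k have the same
    parity; the constant is (?a - k) / 2 for even letters and 2 for odd ones.\<close>
  have st: "\<exists>r > 0. ns_st ?a k = of_real r"
  proof (cases "even k")
    case True
    then have "ns_st ?a k = of_real (of_int (?a - k) / 2)" using even_th by (simp add: ns_st_def)
    moreover have "real_of_int (?a - k) / 2 > 0" using v by simp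
    ultimately show ?thesis by blast
  next
    case False
    then have "ns_st ?a k = of_real 2" using even_th by (simp add: ns_st_def)
    then show ?thesis by (intro exI[of _ 2]) simp
  qed
  then obtain r where r: "r > 0" "ns_st ?a k = of_real r" by blast
  have t1: "Poly_Mapping.lookup (act (th - 2) M) (insort (th - 2) M) = 1"
    using lookup_insort[OF v(2) e1] by simp
  have t2: "\<exists>r \<ge> 0. ns_sg ?a k * Poly_Mapping.lookup (J k (J ?a (ev M))) (insort (th - 2) M) = of_real r"
  proof (cases "k \<in> set M")
    case True
    then obtain M' where M: "M = k # M'" "even k"
      using v(1) by (cases M) force+
    have "Poly_Mapping.lookup (J k (J ?a (ev M))) (k # insort (th - 2) M')
        = Poly_Mapping.lookup (J ?a (ev M)) (insort (th - 2) M')"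
    proof (rule lookup_J_top)
      fix N assume "N \<in> Poly_Mapping.keys (J ?a (ev M))"
      then show "valid N \<and> length N \<le> length (insort (th - 2) M') \<and> (length N = length (insort (th - 2) M') \<longrightarrow> valid (k # N))"
        using act_keys_head[OF v(1,4), of N] M by (simp add: J_ev)
    qed
    moreover have "\<exists>r > 0. Poly_Mapping.lookup (act ?a M) (insort (th - 2) M') = of_real r"
      using Cons(1)[OF v(2)] M v(3) by auto
    moreover have "ns_sg ?a k = 1" using M by (simp add: ns_sg_def)
    ultimately show ?thesis using M v(3) by (auto simp: J_ev intro: less_imp_le)
  next
    case False
    have "Poly_Mapping.lookup (act k N) (insort (th - 2) M) = 0" if N: "N \<in> Poly_Mapping.keys (act ?a M)" for N
    proof (rule ccontr)
      assume "Poly_Mapping.lookup (act k N) (insort (th - 2) M) \<noteq> 0"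
      then have k: "insort (th - 2) M \<in> Poly_Mapping.keys (act k N)" by (simp add: in_keys_iff)
      note vN = act_keys_head[OF v(1,4) N]
      have "length (insort (th - 2) M) \<le> Suc (length N)" using act_keys[OF _ k] vN by simp
      then have "length (insort (th - 2) M) = Suc (length N)" using vN by simp
      then have "mset (insort (th - 2) M) = add_mset k (mset N)" using act_keys_mset[OF _ k] vN by simp
      then have "k \<in> set (insort (th - 2) M)" by (metis set_mset_mset union_single_eq_member)
      then show False using False v(3) by (simp add: set_insort_key)
    qed
    then have "Poly_Mapping.lookup (J k (J ?a (ev M))) (insort (th - 2) M) = 0"
      unfolding lookup_J J_ev by simp
    then show ?thesis by (intro exI[of _ 0]) simp
  qed
  then obtain r' where r': "r' \<ge> 0" "ns_sg ?a k * Poly_Mapping.lookup (J k (J ?a (ev M))) (insort (th - 2) M) = of_real r'"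
    by blast
  have "Poly_Mapping.lookup (act ?a (k # M)) (insort (th - 2) M) = of_real r' + of_real r"
  proof -
    have "insort (th - 2) M \<noteq> M" using len by (metis n_not_Suc_n)
    moreover have "?a + k = th - 2" by simp
    ultimately show ?thesis
      using J_swap[OF v(1,5)] r' r(2) t1
      by (simp add: J_ev act_in_order[OF v(1)] lookup_add lookup_ev)
  qed
  then have "Poly_Mapping.lookup (act ?a (k # M)) (insort (th - 2) M) = of_real (r' + r)" by simp
  moreover have "r' + r > 0" using r r' by simp
  ultimately show ?case by auto
qed simp

definition nb :: "int list \<Rightarrow> nat" where
  "nb W = size (filter_mset (\<lambda>x. x < th - 2) (mset W))"

lemma nb_0: "nb W = 0 \<longleftrightarrow> (\<forall>x\<in>set W. \<not> x < th - 2)"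
  by (simp add: nb_def flip: set_mset_eq_empty_iff) auto

definition singular :: "complex \<Rightarrow> wvec \<Rightarrow> bool" where
  "singular l v \<longleftrightarrow> v \<in> carrier \<and> v \<noteq> 0 \<and> J 0 v = scv (h + l) v \<and> (\<forall>a>0. J a v = 0)"

text \<open>Among the longest words of a singular vector take one with the fewest letters other than the two
  lowest ones; applying the positive mode that turns its first letter into the even lowest letter would
  produce a word that nothing else can cancel.\<close>

lemma singular_lowest_word:
  assumes "singular l v"
  shows "\<exists>W\<in>Poly_Mapping.keys v. set W \<subseteq> {th - 2, th - 1}"
proof -
  let ?x = "th - 2" and ?g = "th - 1"
  have v: "v \<in> carrier" "v \<noteq> 0" and pos: "\<And>a. a > 0 \<Longrightarrow> J a v = 0"
    using assms by (auto simp: singular_def)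
  have val: "valid W" if "W \<in> Poly_Mapping.keys v" for W using v that by (simp add: carrier_def)
  define K where "K = Poly_Mapping.keys v"
  have K: "finite K" "K \<noteq> {}" using v by (auto simp: K_def)
  define d where "d = Max (length ` K)"
  have d: "length W \<le> d" if "W \<in> K" for W
    using K(1) that by (simp add: d_def)
  have "d \<in> length ` K" unfolding d_def using K by (intro Max_in) auto
  then obtain W' where "W' \<in> K" "length W' = d" by auto
  define T where "T = {W \<in> K. length W = d}"
  have T: "finite T" "T \<noteq> {}" using K \<open>W' \<in> K\<close> \<open>length W' = d\<close> by (auto simp: T_def)
  define m where "m = Min (nb ` T)"
  have m: "m \<le> nb W" if "W \<in> T" for W
    using T(1) that by (simp add: m_def)
  have "m \<in> nb ` T" unfolding m_def using T by (intro Min_in) auto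
  then obtain W'' where "W'' \<in> T" "nb W'' = m" by auto
  \<comment> \<open>Among the minimal words one without the odd letter \<open>th - 1\<close> is
    preferred. If W contains that letter, so do all its competitors, and a competitor with another
    letter turned into \<open>th - 1\<close> would yield this odd letter twice.\<close>
  obtain W where W: "W \<in> T" "nb W = m" "?g \<notin> set W \<or> (\<forall>V\<in>T. nb V = m \<longrightarrow> ?g \<in> set V)"
    using \<open>W'' \<in> T\<close> \<open>nb W'' = m\<close> by blast
  have vW: "valid W" and WK: "W \<in> K" "length W = d" using W val by (auto simp: T_def K_def)
  have "m = 0"
  proof (rule ccontr)
    assume m0: "m \<noteq> 0"
    then have "\<exists>x\<in>set W. x < ?x" using W(2) nb_0[of W] by auto
    then obtain k M where kM: "W = k # M" "k < ?x" using vW by (cases W) force+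
    let ?a = "?x - k" and ?V = "insort ?x M"
    have a: "?a > 0" using kM by simp
    have mV: "mset ?V = add_mset ?x (mset M)" by simp
    have nV: "Suc (nb ?V) = m" using W kM by (simp add: nb_def)
    have "Poly_Mapping.lookup (act ?a U) ?V = 0" if U: "U \<in> K" "U \<noteq> W" for U
    proof (rule ccontr)
      assume "Poly_Mapping.lookup (act ?a U) ?V \<noteq> 0"
      then have in_keys: "?V \<in> Poly_Mapping.keys (act ?a U)" by (simp add: in_keys_iff)
      have vU: "valid U" using U val by (simp add: K_def)
      have lV: "length ?V = d" using WK kM by simp
      from keys_positive_mode[OF vU a in_keys] d[OF U(1)] lV
      obtain j where j: "length ?V = length U" "j \<in> set U" "j + ?a < th"
        "mset ?V = add_mset (j + ?a) (mset U - {#j#})" by auto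
      have UT: "U \<in> T" using U j lV by (simp add: T_def)
      have mU: "mset U = add_mset j (mset U - {#j#})" using j by simp
      have nU: "nb U = (if j < ?x then 1 else 0) + size (filter_mset (\<lambda>x. x < ?x) (mset U - {#j#}))"
        by (subst nb_def, subst mU) simp
      have nV': "nb ?V = (if j + ?a < ?x then 1 else 0) + size (filter_mset (\<lambda>x. x < ?x) (mset U - {#j#}))"
        by (subst nb_def, subst j(4)) simp
      have jx: "j < ?x" "\<not> j + ?a < ?x" "nb U = m"
        using m[OF UT] nU nV nV' by (auto split: if_splits)
      then have "j + ?a = ?x \<or> j + ?a = ?g" using j(3) by linarith
      then show False
      proof
        assume "j + ?a = ?x"
        then have "j = k" "mset M = mset U - {#j#}" using j(4) mV by auto
        then have "mset U = mset W" using mU kM by simp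
        then show False using valid_eqI[OF vU vW] U by simp
      next
        assume ja: "j + ?a = ?g"
        then have "mset ?V = add_mset ?g (mset U - {#j#})" using j(4) by simp
        then have e: "add_mset ?x (mset M) = add_mset ?g (mset U - {#j#})" using mV by simp
        then have "?g \<in># add_mset ?x (mset M)" by simp
        then have gM: "?g \<in> set M" by simp
        then have "?g \<in> set W" using kM by simp
        then have gU: "?g \<in> set U" using W(3) UT jx by blast
        moreover have "j \<noteq> ?g" using jx by simp
        moreover have "count (mset U) ?g > 0" using gU by simp
        ultimately have "count (add_mset ?g (mset U - {#j#})) ?g \<ge> 2" by simp
        then have "count (add_mset ?x (mset M)) ?g \<ge> 2" using e by simp
        then have "count (mset M) ?g \<ge> 2" by simp
        moreover have "count (mset N) ?g \<le> 1" if "valid N" for N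
          using that
        proof (induct N)
          case (Cons y N)
          then show ?case using even_th by (auto simp: count_eq_zero_iff)
        qed simp
        ultimately show False using vW kM by (metis One_nat_def Suc_1 not_less_eq_eq valid.simps(2))
      qed
    qed
    then have z: "(\<Sum>U\<in>K - {W}. Poly_Mapping.lookup v U * Poly_Mapping.lookup (act ?a U) ?V) = 0"
      by (intro sum.neutral) auto
    have "(\<Sum>U\<in>K. Poly_Mapping.lookup v U * Poly_Mapping.lookup (act ?a U) ?V)
      = Poly_Mapping.lookup v W * Poly_Mapping.lookup (act ?a W) ?V"
      using sum.remove[OF K(1) WK(1), of "\<lambda>U. Poly_Mapping.lookup v U * Poly_Mapping.lookup (act ?a U) ?V"] z
      by simp
    moreover have "(\<Sum>U\<in>K. Poly_Mapping.lookup v U * Poly_Mapping.lookup (act ?a U) ?V) = 0"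
      using pos[OF a] lookup_J[of ?a v ?V] by (simp add: K_def)
    moreover have "Poly_Mapping.lookup v W \<noteq> 0" using WK by (simp add: K_def in_keys_iff)
    moreover have "Poly_Mapping.lookup (act ?a W) ?V \<noteq> 0"
      using lookup_lower_head[OF vW] kM by auto
    ultimately show False by simp
  qed
  then have "\<forall>x\<in>set W. \<not> x < ?x" using W(2) nb_0[of W] by simp
  moreover have "\<forall>x\<in>set W. x < th" using valid_lt[OF vW] by blast
  ultimately have "set W \<subseteq> {?x, ?g}" by force
  then show ?thesis using WK K_def by blast
qed

lemma lowest_word_form:
  assumes "valid W" "set W \<subseteq> {th - 2, th - 1}"
  shows "\<exists>n. W = replicate n (th - 2) \<or> W = replicate n (th - 2) @ [th - 1]"
  using assms
proof (induct W)
  case (Cons a W)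
  then obtain n where n: "W = replicate n (th - 2) \<or> W = replicate n (th - 2) @ [th - 1]" by auto
  show ?case
  proof (cases "a = th - 2")
    case True
    then show ?thesis using n by (intro exI[of _ "Suc n"]) auto
  next
    case False
    then have a: "a = th - 1" "odd a" using Cons even_th by auto
    then have "set W = {}" using Cons by force
    then show ?thesis using a by (intro exI[of _ 0]) simp
  qed
qed (auto intro: exI[of _ 0])

text \<open>The odd letter occurs at most once, at the end. The parity of the sum of the letters
  decides whether it occurs, and the sum then fixes the number of even letters.\<close>

lemma lowest_word_unique:
  assumes "valid W" "set W \<subseteq> {th - 2, th - 1}" "valid V" "set V \<subseteq> {th - 2, th - 1}" "wt W = wt V"
  shows "W = V"
proof -
  obtain n where n: "W = replicate n (th - 2) \<or> W = replicate n (th - 2) @ [th - 1]"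
    using lowest_word_form assms by blast
  obtain k where k: "V = replicate k (th - 2) \<or> V = replicate k (th - 2) @ [th - 1]"
    using lowest_word_form assms by blast
  have s: "sum_list W = sum_list V" using assms(5) by (simp add: wt_def)
  have ev: "even (int i * (th - 2))" for i using even_th by simp
  have nz: "th - 2 \<noteq> 0" using th_le_0 by simp
  have no: "int i * (th - 2) \<noteq> int j * (th - 2) + (th - 1)" for i j
  proof
    assume e: "int i * (th - 2) = int j * (th - 2) + (th - 1)"
    have "even (int j * (th - 2) + (th - 1))" unfolding e[symmetric] by (rule ev)
    then show False using ev[of j] even_th by simp
  qed
  show ?thesis
    using n k
  proof (elim disjE)
    assume "W = replicate n (th - 2)" "V = replicate k (th - 2)"
    then show ?thesis using s nz by (simp add: sum_list_replicate)
  next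
    assume "W = replicate n (th - 2) @ [th - 1]" "V = replicate k (th - 2) @ [th - 1]"
    then show ?thesis using s nz by (simp add: sum_list_replicate)
  next
    assume "W = replicate n (th - 2)" "V = replicate k (th - 2) @ [th - 1]"
    then show ?thesis using s no[of n k] by (simp add: sum_list_replicate)
  next
    assume "W = replicate n (th - 2) @ [th - 1]" "V = replicate k (th - 2)"
    then show ?thesis using s no[of k n] by (simp add: sum_list_replicate)
  qed
qed

text \<open>The character of the negative modes with $G_{-1/2}, L_{-1} \mapsto 1$ (for th = 0).\<close>

definition chi :: "int \<Rightarrow> complex" where
  "chi a = (if a = -1 \<or> a = -2 then 1 else 0)"

definition phi :: "wvec \<Rightarrow> complex" where
  "phi = wlin (*) (\<lambda>W. if set W \<subseteq> {-2, -1} then 1 else 0)"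

lemma cvs: "vector_space ((*) :: complex \<Rightarrow> complex \<Rightarrow> complex)"
  by unfold_locales (auto simp: algebra_simps)

lemma phi_linear: "Vector_Spaces.linear scv (*) phi"
  unfolding phi_def by (rule wlin_linear) (rule cvs)

lemma phi_add: "phi (v + w) = phi v + phi w" and phi_scale: "phi (scv x v) = x * phi v"
  using phi_linear by (simp_all add: Vector_Spaces.linear_iff)

lemma phi_ev: "phi (ev W) = (if set W \<subseteq> {-2, -1} then 1 else 0)"
  by (simp add: phi_def cvs)

text \<open>The character is compatible with straightening: G_{-1/2} squares to L_{-1}, both of
  value 1, and the commutator of two different negative modes has mode number at most -3/2, where
  \<open>chi\<close> is zero.\<close>

lemma phi_J_ev:
  assumes "th = 0"
  shows "valid W \<Longrightarrow> a < 0 \<Longrightarrow> phi (J a (ev W)) = chi a * phi (ev W)"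
proof (induct "length W" arbitrary: W a rule: less_induct)
  case less
  have lin: "Vector_Spaces.linear scv (*) (\<lambda>v. phi (J b v))" "Vector_Spaces.linear scv (*) (\<lambda>v. chi b * phi v)" for b
    by (simp_all add: Vector_Spaces.linear_iff wvs cvs J_add J_scale phi_add phi_scale algebra_simps)
  show ?case
  proof (cases W)
    case Nil
    have "a < th" using less(3) assms by simp
    then have "valid [a]" by simp
    from J_in_order[OF this] Nil show ?thesis by (auto simp: phi_ev chi_def)
  next
    case (Cons b M)
    have v: "valid (b # M)" using less(2) Cons by simp
    have vb: "b < th" "valid M" using v by simp_all
    have v: "valid (b # M)" "valid M" "b < 0" using v vb assms by simp_all
    have IH: "phi (J x (ev N)) = chi x * phi (ev N)" if "valid N" "length N \<le> length M" "x < 0" for x N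
      using less(1) that Cons by auto
    consider (a) "valid (a # b # M)" | (b) "a = b" "odd a" | (c) "a > b"
      using valid_cases[OF v(1)] by blast
    then show ?thesis
    proof cases
      case a
      then show ?thesis using Cons by (auto simp: J_in_order[OF a] phi_ev chi_def)
    next
      case b
      have "phi (J a (ev W)) = phi (J (2 * a) (ev M))"
        using J_square[OF v(1)] J_in_order[OF v(1)] b Cons by simp
      also have "\<dots> = chi (2 * a) * phi (ev M)" using IH v less(3) by simp
      also have "\<dots> = chi a * phi (ev W)" using Cons b by (auto simp: chi_def phi_ev)
      finally show ?thesis .
    next
      case c
      have swap: "phi (J b (J a (ev M))) = chi b * phi (J a (ev M))"
      proof (rule linear_eq_on_keys[OF lin])
        fix N assume "N \<in> Poly_Mapping.keys (J a (ev M))"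
        then have N: "valid N" "length N \<le> Suc (length M)"
          "length N = Suc (length M) \<Longrightarrow> set N \<subseteq> insert a (set M)"
          using act_keys[OF v(2), of N a] by (auto simp: J_ev)
        show "phi (J b (ev N)) = chi b * phi (ev N)"
        proof (cases "length N = Suc (length M)")
          case True
          then have "valid (b # N)" using N v c by auto
          then show ?thesis by (auto simp: J_in_order phi_ev chi_def)
        qed (use N IH v in auto)
      qed
      have "phi (J a (ev W)) = phi (J a (J b (ev M)))" using J_in_order[OF v(1)] Cons by simp
      also have "\<dots> = (ns_sg a b * chi b * chi a + ns_st a b * chi (a + b) + ns_ct c a b) * phi (ev M)"
        using v less(3) by (simp add: J_swap[OF v(1) c] phi_add phi_scale swap IH algebra_simps)
      also have "ns_sg a b * chi b * chi a + ns_st a b * chi (a + b) + ns_ct c a b = chi a * chi b"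
        using c v less(3) by (auto simp: chi_def ns_sg_def ns_ct_def)
      also have "chi a * chi b * phi (ev M) = chi a * phi (ev W)"
        using Cons by (auto simp: chi_def phi_ev)
      finally show ?thesis .
    qed
  qed
qed

lemma phi_J:
  assumes "th = 0" "v \<in> carrier" "a < 0"
  shows "phi (J a v) = chi a * phi v"
proof -
  have "Vector_Spaces.linear scv (*) (\<lambda>v. phi (J a v))" "Vector_Spaces.linear scv (*) (\<lambda>v. chi a * phi v)"
    by (simp_all add: Vector_Spaces.linear_iff wvs cvs J_add J_scale phi_add phi_scale algebra_simps)
  then show ?thesis
    by (rule linear_eq_on_keys) (rule phi_J_ev[OF assms(1) _ assms(3)], use assms(2) in \<open>simp add: carrier_def\<close>)
qed

text \<open>All words of a singular vector have the same weight, so exactly one of them consists of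
  L_{-1} and G_{-1/2} only, and \<open>phi\<close> returns its coefficient.\<close>

lemma phi_singular:
  assumes "th = 0" "singular l v"
  shows "phi v \<noteq> 0"
proof -
  obtain W where W: "W \<in> Poly_Mapping.keys v" "set W \<subseteq> {th - 2, th - 1}"
    using singular_lowest_word[OF assms(2)] by blast
  have c: "v \<in> carrier" "J 0 v = scv (h + l) v" using assms(2) by (auto simp: singular_def)
  then have val: "valid V" "wt V = l" if "V \<in> Poly_Mapping.keys v" for V
    using that wt_eigen by (auto simp: carrier_def)
  have e: "{-2, -1} = {th - 2, th - 1}" using assms(1) by simp
  have u: "set V \<subseteq> {-2, -1} \<longleftrightarrow> V = W" if V: "V \<in> Poly_Mapping.keys v" for V
    unfolding e using lowest_word_unique[OF val(1)[OF V] _ val(1)[OF W(1)] W(2)] val(2)[OF V] val(2)[OF W(1)] W(2)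
    by metis
  have "phi v = (\<Sum>V\<in>Poly_Mapping.keys v. if V = W then Poly_Mapping.lookup v V else 0)"
    unfolding phi_def wlin_def by (rule sum.cong[OF refl]) (simp add: u)
  then show ?thesis using W by (simp add: sum.delta in_keys_iff)
qed

end

section \<open>The degenerate field\<close>

text \<open>Used to check vector identities after applying an arbitrary functional, where they
  become polynomial identities between complex numbers.\<close>

lemma functional_eqI:
  assumes "vector_space sc" and eq: "\<And>f. Vector_Spaces.linear sc ((*) :: complex \<Rightarrow> _) f \<Longrightarrow> f v = f w"
  shows "v = w"
proof (rule ccontr)
  interpret vector_space_pair sc "(*) :: complex \<Rightarrow> complex \<Rightarrow> complex"
    using assms(1) by (simp add: vector_space_pair_def) (unfold_locales, auto simp: algebra_simps)
  assume "v \<noteq> w"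
  then have "vs1.independent {v - w}" by (simp add: vs1.dependent_single)
  from linear_independent_extend[OF this, of "\<lambda>_. 1"]
  obtain f where f: "Vector_Spaces.linear sc (*) f" "f (v - w) = 1" by auto
  then interpret f: Vector_Spaces.linear sc "(*)" f by simp
  show False using f(2) eq[OF f(1)] by (simp add: f.diff)
qed

section \<open>Density modules of superfields\<close>

locale density = T: ns_rep sc S c K
  for sc :: "complex \<Rightarrow> 'v::ab_group_add \<Rightarrow> 'v" and S c K +
  fixes kap hh :: complex
begin

type_synonym ('a) pairs = "(int \<Rightarrow> 'a) \<times> (int \<Rightarrow> 'a)"

text \<open>A pair (A, B) stands for the series $\sum_k A_k z^{\kappa+k}$ and $\sum_k B_k z^{\kappa+k}$ of the
  two components $\phi(z)s$, $\psi(z)s$ of a superfield of weight hh applied to a vector s;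
  the operators TL n, TG j describe the action of $L_n$, $G_{j+1/2}$ on s.\<close>

definition sc2 :: "complex \<Rightarrow> (int \<Rightarrow> 'v) \<times> (int \<Rightarrow> 'v) \<Rightarrow> (int \<Rightarrow> 'v) \<times> (int \<Rightarrow> 'v)" where
  "sc2 x Z = (\<lambda>k. sc x (fst Z k), \<lambda>k. sc x (snd Z k))"

text \<open>From phi L_n = L_n phi - [L_n, phi] with [L_n, phi(z)] = z^n (z d/dz + (n + 1) hh)
  phi(z); the partner psi has weight hh + 1/2.\<close>

definition TL :: "int \<Rightarrow> (int \<Rightarrow> 'v) \<times> (int \<Rightarrow> 'v) \<Rightarrow> (int \<Rightarrow> 'v) \<times> (int \<Rightarrow> 'v)" where
  "TL n Z = (\<lambda>k. T.L n (fst Z k) - sc (kap + of_int (k - n) + of_int (n + 1) * hh) (fst Z (k - n)),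
             \<lambda>k. T.L n (snd Z k) - sc (kap + of_int (k - n) + of_int (n + 1) * (hh + 1 / 2)) (snd Z (k - n)))"

text \<open>With G = G_{j+1/2}: [G, phi] = z^{j+1} psi and {G, psi} = z^j (z d/dz + (2 j + 2) hh)
  phi. The sign in the second component comes from psi being odd.\<close>

definition TG :: "int \<Rightarrow> (int \<Rightarrow> 'v) \<times> (int \<Rightarrow> 'v) \<Rightarrow> (int \<Rightarrow> 'v) \<times> (int \<Rightarrow> 'v)" where
  "TG j Z = (\<lambda>k. T.G j (fst Z k) - snd Z (k - j - 1),
             \<lambda>k. - T.G j (snd Z k) + sc (kap + of_int (k - j) + of_int (2 * j + 2) * hh) (fst Z (k - j)))"

definition TJ :: "int \<Rightarrow> (int \<Rightarrow> 'v) \<times> (int \<Rightarrow> 'v) \<Rightarrow> (int \<Rightarrow> 'v) \<times> (int \<Rightarrow> 'v)" where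
  "TJ a = (if even a then TL (a div 2) else TG (a div 2))"

definition S2 :: "((int \<Rightarrow> 'v) \<times> (int \<Rightarrow> 'v)) set" where
  "S2 = {Z. \<forall>k. fst Z k \<in> S \<and> snd Z k \<in> S}"

lemma TJ_even [simp]: "TJ (2 * n) = TL n" and TJ_odd [simp]: "TJ (2 * j + 1) = TG j"
  by (simp_all add: TJ_def)

lemma sc2_vs: "vector_space sc2"
  by unfold_locales (auto simp: sc2_def T.scale_right_distrib T.scale_left_distrib fun_eq_iff)

lemma S_uminus: "v \<in> S \<Longrightarrow> - v \<in> S"
  by (rule T.subspace_neg[OF T.S_subspace])

lemma TJ_S2: "Z \<in> S2 \<Longrightarrow> TJ a Z \<in> S2"
  by (auto simp: S2_def TJ_def TL_def TG_def intro!: T.subspace_diff[OF T.S_subspace] T.subspace_add[OF T.S_subspace]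
      T.subspace_scale[OF T.S_subspace] S_uminus T.J_closed)

lemma TJ_add: "TJ a (Z + W) = TJ a Z + TJ a W"
  by (auto simp: TJ_def TL_def TG_def T.J_add T.scale_right_distrib fun_eq_iff)

lemma TJ_scale: "TJ a (sc2 x Z) = sc2 x (TJ a Z)"
  by (auto simp: TJ_def TL_def TG_def sc2_def T.J_scale fun_eq_iff T.scale_right_diff_distrib T.scale_right_distrib mult.commute)

lemma pairs_eqI:
  assumes "\<And>k f. Vector_Spaces.linear sc ((*) :: complex \<Rightarrow> _) f \<Longrightarrow> f (fst Z k) = f (fst W k)"
    and "\<And>k f. Vector_Spaces.linear sc ((*) :: complex \<Rightarrow> _) f \<Longrightarrow> f (snd Z k) = f (snd W k)"
  shows "Z = W"
  using assms by (intro prod_eqI ext functional_eqI[OF T.vector_space_axioms]) auto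

lemma TLL:
  assumes Z: "Z \<in> S2"
  shows "TL m (TL n Z) = TL n (TL m Z) + sc2 (of_int m - of_int n) (TL (m + n) Z)
           + sc2 (if m + n = 0 then c / 12 * (of_int m ^ 3 - of_int m) else 0) Z" (is "?l = ?r")
proof (rule pairs_eqI)
  fix k and f :: "'v \<Rightarrow> complex" assume "Vector_Spaces.linear sc (*) f"
  then interpret f: Vector_Spaces.linear sc "(*)" f .
  have S: "fst Z k \<in> S" "snd Z k \<in> S" for k using Z by (auto simp: S2_def)
  note s = TL_def sc2_def T.J_diff T.J_scale f.add f.diff f.scale f.neg fst_conv snd_conv fst_add snd_add plus_fun_apply
  have e: "k - n - m = k - (m + n)" "k - m - n = k - (m + n)" by simp_all
  obtain u where u: "(if m + n = 0 then c / 12 * (of_int m ^ 3 - of_int m) else 0) = u" by blast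
  have E: "f (T.L m (T.L n v)) = f (T.L n (T.L m v)) + (of_int m - of_int n) * f (T.L (m + n) v) + u * f v"
    if "v \<in> S" for v
    using arg_cong[OF T.LL[OF that, of m n], of f] unfolding u by (simp only: f.add f.scale)
  show "f (fst ?l k) = f (fst ?r k)"
    unfolding u by (simp only: s e E[OF S(1)]) (simp only: of_int_add of_int_diff of_int_1, algebra)
  show "f (snd ?l k) = f (snd ?r k)"
    unfolding u by (simp only: s e E[OF S(2)]) (simp only: of_int_add of_int_diff of_int_1, algebra)
qed

lemma TGL:
  assumes Z: "Z \<in> S2"
  shows "TG a (TL n Z) = TL n (TG a Z) + sc2 (of_int a + 1 / 2 - of_int n / 2) (TG (a + n) Z)" (is "?l = ?r")
proof (rule pairs_eqI)
  fix k and f :: "'v \<Rightarrow> complex" assume "Vector_Spaces.linear sc (*) f"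
  then interpret f: Vector_Spaces.linear sc "(*)" f .
  have S: "fst Z k \<in> S" "snd Z k \<in> S" for k using Z by (auto simp: S2_def)
  obtain t :: complex where t: "2 * t = 1" and hf: "\<And>x. x / 2 = x * t"
    by (rule that[of "1 / 2"]) simp_all
  note s = TL_def TG_def sc2_def T.J_diff T.J_scale T.J_add T.J_minus f.add f.diff f.scale f.neg
     fst_conv snd_conv fst_add snd_add plus_fun_apply
  have e: "k - a - 1 - n = k - (a + n) - 1" "k - n - a - 1 = k - (a + n) - 1"
    "k - a - n = k - (a + n)" "k - n - a = k - (a + n)" by simp_all
  have E: "f (T.G a (T.L n v)) = f (T.L n (T.G a v)) + (of_int a + 1 / 2 - of_int n / 2) * f (T.G (a + n) v)"
    if "v \<in> S" for v
    using arg_cong[OF T.GL[OF that, of a n], of f] by (simp only: f.add f.scale)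
  show "f (fst ?l k) = f (fst ?r k)"
    by (simp only: s e E[OF S(1)]) (simp only: of_int_add of_int_diff of_int_mult of_int_1 of_int_numeral hf, use t in algebra)
  show "f (snd ?l k) = f (snd ?r k)"
    by (simp only: s e E[OF S(2)]) (simp only: of_int_add of_int_diff of_int_mult of_int_1 of_int_numeral hf, use t in algebra)
qed

lemma TGG:
  assumes Z: "Z \<in> S2"
  shows "TG a (TG b Z) = - TG b (TG a Z) + sc2 2 (TL (a + b + 1) Z)
           + sc2 (if a + b + 1 = 0 then c / 3 * of_int (a * (a + 1)) else 0) Z" (is "?l = ?r")
proof (rule pairs_eqI)
  fix k and f :: "'v \<Rightarrow> complex" assume "Vector_Spaces.linear sc (*) f"
  then interpret f: Vector_Spaces.linear sc "(*)" f .
  have S: "fst Z k \<in> S" "snd Z k \<in> S" for k using Z by (auto simp: S2_def)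
  obtain t :: complex where t: "2 * t = 1" and hf: "\<And>x. x / 2 = x * t"
    by (rule that[of "1 / 2"]) simp_all
  note s = TL_def TG_def sc2_def T.J_diff T.J_scale T.J_add T.J_minus f.add f.diff f.scale f.neg
     fst_conv snd_conv fst_add snd_add plus_fun_apply fst_uminus snd_uminus fun_Compl_def
  have e: "k - a - 1 - b = k - (a + b + 1)" "k - b - a - 1 = k - (a + b + 1)"
    "k - b - 1 - a = k - (a + b + 1)" "k - a - b - 1 = k - (a + b + 1)" by simp_all
  obtain u where u: "(if a + b + 1 = 0 then c / 3 * of_int (a * (a + 1)) else 0) = u" by blast
  have E: "f (T.G a (T.G b v)) = - f (T.G b (T.G a v)) + 2 * f (T.L (a + b + 1) v) + u * f v"
    if "v \<in> S" for v
    using arg_cong[OF T.GG[OF that, of a b], of f] unfolding u by (simp only: f.add f.scale f.neg)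
  show "f (fst ?l k) = f (fst ?r k)"
    unfolding u by (simp only: s e E[OF S(1)]) (simp only: of_int_add of_int_diff of_int_mult of_int_1 of_int_numeral, algebra)
  show "f (snd ?l k) = f (snd ?r k)"
    unfolding u by (simp only: s e E[OF S(2)]) (simp only: of_int_add of_int_diff of_int_mult of_int_1 of_int_numeral hf, use t in algebra)
qed

lemma TLG:
  assumes Z: "Z \<in> S2"
  shows "TL n (TG a Z) = TG a (TL n Z) + sc2 (of_int n / 2 - of_int a - 1 / 2) (TG (a + n) Z)"
proof -
  interpret V: vector_space sc2 by (rule sc2_vs)
  have "sc2 (of_int n / 2 - of_int a - 1 / 2) (TG (a + n) Z) = - sc2 (of_int a + 1 / 2 - of_int n / 2) (TG (a + n) Z)"
    by (simp flip: V.scale_minus_left)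
  then show ?thesis unfolding TGL[OF Z] by simp
qed

text \<open>The differential operators alone represent the algebra without centre, so the central
  charge of \<open>K\<close> is unchanged.\<close>

lemma T_rep: "ns_rep sc2 S2 c TJ"
proof -
  interpret V: vector_space sc2 by (rule sc2_vs)
  show ?thesis
  proof
    show "V.subspace S2"
      by (auto simp: V.subspace_def S2_def sc2_def T.subspace_0[OF T.S_subspace]
          intro!: T.subspace_add[OF T.S_subspace] T.subspace_scale[OF T.S_subspace])
    show "TJ a Z \<in> S2" if "Z \<in> S2" for a Z using that by (rule TJ_S2)
    show "TJ a (Z + W) = TJ a Z + TJ a W" for a Z W by (rule TJ_add)
    show "TJ a (sc2 x Z) = sc2 x (TJ a Z)" for a x Z by (rule TJ_scale)
    fix a b Z assume Z: "Z \<in> S2"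
    show "TJ a (TJ b Z) = sc2 (ns_sg a b) (TJ b (TJ a Z)) + sc2 (ns_st a b) (TJ (a + b) Z) + sc2 (ns_ct c a b) Z"
    proof (cases "even a"; cases "even b")
      assume "even a" "even b"
      then obtain m n where "a = 2 * m" "b = 2 * n" by (auto elim!: evenE)
      then show ?thesis using TLL[OF Z, of m n] by (simp only: ns_coeff_LL ns_index TJ_even TJ_odd V.scale_one)
    next
      assume "even a" "odd b"
      then obtain m n where "a = 2 * m" "b = 2 * n + 1" by (auto elim!: evenE oddE)
      then show ?thesis using TLG[OF Z, of m n]
        by (simp only: ns_coeff_LG ns_index TJ_even TJ_odd V.scale_one V.scale_zero_left add_0_right)
    next
      assume "odd a" "even b"
      then obtain m n where "a = 2 * m + 1" "b = 2 * n" by (auto elim!: evenE oddE)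
      then show ?thesis using TGL[OF Z, of m n]
        by (simp only: ns_coeff_GL ns_index TJ_even TJ_odd V.scale_one V.scale_zero_left add_0_right)
    next
      assume "odd a" "odd b"
      then obtain m n where "a = 2 * m + 1" "b = 2 * n + 1" by (auto elim!: oddE)
      then show ?thesis using TGG[OF Z, of m n]
        by (simp only: ns_coeff_GG ns_index TJ_even TJ_odd V.scale_one V.scale_minus_left)
    qed
  qed
qed

sublocale D: ns_rep sc2 S2 c TJ
  by (rule T_rep)

end

text \<open>The two assumptions say that G_{1/2} and G_{3/2} kill the vector (L_{-1} G_{-1/2} - tau
  G_{-3/2}) phi: the first gives 2 hh + 1 = 2 tau, the second 4 hh = tau (2 hh + 2 c / 3).\<close>

locale degenerate = density sc S c K kap hh
  for sc :: "complex \<Rightarrow> 'v::ab_group_add \<Rightarrow> 'v" and S c K kap hh +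
  fixes tau :: complex
  assumes hh: "hh = tau - 1 / 2" and null: "2 * hh = tau * (hh + c / 3)"
begin

text \<open>NN and NP are the coefficients of the fields
  $(L_{-1}G_{-1/2} - \tau G_{-3/2})\phi$ and
  $(L_{-1}^2 - 2\tau L_{-2} + \tau G_{-3/2}G_{-1/2})\phi$ applied to a vector that is
  annihilated by all modes above R.\<close>

definition NN :: "int \<Rightarrow> int \<Rightarrow> (int \<Rightarrow> 'v) \<times> (int \<Rightarrow> 'v) \<Rightarrow> int \<Rightarrow> 'v" where
  "NN M R Z m = sc (kap + of_int (m + 1) + tau * of_int (R + 2)) (snd Z (m + 1))
     - sc tau (\<Sum>j\<in>{-M..R}. T.G j (fst Z (m + j + 2)))"

definition NP :: "int \<Rightarrow> int \<Rightarrow> (int \<Rightarrow> 'v) \<times> (int \<Rightarrow> 'v) \<Rightarrow> int \<Rightarrow> 'v" where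
  "NP M R Z p = sc ((kap + of_int p) * (kap + of_int p - 1 + tau * of_int (R + 2))) (fst Z p)
     - sc (2 * tau) (\<Sum>n\<in>{-M..R}. T.L n (fst Z (p + n)))
     + sc tau (\<Sum>j\<in>{-M..R}. T.G j (snd Z (p + j)))"

text \<open>For a series that vanishes below k0 the sums in \<open>NN\<close> and \<open>NP\<close>
  are complete once M is at least m + 2 - k0, as the omitted modes meet zero coefficients.\<close>

definition lbd :: "(int \<Rightarrow> 'v) \<times> (int \<Rightarrow> 'v) \<Rightarrow> int \<Rightarrow> bool" where
  "lbd Z k0 \<longleftrightarrow> (\<forall>k<k0. fst Z k = 0 \<and> snd Z k = 0)"

text \<open>Expresses that the vector is killed by the modes above R. Its modes with index -1 to R
  are moved to the left of the field at the cost of one commutator each, which is the origin of the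
  factor R + 2 in \<open>NN\<close> and \<open>NP\<close>.\<close>

definition smooth :: "(int \<Rightarrow> 'v) \<times> (int \<Rightarrow> 'v) \<Rightarrow> int \<Rightarrow> bool" where
  "smooth Z R \<longleftrightarrow> (\<forall>j>R. TG j Z = 0 \<and> TL j Z = 0)"

lemma smoothD:
  assumes "smooth Z R" "j > R"
  shows "T.G j (fst Z (k + j)) = snd Z (k - 1)"
    and "T.G j (snd Z (k + j)) = sc (kap + of_int k + of_int (2 * j + 2) * hh) (fst Z k)"
    and "T.L j (fst Z (k + j)) = sc (kap + of_int k + of_int (j + 1) * hh) (fst Z k)"
proof -
  have 0: "TG j Z = 0" "TL j Z = 0" using assms by (auto simp: smooth_def)
  have "fst (TG j Z) (k + j) = 0" "snd (TG j Z) (k + j) = 0" "fst (TL j Z) (k + j) = 0"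
    unfolding 0 by simp_all
  then show "T.G j (fst Z (k + j)) = snd Z (k - 1)"
    "T.G j (snd Z (k + j)) = sc (kap + of_int k + of_int (2 * j + 2) * hh) (fst Z k)"
    "T.L j (fst Z (k + j)) = sc (kap + of_int k + of_int (j + 1) * hh) (fst Z k)"
    by (simp_all only: TG_def TL_def fst_conv snd_conv add_diff_cancel_right' right_minus_eq neg_equal_iff_equal
        diff_add_eq_diff_diff_swap add_diff_cancel eq_neg_iff_add_eq_0[symmetric] neg_eq_iff_add_eq_0)
       (simp_all add: algebra_simps)
qed

lemma smooth_mono: "smooth Z R \<Longrightarrow> R \<le> R' \<Longrightarrow> smooth Z R'"
  by (auto simp: smooth_def)

lemma sum_int_Suc:
  fixes F :: "int \<Rightarrow> 'v"
  assumes "-M \<le> R + 1"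
  shows "(\<Sum>j\<in>{-M..R+1}. F j) = (\<Sum>j\<in>{-M..R}. F j) + F (R + 1)"
proof -
  have "{-M..R+1} = insert (R + 1) {-M..R}" using assms by auto
  then show ?thesis by (simp add: add.commute)
qed

text \<open>A mode above R turns its coefficient into a known multiple of \<open>fst Z p\<close>, so
  enlarging the window by d adds an arithmetic progression.\<close>

lemma SG_shift:
  assumes "smooth Z R" "-M \<le> R + 1"
  shows "(\<Sum>j\<in>{-M..R + int d}. T.G j (snd Z (p + j))) = (\<Sum>j\<in>{-M..R}. T.G j (snd Z (p + j)))
     + sc (of_nat d * (kap + of_int p) + hh * of_nat d * (2 * of_int R + of_nat d + 3)) (fst Z p)"
proof (induct d)
  case (Suc d)
  have "(\<Sum>j\<in>{-M..R + int (Suc d)}. T.G j (snd Z (p + j))) = (\<Sum>j\<in>{-M..R + int d + 1}. T.G j (snd Z (p + j)))"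
    by (simp add: add.assoc add.commute[of 1])
  also have "\<dots> = (\<Sum>j\<in>{-M..R + int d}. T.G j (snd Z (p + j))) + T.G (R + int d + 1) (snd Z (p + (R + int d + 1)))"
    using assms(2) by (intro sum_int_Suc) simp
  also have "T.G (R + int d + 1) (snd Z (p + (R + int d + 1))) = sc (kap + of_int p + of_int (2 * (R + int d + 1) + 2) * hh) (fst Z p)"
    by (rule smoothD(2)[OF assms(1)]) simp
  finally show ?case unfolding Suc add.assoc T.scale_left_distrib[symmetric]
    by (simp add: algebra_simps)
qed simp

lemma SL_shift:
  assumes "smooth Z R" "-M \<le> R + 1"
  shows "(\<Sum>j\<in>{-M..R + int d}. T.L j (fst Z (p + j))) = (\<Sum>j\<in>{-M..R}. T.L j (fst Z (p + j)))
     + sc (of_nat d * (kap + of_int p) + hh * of_nat d * (2 * of_int R + of_nat d + 3) / 2) (fst Z p)"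
proof (induct d)
  case (Suc d)
  have "(\<Sum>j\<in>{-M..R + int (Suc d)}. T.L j (fst Z (p + j))) = (\<Sum>j\<in>{-M..R + int d + 1}. T.L j (fst Z (p + j)))"
    by (simp add: add.assoc add.commute[of 1])
  also have "\<dots> = (\<Sum>j\<in>{-M..R + int d}. T.L j (fst Z (p + j))) + T.L (R + int d + 1) (fst Z (p + (R + int d + 1)))"
    using assms(2) by (intro sum_int_Suc) simp
  also have "T.L (R + int d + 1) (fst Z (p + (R + int d + 1))) = sc (kap + of_int p + of_int (R + int d + 1 + 1) * hh) (fst Z p)"
    by (rule smoothD(3)[OF assms(1)]) simp
  finally show ?case unfolding Suc add.assoc T.scale_left_distrib[symmetric]
    by (simp add: field_simps)
qed simp

lemma SA_shift:
  assumes "smooth Z R" "-M \<le> R + 1"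
  shows "(\<Sum>j\<in>{-M..R + int d}. sc (x + y * of_int j) (T.G j (fst Z (m + j + 2)))) = (\<Sum>j\<in>{-M..R}. sc (x + y * of_int j) (T.G j (fst Z (m + j + 2))))
     + sc (of_nat d * x + y * of_nat d * (2 * of_int R + of_nat d + 1) / 2) (snd Z (m + 1))"
proof (induct d)
  case (Suc d)
  let ?F = "\<lambda>j. sc (x + y * of_int j) (T.G j (fst Z (m + j + 2)))"
  have "(\<Sum>j\<in>{-M..R + int (Suc d)}. ?F j) = (\<Sum>j\<in>{-M..R + int d + 1}. ?F j)"
    by (simp add: add.assoc add.commute[of 1])
  also have "\<dots> = (\<Sum>j\<in>{-M..R + int d}. ?F j) + ?F (R + int d + 1)"
    using assms(2) by (intro sum_int_Suc) simp
  also have "T.G (R + int d + 1) (fst Z (m + (R + int d + 1) + 2)) = snd Z (m + 1)"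
    using smoothD(1)[OF assms(1), of "R + int d + 1" "m + 2"] by (simp add: algebra_simps)
  finally have *: "(\<Sum>j\<in>{-M..R + int (Suc d)}. ?F j) = (\<Sum>j\<in>{-M..R + int d}. ?F j)
      + sc (x + y * of_int (R + int d + 1)) (snd Z (m + 1))" .
  have e: "of_nat (Suc d) * x + y * of_nat (Suc d) * (2 * of_int R + of_nat (Suc d) + 1) / 2
     = (of_nat d * x + y * of_nat d * (2 * of_int R + of_nat d + 1) / 2) + (x + y * of_int (R + int d + 1))"
    by (simp add: field_simps)
  show ?case unfolding * Suc e by (simp only: T.scale_left_distrib add.assoc)
qed simp

lemma lbdD: "lbd Z k0 \<Longrightarrow> k < k0 \<Longrightarrow> fst Z k = 0" "lbd Z k0 \<Longrightarrow> k < k0 \<Longrightarrow> snd Z k = 0"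
  by (auto simp: lbd_def)

text \<open>The null field and its partner are again the components of a superfield, of weight hh +
  3/2, and this is its rule for G_i. The window for \<open>TG i Z\<close> must reach R - i - 1,
  because the anticommutator of G_i and G_j kills the vector only if i + j + 1 > R.\<close>

lemma NG:
  assumes Z: "Z \<in> S2" and sm: "smooth Z R" and lb: "lbd Z k0" and i: "i \<le> -1" and R: "R \<ge> 0"
    and M: "M \<ge> 0" "M \<ge> m + 2 - i - k0"
  shows "NN M (R - i - 1) (TG i Z) m = NP M R Z (m + 1 - i) - T.G i (NN M (R - i - 1) Z m)"
proof -
  define d where "d = nat (- i - 1)"
  have d: "int d = - i - 1" "R - i - 1 = R + int d" using i by (auto simp: d_def)
  define p where "p = m + 1 - i"
  define ct where "ct = c / 3 * of_int (i * (i + 1))"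
  let ?A = "fst Z" and ?B = "snd Z"
  have S: "?A k \<in> S" "?B k \<in> S" for k using Z by (auto simp: S2_def)
  let ?I = "{-M..R - i - 1}"
  have "(\<Sum>j\<in>?I. T.G j (fst (TG i Z) (m + j + 2))) + (\<Sum>j\<in>?I. T.G i (T.G j (?A (m + j + 2))))
     = (\<Sum>j\<in>?I. sc 2 (T.L (i + j + 1) (?A (p + (i + j + 1)))) + (if j = - i - 1 then sc ct (?A p) else 0) - T.G j (?B (p + j)))"
    unfolding sum.distrib[symmetric]
  proof (rule sum.cong[OF refl])
    fix j
    have e: "m + j + 2 = p + (i + j + 1)" "p + (i + j + 1) - i - 1 = p + j" by (simp_all add: p_def)
    have "T.G i (T.G j (?A (p + (i + j + 1)))) = - T.G j (T.G i (?A (p + (i + j + 1)))) + sc 2 (T.L (i + j + 1) (?A (p + (i + j + 1))))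
        + (if j = - i - 1 then sc ct (?A p) else 0)"
    proof (cases "j = - i - 1")
      case True
      then have "i + j + 1 = 0" by simp
      then show ?thesis using T.GG[OF S(1)[of "p + (i + j + 1)"], of i j] True unfolding ct_def by (simp only: simp_thms if_True add_0_right)
    next
      case False
      then have "i + j + 1 \<noteq> 0" by simp
      then show ?thesis using T.GG[OF S(1)[of "p + (i + j + 1)"], of i j] False by (simp only: if_False T.scale_zero_left)
    qed
    then show "T.G j (fst (TG i Z) (m + j + 2)) + T.G i (T.G j (?A (m + j + 2)))
       = sc 2 (T.L (i + j + 1) (?A (p + (i + j + 1)))) + (if j = - i - 1 then sc ct (?A p) else 0) - T.G j (?B (p + j))"
      unfolding e(1) TG_def fst_conv e(2) T.J_diff by simp
  qed
  also have "\<dots> = sc 2 (\<Sum>n\<in>{-M..R}. T.L n (?A (p + n))) + sc ct (?A p) - (\<Sum>j\<in>?I. T.G j (?B (p + j)))"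
  proof -
    have "(\<Sum>j\<in>?I. T.L (i + j + 1) (?A (p + (i + j + 1)))) = (\<Sum>n\<in>{-M+i+1..R}. T.L n (?A (p + n)))"
      by (rule sum.reindex_bij_witness[of _ "\<lambda>n. n - i - 1" "\<lambda>j. i + j + 1"]) auto
    also have "\<dots> = (\<Sum>n\<in>{-M..R}. T.L n (?A (p + n)))"
      by (rule sum.mono_neutral_right) (use i M in \<open>auto simp: p_def lbdD(1)[OF lb]\<close>)
    finally have 1: "(\<Sum>j\<in>?I. T.L (i + j + 1) (?A (p + (i + j + 1)))) = (\<Sum>n\<in>{-M..R}. T.L n (?A (p + n)))" .
    have 2: "(\<Sum>j\<in>?I. if j = - i - 1 then sc ct (?A p) else 0) = sc ct (?A p)"
      using R M i by (subst sum.delta) auto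
    show ?thesis
      unfolding sum.distrib sum_subtractf 2 T.scale_sum_right[symmetric] 1 ..
  qed
  also have "(\<Sum>j\<in>?I. T.G j (?B (p + j))) = (\<Sum>j\<in>{-M..R}. T.G j (?B (p + j)))
     + sc (of_nat d * (kap + of_int p) + hh * of_nat d * (2 * of_int R + of_nat d + 3)) (?A p)"
    unfolding d(2) using sm M R by (intro SG_shift) auto
  finally have main: "(\<Sum>j\<in>?I. T.G j (fst (TG i Z) (m + j + 2))) + (\<Sum>j\<in>?I. T.G i (T.G j (?A (m + j + 2))))
     = sc 2 (\<Sum>n\<in>{-M..R}. T.L n (?A (p + n))) + sc ct (?A p) - ((\<Sum>j\<in>{-M..R}. T.G j (?B (p + j)))
     + sc (of_nat d * (kap + of_int p) + hh * of_nat d * (2 * of_int R + of_nat d + 3)) (?A p))" .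
  have dc: "of_nat d = (- of_int i - 1 :: complex)"
    using arg_cong[OF d(1), of "of_int :: int \<Rightarrow> complex"] by simp
  show ?thesis
  proof (rule functional_eqI[OF T.vector_space_axioms])
    fix f :: "'v \<Rightarrow> complex" assume "Vector_Spaces.linear sc (*) f"
    then interpret f: Vector_Spaces.linear sc "(*)" f .
    have B: "snd (TG i Z) (m + 1) = - T.G i (?B (m + 1)) + sc (kap + of_int p + of_int (2 * i + 2) * hh) (?A p)"
      by (simp add: TG_def p_def)
    have m: "m = p + i - 1" by (simp add: p_def)
    note main' = arg_cong[OF main, of f, unfolded f.add f.diff f.scale]
    obtain X where X: "f (\<Sum>j\<in>?I. T.G j (fst (TG i Z) (m + j + 2))) = X" by blast
    obtain Y where Y: "f (\<Sum>j\<in>?I. T.G i (T.G j (?A (m + j + 2)))) = Y" by blast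
    obtain SL where SL: "f (\<Sum>n\<in>{-M..R}. T.L n (?A (p + n))) = SL" by blast
    obtain SG where SG: "f (\<Sum>j\<in>{-M..R}. T.G j (?B (p + j))) = SG" by blast
    obtain a where a: "f (?A p) = a" by blast
    obtain b where b: "f (T.G i (?B (m + 1))) = b" by blast
    have c3: "3 * (c / 3) = c" by simp
    have n3: "tau * c = 3 * (2 * hh - tau * hh)" using null c3 by algebra
    have ct: "3 * ct = c * of_int i * (of_int i + 1)" by (simp add: ct_def)
    have h2: "2 * hh = 2 * tau - 1" using hh by simp
    have "X + Y = 2 * SL + ct * a - (SG + ((- of_int i - 1) * (kap + of_int p) + hh * (- of_int i - 1) * (2 * of_int R - of_int i + 2)) * a)"
      using main' unfolding X Y SL SG a dc by simp
    \<comment> \<open>The factor 6 clears the 2 from \<open>hh\<close> and the 3 from c / 3; what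
      remains is a polynomial identity modulo the two null conditions.\<close>
    then have "6 * ((kap + (of_int p + of_int i) + tau * (of_int R - of_int i + 1)) * (- b + (kap + of_int p + (2 * of_int i + 2) * hh) * a) - tau * X)
      = 6 * ((kap + of_int p) * (kap + of_int p - 1 + tau * (of_int R + 2)) * a - 2 * tau * SL + tau * SG
         - ((kap + (of_int p + of_int i) + tau * (of_int R - of_int i + 1)) * b - tau * Y))" (is "6 * ?l = 6 * ?r")
      using n3 ct h2 by algebra
    then have "?l = ?r" by (simp only: mult_cancel_left) simp
    then show "f (NN M (R - i - 1) (TG i Z) m) = f (NP M R Z (m + 1 - i) - T.G i (NN M (R - i - 1) Z m))"
      unfolding NN_def NP_def p_def[symmetric] B T.J_diff T.J_scale T.J_sum f.diff f.scale f.add f.neg X Y SL SG a b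
      by (simp add: m add.commute)
  qed
qed

text \<open>The null field is primary of weight tau + 1 = hh + 3/2, so its commutator with L_n has
  the factor kap + (m - n) + (n + 1) (tau + 1), which is the factor in the statement.\<close>

lemma NL:
  assumes Z: "Z \<in> S2" and sm: "smooth Z (R + n)" and lb: "lbd Z k0" and n: "n \<le> -1" and R: "R + n \<ge> 0"
    and M: "M \<ge> 0" "M \<ge> m - n + 2 - k0"
  shows "NN M R (TL n Z) m = T.L n (NN M R Z m)
     - sc (kap + of_int (m + 1) + of_int (n + 1) * tau) (NN M (R + n) Z (m - n))"
proof -
  define d where "d = nat (- n)"
  have d: "int d = - n" "R = (R + n) + int d" using n by (auto simp: d_def)
  define q where "q = m - n"
  define C where "C = kap + of_int (m + 1) + of_int (n + 1) * tau"
  define x where "x = kap + of_int (m + 2 - n) + of_int (n + 1) * hh"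
  let ?A = "fst Z" and ?B = "snd Z"
  have S: "?A k \<in> S" "?B k \<in> S" for k using Z by (auto simp: S2_def)
  let ?I = "{-M..R}"
  have "(\<Sum>j\<in>?I. T.G j (fst (TL n Z) (m + j + 2)))
     = (\<Sum>j\<in>?I. T.L n (T.G j (?A (m + j + 2)))
        + sc (of_int (j + n) - of_int n + 1 / 2 - of_int n / 2) (T.G (j + n) (?A (q + (j + n) + 2)))
        - sc (x + 1 * of_int j) (T.G j (?A (q + j + 2))))"
  proof (rule sum.cong[OF refl])
    fix j
    have e: "m + j + 2 = q + (j + n) + 2" "q + (j + n) + 2 - n = q + j + 2" by (simp_all add: q_def)
    have "kap + of_int (q + j + 2) + of_int (n + 1) * hh = x + 1 * of_int j"
      by (simp add: x_def q_def)
    then show "T.G j (fst (TL n Z) (m + j + 2)) = T.L n (T.G j (?A (m + j + 2)))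
        + sc (of_int (j + n) - of_int n + 1 / 2 - of_int n / 2) (T.G (j + n) (?A (q + (j + n) + 2)))
        - sc (x + 1 * of_int j) (T.G j (?A (q + j + 2)))"
      unfolding e(1) TL_def fst_conv e(2) T.J_diff T.J_scale using T.GL[OF S(1)[of "q + (j + n) + 2"], of j n] by simp
  qed
  also have "\<dots> = (\<Sum>j\<in>?I. T.L n (T.G j (?A (m + j + 2))))
        + (\<Sum>j\<in>{-M..R + n}. sc (of_int j - of_int n + 1 / 2 - of_int n / 2) (T.G j (?A (q + j + 2))))
        - (\<Sum>j\<in>?I. sc (x + 1 * of_int j) (T.G j (?A (q + j + 2))))"
  proof -
    have "(\<Sum>j\<in>?I. sc (of_int (j + n) - of_int n + 1 / 2 - of_int n / 2) (T.G (j + n) (?A (q + (j + n) + 2))))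
      = (\<Sum>j\<in>{-M+n..R+n}. sc (of_int j - of_int n + 1 / 2 - of_int n / 2) (T.G j (?A (q + j + 2))))"
      by (rule sum.reindex_bij_witness[of _ "\<lambda>j. j - n" "\<lambda>j. j + n"]) auto
    also have "\<dots> = (\<Sum>j\<in>{-M..R+n}. sc (of_int j - of_int n + 1 / 2 - of_int n / 2) (T.G j (?A (q + j + 2))))"
      by (rule sum.mono_neutral_right) (use n M in \<open>auto simp: q_def lbdD(1)[OF lb]\<close>)
    finally show ?thesis unfolding sum.distrib sum_subtractf by simp
  qed
  also have "(\<Sum>j\<in>?I. sc (x + 1 * of_int j) (T.G j (?A (q + j + 2))))
     = (\<Sum>j\<in>{-M..R+n}. sc (x + 1 * of_int j) (T.G j (?A (q + j + 2))))
       + sc (of_nat d * x + 1 * of_nat d * (2 * of_int (R + n) + of_nat d + 1) / 2) (?B (q + 1))"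
    by (subst d(2), rule SA_shift) (use sm M R in auto)
  also have "(\<Sum>j\<in>?I. T.L n (T.G j (?A (m + j + 2))))
        + (\<Sum>j\<in>{-M..R + n}. sc (of_int j - of_int n + 1 / 2 - of_int n / 2) (T.G j (?A (q + j + 2)))) -
        ((\<Sum>j\<in>{-M..R+n}. sc (x + 1 * of_int j) (T.G j (?A (q + j + 2))))
       + sc (of_nat d * x + 1 * of_nat d * (2 * of_int (R + n) + of_nat d + 1) / 2) (?B (q + 1)))
     = T.L n (\<Sum>j\<in>?I. T.G j (?A (m + j + 2))) - sc C (\<Sum>j\<in>{-M..R + n}. T.G j (?A (q + j + 2)))
       - sc (of_nat d * x + 1 * of_nat d * (2 * of_int (R + n) + of_nat d + 1) / 2) (?B (q + 1))"
  proof -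
    have "sc (of_int j - of_int n + 1 / 2 - of_int n / 2) v - sc (x + 1 * of_int j) v = - sc C v" for j v
    proof -
      have "of_int j - of_int n + 1 / 2 - of_int n / 2 - (x + 1 * of_int j) = - C"
        by (simp add: x_def C_def hh algebra_simps)
      then show ?thesis by (simp only: T.scale_left_diff_distrib[symmetric] T.scale_minus_left)
    qed
    then have "(\<Sum>j\<in>{-M..R + n}. sc (of_int j - of_int n + 1 / 2 - of_int n / 2) (T.G j (?A (q + j + 2)))) -
        (\<Sum>j\<in>{-M..R+n}. sc (x + 1 * of_int j) (T.G j (?A (q + j + 2))))
       = - sc C (\<Sum>j\<in>{-M..R + n}. T.G j (?A (q + j + 2)))"
      unfolding sum_subtractf[symmetric] by (simp only: T.scale_sum_right sum_negf)
    then show ?thesis by (simp add: T.J_sum algebra_simps)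
  qed
  finally have main: "(\<Sum>j\<in>?I. T.G j (fst (TL n Z) (m + j + 2)))
     = T.L n (\<Sum>j\<in>?I. T.G j (?A (m + j + 2))) - sc C (\<Sum>j\<in>{-M..R + n}. T.G j (?A (q + j + 2)))
       - sc (of_nat d * x + 1 * of_nat d * (2 * of_int (R + n) + of_nat d + 1) / 2) (?B (q + 1))" .
  have dc: "of_nat d = (- of_int n :: complex)"
    using arg_cong[OF d(1), of "of_int :: int \<Rightarrow> complex"] by simp
  show ?thesis
  proof (rule functional_eqI[OF T.vector_space_axioms])
    fix f :: "'v \<Rightarrow> complex" assume "Vector_Spaces.linear sc (*) f"
    then interpret f: Vector_Spaces.linear sc "(*)" f .
    have B: "snd (TL n Z) (m + 1) = T.L n (?B (m + 1)) - sc (kap + of_int (q + 1) + of_int (n + 1) * (hh + 1 / 2)) (?B (q + 1))"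
      by (simp add: TL_def q_def algebra_simps)
    note main' = arg_cong[OF main, of f, unfolded f.add f.diff f.scale]
    obtain X where X: "f (\<Sum>j\<in>?I. T.G j (fst (TL n Z) (m + j + 2))) = X" by blast
    obtain Y where Y: "f (T.L n (\<Sum>j\<in>?I. T.G j (?A (m + j + 2)))) = Y" by blast
    obtain W where W: "f (\<Sum>j\<in>{-M..R + n}. T.G j (?A (q + j + 2))) = W" by blast
    obtain a where a: "f (?B (q + 1)) = a" by blast
    obtain b where b: "f (T.L n (?B (m + 1))) = b" by blast
    have "X = Y - C * W - (- of_int n * x - of_int n * (2 * of_int R + of_int n + 1) / 2) * a"
      using main' unfolding X Y W a dc by simp
    moreover have "(of_int n * (2 * of_int R + of_int n + 1) / 2) * 2 = of_int n * (2 * of_int R + of_int n + (1 :: complex))"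
      by simp
    moreover have "C = kap + of_int m + 1 + (of_int n + 1) * tau" by (simp add: C_def)
    moreover have "2 * x = 2 * kap + 2 * (of_int m + 2 - of_int n) + (of_int n + 1) * (2 * tau - 1)"
    proof -
      have "2 * hh = 2 * tau - 1" using hh by simp
      then show ?thesis unfolding x_def of_int_add of_int_diff of_int_1 of_int_numeral by algebra
    qed
    ultimately have "2 * ((kap + (of_int m + 1) + tau * (of_int R + 2)) * (b - (kap + (of_int m - of_int n + 1) + (of_int n + 1) * tau) * a) - tau * X)
      = 2 * ((kap + (of_int m + 1) + tau * (of_int R + 2)) * b - tau * Y - C * ((kap + (of_int m - of_int n + 1) + tau * (of_int R + of_int n + 2)) * a - tau * W))"
      (is "2 * ?l = 2 * ?r") by algebra
    then have "?l = ?r" by (simp only: mult_cancel_left) simp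
    moreover have "hh + 1 / 2 = tau" by (simp add: hh)
    ultimately show "f (NN M R (TL n Z) m) = f (T.L n (NN M R Z m)
     - sc (kap + of_int (m + 1) + of_int (n + 1) * tau) (NN M (R + n) Z (m - n)))"
      unfolding NN_def q_def[symmetric] C_def[symmetric] B T.J_diff T.J_scale f.diff f.scale f.add f.neg X Y W a b
      by (simp add: q_def)
  qed
qed

text \<open>Solutions of the null vector equation. Asking for it on all sufficiently large windows
  makes the set a subspace and allows for the growth of the window under negative modes.\<close>

definition kill :: "((int \<Rightarrow> 'v) \<times> (int \<Rightarrow> 'v)) set" where
  "kill = {Z \<in> S2. \<exists>R0 k0. R0 \<ge> 0 \<and> smooth Z R0 \<and> lbd Z k0 \<and>
     (\<forall>R M m. R \<ge> R0 \<longrightarrow> M \<ge> 0 \<longrightarrow> M \<ge> m + 2 - k0 \<longrightarrow> NN M R Z m = 0 \<and> NP M R Z m = 0)}"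

lemma lbd_mono: "lbd Z k0 \<Longrightarrow> k1 \<le> k0 \<Longrightarrow> lbd Z k1"
  by (auto simp: lbd_def)

lemma NN_add: "NN M R (Z + W) m = NN M R Z m + NN M R W m"
  by (simp add: NN_def T.J_add sum.distrib T.scale_right_distrib)

lemma NP_add: "NP M R (Z + W) m = NP M R Z m + NP M R W m"
  by (simp add: NP_def T.J_add sum.distrib T.scale_right_distrib)

lemma NN_scale: "NN M R (sc2 x Z) m = sc x (NN M R Z m)"
  by (simp add: NN_def sc2_def T.J_scale T.scale_sum_right T.scale_right_diff_distrib mult.commute)

lemma NP_scale: "NP M R (sc2 x Z) m = sc x (NP M R Z m)"
  by (simp add: NP_def sc2_def T.J_scale T.scale_sum_right T.scale_right_diff_distrib T.scale_right_distrib ac_simps)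

lemma smooth_add: "smooth Z R \<Longrightarrow> smooth W R \<Longrightarrow> smooth (Z + W) R"
  using TJ_add[of "2 * _" Z W] TJ_add[of "2 * _ + 1" Z W] by (simp add: smooth_def)

lemma smooth_scale: "smooth Z R \<Longrightarrow> smooth (sc2 x Z) R"
  using TJ_scale[of "2 * _" x Z] TJ_scale[of "2 * _ + 1" x Z] D.scale_zero_right by (simp add: smooth_def)

lemma killI:
  assumes "Z \<in> S2" "R0 \<ge> 0" "smooth Z R0" "lbd Z k0"
    "\<And>R M m. R \<ge> R0 \<Longrightarrow> M \<ge> 0 \<Longrightarrow> M \<ge> m + 2 - k0 \<Longrightarrow> NN M R Z m = 0 \<and> NP M R Z m = 0"
  shows "Z \<in> kill"
  unfolding kill_def using assms by blast

lemma kill_subspace: "D.subspace kill"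
proof (rule D.subspaceI)
  show "0 \<in> kill"
    by (auto simp: kill_def S2_def T.subspace_0[OF T.S_subspace] smooth_def lbd_def NN_def NP_def TL_def TG_def fun_eq_iff
        zero_prod_def intro!: exI[of _ 0])
next
  fix Z W assume Z: "Z \<in> kill" and W: "W \<in> kill"
  from Z obtain R0 k0 where 1: "Z \<in> S2" "R0 \<ge> 0" "smooth Z R0" "lbd Z k0"
     "\<And>R M m. R \<ge> R0 \<Longrightarrow> M \<ge> 0 \<Longrightarrow> M \<ge> m + 2 - k0 \<Longrightarrow> NN M R Z m = 0 \<and> NP M R Z m = 0"
    unfolding kill_def by blast
  from W obtain R1 k1 where 2: "W \<in> S2" "R1 \<ge> 0" "smooth W R1" "lbd W k1"
     "\<And>R M m. R \<ge> R1 \<Longrightarrow> M \<ge> 0 \<Longrightarrow> M \<ge> m + 2 - k1 \<Longrightarrow> NN M R W m = 0 \<and> NP M R W m = 0"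
    unfolding kill_def by blast
  have "smooth (Z + W) (max R0 R1)"
    using 1 2 by (intro smooth_add) (auto intro: smooth_mono)
  moreover have "lbd (Z + W) (min k0 k1)" using 1(4) 2(4) by (auto simp: lbd_def)
  moreover have "Z + W \<in> S2" using 1 2 D.subspace_add[OF D.S_subspace] by blast
  ultimately show "Z + W \<in> kill"
    using 1(2,5) 2(5) by (intro killI[of _ "max R0 R1" "min k0 k1"]) (auto simp: NN_add NP_add)
next
  fix x Z assume Z: "Z \<in> kill"
  from Z obtain R0 k0 where 1: "Z \<in> S2" "R0 \<ge> 0" "smooth Z R0" "lbd Z k0"
     "\<And>R M m. R \<ge> R0 \<Longrightarrow> M \<ge> 0 \<Longrightarrow> M \<ge> m + 2 - k0 \<Longrightarrow> NN M R Z m = 0 \<and> NP M R Z m = 0"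
    unfolding kill_def by blast
  have "lbd (sc2 x Z) k0" using 1(4) by (auto simp: lbd_def sc2_def)
  moreover have "sc2 x Z \<in> S2" using 1 D.subspace_scale[OF D.S_subspace] by blast
  ultimately show "sc2 x Z \<in> kill"
    using smooth_scale[OF 1(3), of x] by (intro killI[of _ R0 k0]) (use 1(2,5) in \<open>auto simp: NN_scale NP_scale\<close>)
qed

text \<open>\<open>NP\<close> of \<open>TG i Z\<close> needs no rule of its own: \<open>NG\<close>
  applied to \<open>TG i Z\<close> expresses it through \<open>NN\<close> of the square of
  \<open>TG i\<close>, which is \<open>TL (2 i + 1)\<close> and is governed by
  \<open>NL\<close>.\<close>

lemma kill_TG:
  assumes "Z \<in> kill" and i: "i \<le> -1"
  shows "TG i Z \<in> kill"
proof -
  from assms obtain R0 k0 where 1: "Z \<in> S2" "R0 \<ge> 0" "smooth Z R0" "lbd Z k0"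
     "\<And>R M m. R \<ge> R0 \<Longrightarrow> M \<ge> 0 \<Longrightarrow> M \<ge> m + 2 - k0 \<Longrightarrow> NN M R Z m = 0 \<and> NP M R Z m = 0"
    unfolding kill_def by blast
  define R1 where "R1 = R0 - i"
  define k1 where "k1 = k0 + i - 1"
  have T0: "TL j 0 = 0" "TG j 0 = 0" for j
    using D.J_0[of "2 * j"] D.J_0[of "2 * j + 1"] by simp_all
  have Z1: "TG i Z \<in> S2" using D.J_closed[OF 1(1), of "2 * i + 1"] by simp
  have s1: "smooth (TG i Z) R1"
    unfolding smooth_def
  proof (intro allI impI conjI)
    fix j assume j: "j > R1"
    then have z: "TG j Z = 0" "TL (j + i + 1) Z = 0" "TL j Z = 0" "TG (i + j) Z = 0"
      using 1(3) i by (auto simp: smooth_def R1_def)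
    show "TG j (TG i Z) = 0" using TGG[OF 1(1), of j i] z j i 1(2) by (simp add: R1_def T0 D.scale_zero_right)
    show "TL j (TG i Z) = 0" using TLG[OF 1(1), of j i] z by (simp add: T0 D.scale_zero_right)
  qed
  have l1: "lbd (TG i Z) k1" using 1(4) i by (auto simp: lbd_def TG_def k1_def)
  have N1: "NN M R (TG i Z) m = 0" if "R \<ge> R1" "M \<ge> 0" "M \<ge> m + 2 - k1" for R M m
  proof -
    have "NN M ((R + i + 1) - i - 1) (TG i Z) m = NP M (R + i + 1) Z (m + 1 - i) - T.G i (NN M ((R + i + 1) - i - 1) Z m)"
      using that i 1 by (intro NG[where ?k0.0 = k0]) (auto simp: R1_def k1_def intro: smooth_mono)
    moreover have "NP M (R + i + 1) Z (m + 1 - i) = 0" using 1(5)[of "R + i + 1" M "m + 1 - i"] that by (simp add: R1_def k1_def)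
    moreover have "NN M R Z m = 0" using 1(5)[of R M m] that i by (simp add: R1_def k1_def)
    ultimately show ?thesis by simp
  qed
  have N2: "NP M R (TG i Z) p = 0" if "R \<ge> R1" "M \<ge> 0" "M \<ge> p + 2 - k1 - i" for R M p
  proof -
    let ?m = "p + i - 1"
    have "NN M (R - i - 1) (TG i (TG i Z)) ?m = NP M R (TG i Z) (?m + 1 - i) - T.G i (NN M (R - i - 1) (TG i Z) ?m)"
      using that i 1(2) s1 l1 Z1 by (intro NG[where ?k0.0 = k1]) (auto simp: R1_def k1_def intro: smooth_mono)
    moreover have "NN M (R - i - 1) (TG i Z) ?m = 0" using that i by (intro N1) auto
    moreover have "TG i (TG i Z) = TL (2 * i + 1) Z"
    proof -
      have "i + i + 1 \<noteq> 0" by presburger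
      then have x: "TG i (TG i Z) = - TG i (TG i Z) + sc2 2 (TL (i + i + 1) Z)"
        using TGG[OF 1(1), of i i] by (simp only: if_False D.scale_zero_left add_0_right)
      have "TG i (TG i Z) + TG i (TG i Z) = sc2 2 (TL (i + i + 1) Z)"
        using arg_cong[OF x, of "\<lambda>u. TG i (TG i Z) + u"] by simp
      then have "sc2 2 (TG i (TG i Z)) = sc2 2 (TL (2 * i + 1) Z)"
        by (metis D.scale_left_distrib D.scale_one one_add_one mult_2)
      then show ?thesis by simp
    qed
    moreover have "NN M (R - i - 1) (TL (2 * i + 1) Z) ?m = 0"
    proof -
      have "NN M (R - i - 1) (TL (2 * i + 1) Z) ?m = T.L (2 * i + 1) (NN M (R - i - 1) Z ?m)
         - sc (kap + of_int (?m + 1) + of_int (2 * i + 1 + 1) * tau) (NN M (R - i - 1 + (2 * i + 1)) Z (?m - (2 * i + 1)))"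
        using that i 1 by (intro NL[where ?k0.0 = k0]) (auto simp: R1_def k1_def intro: smooth_mono)
      moreover have "NN M (R - i - 1) Z ?m = 0" using 1(5)[of "R - i - 1" M ?m] that i by (simp add: R1_def k1_def)
      moreover have "NN M (R - i - 1 + (2 * i + 1)) Z (?m - (2 * i + 1)) = 0"
        using 1(5)[of "R - i - 1 + (2 * i + 1)" M "?m - (2 * i + 1)"] that i by (simp add: R1_def k1_def)
      ultimately show ?thesis by simp
    qed
    ultimately show ?thesis by simp
  qed
  have "NN M R (TG i Z) m = 0 \<and> NP M R (TG i Z) m = 0" if "R \<ge> R1" "M \<ge> 0" "M \<ge> m + 2 - (k1 + i)" for R M m
    using N1[of R M m] N2[of R M m] that i by simp
  moreover have "lbd (TG i Z) (k1 + i)" using l1 i by (auto intro: lbd_mono)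
  ultimately show ?thesis
    using Z1 s1 1(2) i by (intro killI[of _ R1 "k1 + i"]) (auto simp: R1_def)
qed

text \<open>L_n is half the anticommutator of G_{-1/2} and G_{n+1/2}, so the odd modes
  suffice.\<close>

lemma kill_TJ:
  assumes Z: "Z \<in> kill" and a: "a < 0"
  shows "TJ a Z \<in> kill"
proof (cases "even a")
  case False
  then obtain i where "a = 2 * i + 1" by (auto elim: oddE)
  then show ?thesis using kill_TG[OF Z, of i] a by simp
next
  case True
  then obtain n where n: "a = 2 * n" by (auto elim: evenE)
  have S: "Z \<in> S2" using Z by (simp add: kill_def)
  have "TG (-1) (TG n Z) = - TG n (TG (-1) Z) + sc2 2 (TL n Z)"
    using TGG[OF S, of "-1" n] n a by (simp add: D.scale_zero_left)
  then have "sc2 2 (TL n Z) = TG (-1) (TG n Z) + TG n (TG (-1) Z)" by simp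
  moreover have "TG (-1) (TG n Z) + TG n (TG (-1) Z) \<in> kill"
    using Z n a by (intro D.subspace_add[OF kill_subspace] kill_TG) auto
  ultimately have "sc2 (1 / 2) (sc2 2 (TL n Z)) \<in> kill" by (simp only: D.subspace_scale[OF kill_subspace])
  then show ?thesis using n by simp
qed

end

section \<open>Null equations on highest weight series\<close>

context degenerate
begin

text \<open>The additional modes of the larger window give multiples of one coefficient, which the
  factor R + 2 compensates.\<close>

lemma NN_shift:
  assumes "smooth Z R" "-M \<le> R + 1"
  shows "NN M (R + int d) Z m = NN M R Z m"
proof -
  have "(\<Sum>j\<in>{-M..R + int d}. T.G j (fst Z (m + j + 2))) = (\<Sum>j\<in>{-M..R}. T.G j (fst Z (m + j + 2))) + sc (of_nat d) (snd Z (m + 1))"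
    using SA_shift[OF assms, of 1 0 m d] by simp
  moreover have "kap + of_int (m + 1) + tau * of_int (R + int d + 2) = (kap + of_int (m + 1) + tau * of_int (R + 2)) + tau * of_nat d"
    by (simp add: ring_distribs)
  ultimately show ?thesis
    unfolding NN_def by (simp only: T.scale_left_distrib T.scale_right_distrib T.scale_scale[symmetric]) simp
qed

lemma NP_shift:
  assumes "smooth Z R" "-M \<le> R + 1"
  shows "NP M (R + int d) Z p = NP M R Z p"
proof (rule functional_eqI[OF T.vector_space_axioms])
  fix f :: "'v \<Rightarrow> complex" assume "Vector_Spaces.linear sc (*) f"
  then interpret f: Vector_Spaces.linear sc "(*)" f .
  obtain SL where SL: "f (\<Sum>n\<in>{-M..R}. T.L n (fst Z (p + n))) = SL" by blast
  obtain SG where SG: "f (\<Sum>j\<in>{-M..R}. T.G j (snd Z (p + j))) = SG" by blast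
  obtain a where a: "f (fst Z p) = a" by blast
  obtain t where t: "(hh * of_nat d * (2 * of_int R + of_nat d + 3) / 2) = t" "hh * of_nat d * (2 * of_int R + of_nat d + 3) = 2 * t"
    by (rule that[OF refl]) simp
  have i: "of_int (R + int d + 2) = (of_int R + of_nat d + 2 :: complex)" "of_int (R + 2) = (of_int R + 2 :: complex)" by simp_all
  show "f (NP M (R + int d) Z p) = f (NP M R Z p)"
    unfolding NP_def SL_shift[OF assms] SG_shift[OF assms] f.add f.diff f.scale SL SG a t i by algebra
qed

text \<open>On a highest weight series the window R = 0 suffices, and the terms with G_{1/2} and L_0
  are known multiples of coefficients. What remains determines each coefficient by earlier ones,
  with the indicial polynomials as leading factors.\<close>

lemma hw_recursion:
  assumes sm: "smooth Z 0" and g0: "TG 0 Z = 0" and l0: "TL 0 Z = sc2 w Z" and M: "M \<ge> 0"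
  shows "NN M 0 Z m = sc (kap + of_int (m + 1) + tau) (snd Z (m + 1))
            - sc tau (\<Sum>i\<in>{0..M - 1}. T.G (-1 - i) (fst Z (m + 1 - i)))" (is ?A)
    and "NP M 0 Z p = sc ((kap + of_int p) * (kap + of_int p - 1 + tau) - 2 * tau * w) (fst Z p)
     - sc (2 * tau) (\<Sum>n\<in>{1..M}. T.L (- n) (fst Z (p - n)))
     + sc tau (\<Sum>i\<in>{0..M - 1}. T.G (-1 - i) (snd Z (p - 1 - i)))" (is ?B)
proof -
  have split0: "(\<Sum>j\<in>{-M..0}. F j) = F 0 + (\<Sum>j\<in>{-M..-1}. F j)" for F :: "int \<Rightarrow> 'v"
  proof -
    have "{-M..0} = insert 0 {-M..-1}" using M by auto
    then show ?thesis by simp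
  qed
  have re1: "(\<Sum>j\<in>{-M..-1}. F j) = (\<Sum>i\<in>{0..M - 1}. F (-1 - i))" for F :: "int \<Rightarrow> 'v"
    by (rule sum.reindex_bij_witness[of _ "\<lambda>i. -1 - i" "\<lambda>j. -1 - j"]) auto
  have re2: "(\<Sum>j\<in>{-M..-1}. F j) = (\<Sum>i\<in>{1..M}. F (- i))" for F :: "int \<Rightarrow> 'v"
    by (rule sum.reindex_bij_witness[of _ "\<lambda>i. - i" "\<lambda>j. - j"]) auto
  have c: "fst (TG 0 Z) k = 0" "snd (TG 0 Z) k = 0" "fst (TL 0 Z) k = sc w (fst Z k)" for k
    unfolding g0 l0 by (simp_all add: sc2_def)
  have G0A: "T.G 0 (fst Z (k + 1)) = snd Z k" for k
    using c(1)[of "k + 1"] by (simp add: TG_def)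
  have G0B: "T.G 0 (snd Z k) = sc (kap + of_int k + 2 * hh) (fst Z k)" for k
    using c(2)[of k] by (simp add: TG_def neg_eq_iff_add_eq_0[symmetric])
  have L0A: "T.L 0 (fst Z k) = sc (w + (kap + of_int k + hh)) (fst Z k)" for k
    using c(3)[of k] by (simp add: TL_def diff_eq_eq T.scale_left_distrib)
  show ?A
  proof -
    have i: "kap + of_int (m + 1) + tau * of_int (0 + 2) = (kap + of_int (m + 1) + tau) + tau" by simp
    have "T.G 0 (fst Z (m + 0 + 2)) = snd Z (m + 1)" using G0A[of "m + 1"] by (simp add: add.assoc)
    moreover have e: "m + (- 1 - i) + 2 = m + 1 - i" for i by simp
    ultimately show ?thesis
      unfolding NN_def split0 re1 i e T.scale_left_distrib[of _ tau] T.scale_right_distrib by simp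
  qed
  have cf: "(kap + of_int p) * (kap + of_int p - 1 + tau * of_int (0 + 2)) - 2 * tau * (w + (kap + of_int p + hh))
     + tau * (kap + of_int p + 2 * hh) = (kap + of_int p) * (kap + of_int p - 1 + tau) - 2 * tau * w"
    by (simp add: ring_distribs)
  show ?B
  proof (rule functional_eqI[OF T.vector_space_axioms])
    fix f :: "'v \<Rightarrow> complex" assume "Vector_Spaces.linear sc (*) f"
    then interpret f: Vector_Spaces.linear sc "(*)" f .
    have s: "p + (- i) = p - i" "p + (- 1 - i) = p - 1 - i" "p + 0 = p" for i by simp_all
    show "f (NP M 0 Z p) = f (sc ((kap + of_int p) * (kap + of_int p - 1 + tau) - 2 * tau * w) (fst Z p)
     - sc (2 * tau) (\<Sum>n\<in>{1..M}. T.L (- n) (fst Z (p - n)))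
     + sc tau (\<Sum>i\<in>{0..M - 1}. T.G (-1 - i) (snd Z (p - 1 - i))))"
      unfolding NP_def split0 cf[symmetric] re1[of "\<lambda>j. T.G j (snd Z (p + j))"] re2[of "\<lambda>n. T.L n (fst Z (p + n))"]
        f.add f.diff f.scale s G0B L0A by algebra
  qed
qed

end

section \<open>Fusion\<close>

text \<open>\<open>indicial\<close> leaves the coefficient at 0 free, to be filled by u0;
  \<open>nonres_a\<close> and \<open>nonres_b\<close> keep all later factors of the recursion
  nonzero.\<close>

locale fusion_vector = degenerate sc S c K kap hh tau
  for sc :: "complex \<Rightarrow> 'v::ab_group_add \<Rightarrow> 'v" and S c K kap hh tau +
  fixes hT wS :: complex and u0 :: 'v
  assumes u0: "u0 \<in> S" "\<And>a. a > 0 \<Longrightarrow> K a u0 = 0" "K 0 u0 = sc hT u0"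
    and kap: "kap = hT - hh - wS" and indicial: "kap * (kap - 1 + tau) = 2 * tau * wS"
    and nonres_a: "\<And>p :: nat. p \<ge> 1 \<Longrightarrow> (kap + of_nat p) * (kap + of_nat p - 1 + tau) - 2 * tau * wS \<noteq> 0"
    and nonres_b: "\<And>p :: nat. kap + of_nat p + tau \<noteq> 0"
begin

definition ca :: "int \<Rightarrow> complex" where
  "ca p = (kap + of_int p) * (kap + of_int p - 1 + tau) - 2 * tau * wS"

definition cb :: "int \<Rightarrow> complex" where
  "cb p = kap + of_int p + tau"

lemma ca_0: "ca 0 = 0" using indicial by (simp add: ca_def)
lemma ca_neq_0: "p \<ge> 1 \<Longrightarrow> ca p \<noteq> 0" using nonres_a[of "nat p"] by (simp add: ca_def)
lemma cb_neq_0: "p \<ge> 0 \<Longrightarrow> cb p \<noteq> 0" using nonres_b[of "nat p"] by (simp add: cb_def)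

function AB :: "nat \<Rightarrow> 'v \<times> 'v" where
  "AB p = (let a = (if p = 0 then u0 else sc (1 / ca (int p))
        (sc (2 * tau) (\<Sum>n\<in>{1..p}. T.L (- int n) (fst (AB (p - n))))
         - sc tau (\<Sum>i\<in>{0..<p}. T.G (-1 - int i) (snd (AB (p - 1 - i))))))
     in (a, sc (tau / cb (int p)) (T.G (-1) a + (\<Sum>i\<in>{1..p}. T.G (-1 - int i) (fst (AB (p - i)))))))"
  by auto
termination by (relation "measure id") auto

declare AB.simps [simp del]

lemma fst_AB: "fst (AB p) = (if p = 0 then u0 else sc (1 / ca (int p))
        (sc (2 * tau) (\<Sum>n\<in>{1..p}. T.L (- int n) (fst (AB (p - n))))
         - sc tau (\<Sum>i\<in>{0..<p}. T.G (-1 - int i) (snd (AB (p - 1 - i))))))"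
  by (subst AB.simps) (simp only: Let_def fst_conv)

lemma snd_AB: "snd (AB p) = sc (tau / cb (int p)) (T.G (-1) (fst (AB p)) + (\<Sum>i\<in>{1..p}. T.G (-1 - int i) (fst (AB (p - i)))))"
  by (subst AB.simps) (simp only: Let_def snd_conv fst_AB[symmetric])

definition AA :: "int \<Rightarrow> 'v" where "AA k = (if k < 0 then 0 else fst (AB (nat k)))"
definition BB :: "int \<Rightarrow> 'v" where "BB k = (if k < 0 then 0 else snd (AB (nat k)))"

lemma AA_0: "AA 0 = u0"
  unfolding AA_def by (subst AB.simps) (simp add: Let_def)

lemma AA_neg: "k < 0 \<Longrightarrow> AA k = 0" and BB_neg: "k < 0 \<Longrightarrow> BB k = 0"
  by (simp_all add: AA_def BB_def)

text \<open>The summation bound N is free, since coefficients of negative index vanish; this lets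
  sums with shifted indices be compared over one common range.\<close>

lemma rec_B:
  assumes N: "N \<ge> p" "N \<ge> 0"
  shows "sc (cb p) (BB p) = sc tau (\<Sum>i\<in>{0..N}. T.G (-1 - i) (AA (p - i)))"
proof (cases "p < 0")
  case True
  then show ?thesis by (simp add: BB_neg AA_neg)
next
  case False
  define q where "q = nat p"
  have p: "p = int q" using False by (simp add: q_def)
  have 1: "BB p = sc (tau / cb p) (T.G (-1) (AA p) + (\<Sum>i\<in>{1..q}. T.G (-1 - int i) (fst (AB (q - i)))))"
    unfolding p BB_def AA_def using snd_AB[of q] by simp
  have "(\<Sum>i\<in>{1..q}. T.G (-1 - int i) (fst (AB (q - i)))) = (\<Sum>i\<in>{1..int q}. T.G (-1 - i) (AA (p - i)))"
    by (rule sum.reindex_bij_witness[of _ nat int]) (auto simp: p AA_def of_nat_diff nat_diff_distrib)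
  also have "T.G (-1) (AA p) + \<dots> = (\<Sum>i\<in>{0..int q}. T.G (-1 - i) (AA (p - i)))"
  proof -
    have "{0..int q} = insert 0 {1..int q}" by auto
    then show ?thesis by simp
  qed
  also have "\<dots> = (\<Sum>i\<in>{0..N}. T.G (-1 - i) (AA (p - i)))"
    by (rule sum.mono_neutral_left) (use N p in \<open>auto simp: AA_neg\<close>)
  finally show ?thesis using 1 cb_neq_0[of p] False by simp
qed

lemma rec_A:
  assumes N: "N \<ge> p" "N \<ge> 0"
  shows "sc (ca p) (AA p) = sc (2 * tau) (\<Sum>n\<in>{1..N}. T.L (- n) (AA (p - n)))
     - sc tau (\<Sum>i\<in>{0..N}. T.G (-1 - i) (BB (p - 1 - i)))"
proof (cases "p \<le> 0")
  case True
  then have "sc (ca p) (AA p) = 0" by (cases "p = 0") (simp_all add: ca_0 AA_neg)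
  moreover have "(\<Sum>n\<in>{1..N}. T.L (- n) (AA (p - n))) = 0" "(\<Sum>i\<in>{0..N}. T.G (-1 - i) (BB (p - 1 - i))) = 0"
    using True by (intro sum.neutral; simp add: AA_neg BB_neg)+
  ultimately show ?thesis by simp
next
  case False
  define q where "q = nat p"
  have p: "p = int q" and q: "q \<ge> 1" using False by (simp_all add: q_def)
  have 1: "AA p = sc (1 / ca p) (sc (2 * tau) (\<Sum>n\<in>{1..q}. T.L (- int n) (fst (AB (q - n))))
         - sc tau (\<Sum>i\<in>{0..<q}. T.G (-1 - int i) (snd (AB (q - 1 - i)))))"
    unfolding p AA_def using fst_AB[of q] q by simp
  have "(\<Sum>n\<in>{1..q}. T.L (- int n) (fst (AB (q - n)))) = (\<Sum>n\<in>{1..int q}. T.L (- n) (AA (p - n)))"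
    by (rule sum.reindex_bij_witness[of _ nat int]) (auto simp: p AA_def of_nat_diff nat_diff_distrib)
  also have "\<dots> = (\<Sum>n\<in>{1..N}. T.L (- n) (AA (p - n)))"
    by (rule sum.mono_neutral_left) (use N p in \<open>auto simp: AA_neg\<close>)
  finally have 2: "(\<Sum>n\<in>{1..q}. T.L (- int n) (fst (AB (q - n)))) = (\<Sum>n\<in>{1..N}. T.L (- n) (AA (p - n)))" .
  have "(\<Sum>i\<in>{0..<q}. T.G (-1 - int i) (snd (AB (q - 1 - i)))) = (\<Sum>i\<in>{0..int q - 1}. T.G (-1 - i) (BB (p - 1 - i)))"
    by (rule sum.reindex_bij_witness[of _ nat int]) (auto simp: p BB_def of_nat_diff nat_diff_distrib)
  also have "\<dots> = (\<Sum>i\<in>{0..N}. T.G (-1 - i) (BB (p - 1 - i)))"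
    by (rule sum.mono_neutral_left) (use N p in \<open>auto simp: BB_neg\<close>)
  finally show ?thesis using 1 2 ca_neq_0[of p] False by simp
qed

lemma AABB_in_S: "AA k \<in> S" "BB k \<in> S"
proof -
  have "fst (AB p) \<in> S \<and> snd (AB p) \<in> S" for p
  proof (induct p rule: less_induct)
    case (less p)
    have 1: "(\<Sum>n\<in>{1..p}. T.L (- int n) (fst (AB (p - n)))) \<in> S"
      "(\<Sum>i\<in>{0..<p}. T.G (-1 - int i) (snd (AB (p - 1 - i)))) \<in> S"
      "(\<Sum>i\<in>{1..p}. T.G (-1 - int i) (fst (AB (p - i)))) \<in> S"
      using less by (auto intro!: T.subspace_sum[OF T.S_subspace] T.J_closed)
    have 2: "fst (AB p) \<in> S"
      unfolding fst_AB[of p] using 1 u0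
      by (auto intro!: T.subspace_scale[OF T.S_subspace] T.subspace_diff[OF T.S_subspace])
    then have "snd (AB p) \<in> S"
      unfolding snd_AB[of p] using 1
      by (auto intro!: T.subspace_scale[OF T.S_subspace] T.subspace_add[OF T.S_subspace] T.J_closed)
    with 2 show ?case by simp
  qed
  then show "AA k \<in> S" "BB k \<in> S"
    using T.subspace_0[OF T.S_subspace] by (auto simp: AA_def BB_def)
qed

lemma L0_levels: "T.L 0 (AA p) = sc (hT + of_int p) (AA p)" "T.L 0 (BB p) = sc (hT + of_int p + 1 / 2) (BB p)"
proof -
  have "T.L 0 (AA (int p)) = sc (hT + of_nat p) (AA (int p)) \<and> T.L 0 (BB (int p)) = sc (hT + of_nat p + 1 / 2) (BB (int p))" for p
  proof (induct p rule: less_induct)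
    case (less p)
    have A: "T.L 0 (AA q) = sc (hT + of_int q) (AA q)" and B: "T.L 0 (BB q) = sc (hT + of_int q + 1 / 2) (BB q)" if "q < int p" for q
      using less[of "nat q"] that by (cases "q < 0"; simp add: AA_neg BB_neg)+
    have 1: "T.L 0 (T.L (- n) (AA (int p - n))) = sc (hT + of_nat p) (T.L (- n) (AA (int p - n)))" if "n \<ge> 1" for n
      using T.LL[OF AABB_in_S(1)[of "int p - n"], of 0 "- n"] A[of "int p - n"] that
      by (simp add: T.J_scale flip: T.scale_left_distrib)
    have 2: "T.L 0 (T.G (-1 - i) (BB (int p - 1 - i))) = sc (hT + of_nat p) (T.G (-1 - i) (BB (int p - 1 - i)))" if "i \<ge> 0" for i
      using T.LG[OF AABB_in_S(2)[of "int p - 1 - i"], of 0 "-1 - i"] B[of "int p - 1 - i"] that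
      by (simp add: T.J_scale flip: T.scale_left_distrib)
    have LA: "T.L 0 (AA (int p)) = sc (hT + of_nat p) (AA (int p))"
    proof (cases "p = 0")
      case True
      then show ?thesis using u0 by (simp add: AA_0)
    next
      case False
      have "sc (ca p) (T.L 0 (AA (int p))) = T.L 0 (sc (ca p) (AA (int p)))" by (simp add: T.J_scale)
      also have "\<dots> = sc (hT + of_nat p) (sc (ca p) (AA (int p)))"
        unfolding rec_A[of "int p" "int p", simplified] T.J_diff T.J_scale T.J_sum T.scale_right_diff_distrib T.scale_sum_right
        using 1 2 by (intro arg_cong2[where f = minus] sum.cong refl) (simp_all add: mult.commute)
      finally have "sc (ca p) (T.L 0 (AA (int p))) = sc (ca p) (sc (hT + of_nat p) (AA (int p)))" by (simp add: mult.commute)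
      then show ?thesis unfolding T.scale_cancel_left using ca_neq_0[of "int p"] False by simp
    qed
    have A': "T.L 0 (AA q) = sc (hT + of_int q) (AA q)" if "q \<le> int p" for q
      using A[of q] LA that by (cases "q = int p") auto
    have 3: "T.L 0 (T.G (-1 - i) (AA (int p - i))) = sc (hT + of_nat p + 1 / 2) (T.G (-1 - i) (AA (int p - i)))" if "i \<ge> 0" for i
      using T.LG[OF AABB_in_S(1)[of "int p - i"], of 0 "-1 - i"] A'[of "int p - i"] that
      by (simp add: T.J_scale flip: T.scale_left_distrib) 
    have "sc (cb p) (T.L 0 (BB (int p))) = T.L 0 (sc (cb p) (BB (int p)))" by (simp add: T.J_scale)
    also have "\<dots> = sc (hT + of_nat p + 1 / 2) (sc (cb p) (BB (int p)))"
      unfolding rec_B[of "int p" "int p", simplified] T.J_scale T.J_sum T.scale_sum_right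
      using 3 by (intro sum.cong refl) (simp_all add: mult.commute)
    finally have "sc (cb p) (T.L 0 (BB (int p))) = sc (cb p) (sc (hT + of_nat p + 1 / 2) (BB (int p)))" by (simp add: mult.commute)
    then show ?case unfolding T.scale_cancel_left using cb_neq_0[of "int p"] LA by simp
  qed
  from this[of "nat p"] show "T.L 0 (AA p) = sc (hT + of_int p) (AA p)" "T.L 0 (BB p) = sc (hT + of_int p + 1 / 2) (BB p)"
    by (cases "p < 0"; simp add: AA_neg BB_neg)+
qed

lemma sum_shift:
  fixes F :: "int \<Rightarrow> 'v"
  assumes "N \<ge> 0" "F (N + 1) = 0"
  shows "(\<Sum>n\<in>{1..N}. F n) = (\<Sum>i\<in>{0..N}. F (i + 1))"
proof -
  have "(\<Sum>i\<in>{0..N}. F (i + 1)) = (\<Sum>n\<in>{1..N + 1}. F n)"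
    by (rule sum.reindex_bij_witness[of _ "\<lambda>n. n - 1" "\<lambda>i. i + 1"]) auto
  also have "{1..N + 1} = insert (N + 1) {1..N}" using assms by auto
  finally show ?thesis using assms by simp
qed

lemma sum_split0:
  fixes F :: "int \<Rightarrow> 'v"
  assumes "N \<ge> 0"
  shows "(\<Sum>i\<in>{0..N}. F i) = F 0 + (\<Sum>i\<in>{1..N}. F i)"
proof -
  have "{0..N} = insert 0 {1..N}" using assms by auto
  then show ?thesis by simp
qed

text \<open>The recursion makes (AA, BB) a highest weight vector: $G_{1/2}$ and $G_{3/2}$ are moved through it.\<close>

lemma G0_AA:
  assumes A: "\<And>q. q < p \<Longrightarrow> T.G 0 (AA q) = BB (q - 1)"
    and B: "\<And>q. q < p \<Longrightarrow> T.G 0 (BB q) = sc (kap + of_int q + 2 * hh) (AA q)"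
  shows "T.G 0 (AA p) = BB (p - 1)"
proof (cases "p \<le> 0")
  case True
  then show ?thesis using u0(2)[of 1] by (cases "p = 0") (simp_all add: AA_0 AA_neg BB_neg)
next
  case False
  define N where "N = p + 1"
  have N: "N \<ge> p" "N \<ge> 0" "N \<ge> p - 1" using False by (simp_all add: N_def)
  note cmp = AABB_in_S
  have t1: "T.G 0 (T.L (- n) (AA (p - n))) = T.L (- n) (BB (p - 1 - n)) + sc ((of_int n + 1) / 2) (T.G (- n) (AA (p - n)))"
    if "n \<ge> 1" for n
  proof -
    have i: "p - n - 1 = p - 1 - n" by simp
    have "T.G 0 (AA (p - n)) = BB (p - 1 - n)" using A[of "p - n"] that unfolding i by simp
    moreover have "of_int 0 + 1 / 2 - of_int (- n) / 2 = ((of_int n + 1) / 2 :: complex)" by (simp add: add_divide_distrib)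
    ultimately show ?thesis
      using T.GL[OF cmp(1)[of "p - n"], of 0 "- n"] by (simp only: add_0_left)
  qed
  have t2: "T.G 0 (T.G (-1 - i) (BB (p - 1 - i))) = - sc (kap + of_int (p - 1 - i) + 2 * hh) (T.G (-1 - i) (AA (p - 1 - i)))
      + sc 2 (T.L (- i) (BB (p - 1 - i)))" if "i \<ge> 0" for i
    using T.GG[OF cmp(2)[of "p - 1 - i"], of 0 "-1 - i"] B[of "p - 1 - i"] that by (simp add: T.J_scale)
  have s1: "(\<Sum>n\<in>{1..N}. sc ((of_int n + 1) / 2) (T.G (- n) (AA (p - n))))
      = (\<Sum>i\<in>{0..N}. sc ((of_int i + 2) / 2) (T.G (-1 - i) (AA (p - 1 - i))))"
    by (subst sum_shift) (use N in \<open>auto simp: AA_neg N_def algebra_simps\<close>)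
  have e: "sc (ca p) (T.G 0 (AA p)) = sc (2 * tau) (\<Sum>n\<in>{1..N}. T.G 0 (T.L (- n) (AA (p - n))))
     - sc tau (\<Sum>i\<in>{0..N}. T.G 0 (T.G (-1 - i) (BB (p - 1 - i))))"
    unfolding T.J_scale[symmetric] rec_A[OF N(1,2)] T.J_diff T.J_sum T.J_scale ..
  have e1: "(\<Sum>n\<in>{1..N}. T.G 0 (T.L (- n) (AA (p - n)))) = (\<Sum>n\<in>{1..N}. T.L (- n) (BB (p - 1 - n)))
       + (\<Sum>i\<in>{0..N}. sc ((of_int i + 2) / 2) (T.G (-1 - i) (AA (p - 1 - i))))"
    unfolding s1[symmetric] sum.distrib[symmetric] by (rule sum.cong) (use t1 in auto)
  have e2: "(\<Sum>i\<in>{0..N}. T.G 0 (T.G (-1 - i) (BB (p - 1 - i)))) =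
       - (\<Sum>i\<in>{0..N}. sc (kap + of_int (p - 1 - i) + 2 * hh) (T.G (-1 - i) (AA (p - 1 - i))))
       + sc 2 (T.L 0 (BB (p - 1)) + (\<Sum>i\<in>{1..N}. T.L (- i) (BB (p - 1 - i))))"
  proof -
    have "T.L 0 (BB (p - 1)) + (\<Sum>i\<in>{1..N}. T.L (- i) (BB (p - 1 - i))) = (\<Sum>i\<in>{0..N}. T.L (- i) (BB (p - 1 - i)))"
      using sum_split0[OF N(2), of "\<lambda>i. T.L (- i) (BB (p - 1 - i))"] by simp
    then show ?thesis
      unfolding T.scale_sum_right sum_negf[symmetric]
      by (simp only: T.scale_sum_right sum.distrib[symmetric]) (rule sum.cong, use t2 in auto)
  qed
  \<comment> \<open>The summation index cancels in the scalars, so the two sums combine to a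
    multiple of the sum in \<open>rec_B\<close>.\<close>
  have s2: "(\<Sum>i\<in>{0..N}. sc (kap + of_int (p - 1 - i) + 2 * hh) (T.G (-1 - i) (AA (p - 1 - i))))
     + sc 2 (\<Sum>i\<in>{0..N}. sc ((of_int i + 2) / 2) (T.G (-1 - i) (AA (p - 1 - i))))
    = sc (kap + of_int p + 1 + 2 * hh) (\<Sum>i\<in>{0..N}. T.G (-1 - i) (AA (p - 1 - i)))"
  proof -
    have cf: "kap + of_int (p - 1 - i) + 2 * hh + 2 * ((of_int i + 2) / 2) = kap + of_int p + 1 + 2 * hh" for i
      by (simp add: field_simps)
    show ?thesis
      by (simp only: T.scale_sum_right sum.distrib[symmetric] T.scale_scale T.scale_left_distrib[symmetric] cf)
  qed
  have r: "sc tau (\<Sum>i\<in>{0..N}. T.G (-1 - i) (AA (p - 1 - i))) = sc (cb (p - 1)) (BB (p - 1))"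
    using rec_B[OF N(3,2)] by simp
  have "sc (ca p) (T.G 0 (AA p)) = sc (ca p) (BB (p - 1))"
  proof (rule functional_eqI[OF T.vector_space_axioms])
    fix f :: "'v \<Rightarrow> complex" assume "Vector_Spaces.linear sc (*) f"
    then interpret f: Vector_Spaces.linear sc "(*)" f .
    obtain X where X: "f (\<Sum>n\<in>{1..N}. T.L (- n) (BB (p - 1 - n))) = X" by blast
    obtain Y where Y: "f (\<Sum>i\<in>{0..N}. sc ((of_int i + 2) / 2) (T.G (-1 - i) (AA (p - 1 - i)))) = Y" by blast
    obtain W where W: "f (\<Sum>i\<in>{0..N}. sc (kap + of_int (p - 1 - i) + 2 * hh) (T.G (-1 - i) (AA (p - 1 - i)))) = W" by blast
    obtain V where V: "f (\<Sum>i\<in>{0..N}. T.G (-1 - i) (AA (p - 1 - i))) = V" by blast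
    obtain b where b: "f (BB (p - 1)) = b" by blast
    have 1: "W + 2 * Y = (kap + of_int p + 1 + 2 * hh) * V" using arg_cong[OF s2, of f] by (simp only: f.add f.scale W Y V)
    have 2: "tau * V = cb (p - 1) * b" using arg_cong[OF r, of f] by (simp only: f.scale V b)
    have 3: "2 * hh = 2 * tau - 1" using hh by simp
    have 4: "2 * (hT + of_int (p - 1) + 1 / 2) = 2 * (kap + hh + wS) + 2 * (of_int p - 1) + 1" using kap by simp
    have "f (sc (ca p) (T.G 0 (AA p))) = 2 * tau * (X + Y) - tau * (- W + 2 * ((hT + of_int (p - 1) + 1 / 2) * b + X))"
      unfolding e e1 e2 L0_levels f.add f.diff f.scale f.neg X Y W b ..
    also have "\<dots> = ca p * b"
      using 1 2 3 4 unfolding ca_def cb_def of_int_diff of_int_1 by algebra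
    finally show "f (sc (ca p) (T.G 0 (AA p))) = f (sc (ca p) (BB (p - 1)))" by (simp add: f.scale b)
  qed
  then show ?thesis unfolding T.scale_cancel_left using ca_neq_0[of p] False by simp
qed

lemma G0_BB:
  assumes A: "\<And>q. q \<le> p \<Longrightarrow> T.G 0 (AA q) = BB (q - 1)"
  shows "T.G 0 (BB p) = sc (kap + of_int p + 2 * hh) (AA p)"
proof (cases "p < 0")
  case True
  then show ?thesis by (simp add: AA_neg BB_neg)
next
  case False
  define N where "N = p + 1"
  have N: "N \<ge> p" "N \<ge> 0" using False by (simp_all add: N_def)
  have t: "T.G 0 (T.G (-1 - i) (AA (p - i))) = - T.G (-1 - i) (BB (p - 1 - i)) + sc 2 (T.L (- i) (AA (p - i)))"
    if "i \<ge> 0" for i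
  proof -
    have i: "p - i - 1 = p - 1 - i" by simp
    have "T.G 0 (AA (p - i)) = BB (p - 1 - i)" using A[of "p - i"] that unfolding i by simp
    then show ?thesis using T.GG[OF AABB_in_S(1)[of "p - i"], of 0 "-1 - i"] by simp
  qed
  have e1: "(\<Sum>i\<in>{0..N}. T.G 0 (T.G (-1 - i) (AA (p - i)))) = - (\<Sum>i\<in>{0..N}. T.G (-1 - i) (BB (p - 1 - i)))
      + sc 2 (T.L 0 (AA p) + (\<Sum>n\<in>{1..N}. T.L (- n) (AA (p - n))))"
  proof -
    have "T.L 0 (AA p) + (\<Sum>n\<in>{1..N}. T.L (- n) (AA (p - n))) = (\<Sum>i\<in>{0..N}. T.L (- i) (AA (p - i)))"
      using sum_split0[OF N(2), of "\<lambda>i. T.L (- i) (AA (p - i))"] by simp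
    then show ?thesis
      unfolding T.scale_sum_right sum_negf[symmetric]
      by (simp only: T.scale_sum_right sum.distrib[symmetric]) (rule sum.cong, use t in auto)
  qed
  have e: "sc (cb p) (T.G 0 (BB p)) = sc tau (\<Sum>i\<in>{0..N}. T.G 0 (T.G (-1 - i) (AA (p - i))))"
    unfolding T.J_scale[symmetric] rec_B[OF N] T.J_sum T.J_scale ..
  have "sc (cb p) (T.G 0 (BB p)) = sc (cb p) (sc (kap + of_int p + 2 * hh) (AA p))"
  proof (rule functional_eqI[OF T.vector_space_axioms])
    fix f :: "'v \<Rightarrow> complex" assume "Vector_Spaces.linear sc (*) f"
    then interpret f: Vector_Spaces.linear sc "(*)" f .
    obtain X where X: "f (\<Sum>n\<in>{1..N}. T.L (- n) (AA (p - n))) = X" by blast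
    obtain Y where Y: "f (\<Sum>i\<in>{0..N}. T.G (-1 - i) (BB (p - 1 - i))) = Y" by blast
    obtain a where a: "f (AA p) = a" by blast
    have 1: "ca p * a = 2 * tau * X - tau * Y"
      using arg_cong[OF rec_A[OF N], of f] by (simp only: f.diff f.scale X Y a)
    have 2: "2 * hh = 2 * tau - 1" using hh by simp
    have "f (sc (cb p) (T.G 0 (BB p))) = tau * (- Y + 2 * ((hT + of_int p) * a + X))"
      unfolding e e1 L0_levels f.add f.diff f.scale f.neg X Y a ..
    also have "\<dots> = cb p * ((kap + of_int p + 2 * hh) * a)"
      using 1 2 kap unfolding ca_def cb_def by algebra
    finally show "f (sc (cb p) (T.G 0 (BB p))) = f (sc (cb p) (sc (kap + of_int p + 2 * hh) (AA p)))" by (simp only: f.scale a)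
  qed
  then show ?thesis unfolding T.scale_cancel_left using cb_neq_0[of p] False by simp
qed

lemma G0: "T.G 0 (AA p) = BB (p - 1) \<and> T.G 0 (BB p) = sc (kap + of_int p + 2 * hh) (AA p)"
proof -
  have "T.G 0 (AA (int p)) = BB (int p - 1) \<and> T.G 0 (BB (int p)) = sc (kap + of_int (int p) + 2 * hh) (AA (int p))" for p
  proof (induct p rule: less_induct)
    case (less p)
    have IH: "T.G 0 (AA q) = BB (q - 1) \<and> T.G 0 (BB q) = sc (kap + of_int q + 2 * hh) (AA q)" if "q < int p" for q
      using less[of "nat q"] that by (cases "q < 0") (simp_all add: AA_neg BB_neg)
    have A: "T.G 0 (AA (int p)) = BB (int p - 1)" by (rule G0_AA) (use IH in auto)
    have "T.G 0 (AA q) = BB (q - 1)" if "q \<le> int p" for q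
      using IH[of q] A that by (cases "q = int p") auto
    with A show ?case using G0_BB by blast
  qed
  from this[of "nat p"] show ?thesis by (cases "p < 0") (simp_all add: AA_neg BB_neg)
qed

lemma L1: "T.L 1 (BB q) = sc (kap + of_int q + 2 * hh) (BB (q - 1))" "T.L 1 (AA q) = sc (kap + of_int (q - 1) + 2 * hh) (AA (q - 1))"
proof -
  have "T.L 1 v = T.G 0 (T.G 0 v)" if "v \<in> S" for v
  proof -
    have "T.G 0 (T.G 0 v) + T.G 0 (T.G 0 v) = sc 2 (T.L 1 v)"
      using arg_cong[OF T.GG[OF that, of 0 0], of "\<lambda>u. T.G 0 (T.G 0 v) + u"] by simp
    then have "sc 2 (T.G 0 (T.G 0 v)) = sc 2 (T.L 1 v)"
      by (metis T.scale_left_distrib T.scale_one one_add_one)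
    then show ?thesis by simp
  qed
  then show "T.L 1 (BB q) = sc (kap + of_int q + 2 * hh) (BB (q - 1))" "T.L 1 (AA q) = sc (kap + of_int (q - 1) + 2 * hh) (AA (q - 1))"
    using G0 AABB_in_S by (simp_all only: T.J_scale)
qed

lemma tau_c: "tau * c = 3 * (2 * hh - tau * hh)"
proof -
  have c3: "3 * (c / 3) = c" by simp
  show ?thesis using null c3 by algebra
qed

text \<open>Here the central charge enters, through G_{3/2} and G_{-3/2} at i = 1, and
  \<open>tau_c\<close> makes the terms cancel. L_1 is the square of G_{1/2} and hence known from
  \<open>G0\<close>.\<close>

lemma G1_AA:
  assumes A: "\<And>q. q < p \<Longrightarrow> T.G 1 (AA q) = BB (q - 2)"
    and B: "\<And>q. q < p \<Longrightarrow> T.G 1 (BB q) = sc (kap + of_int (q - 1) + 4 * hh) (AA (q - 1))"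
  shows "T.G 1 (AA p) = BB (p - 2)"
proof (cases "p \<le> 0")
  case True
  then show ?thesis using u0(2)[of 3] by (cases "p = 0") (simp_all add: AA_0 AA_neg BB_neg)
next
  case False
  define N where "N = p + 1"
  have N: "N \<ge> p" "N \<ge> 0" "N \<ge> p - 2" "N \<ge> 1" using False by (simp_all add: N_def)
  have t1: "T.G 1 (T.L (- n) (AA (p - n))) = T.L (- n) (BB (p - 2 - n)) + sc ((of_int n + 3) / 2) (T.G (1 - n) (AA (p - n)))"
    if "n \<ge> 1" for n
  proof -
    have i: "p - n - 2 = p - 2 - n" "1 + (- n) = 1 - n" by simp_all
    have "T.G 1 (AA (p - n)) = BB (p - 2 - n)" using A[of "p - n"] that unfolding i by simp
    moreover have "of_int 1 + 1 / 2 - of_int (- n) / 2 = ((of_int n + 3) / 2 :: complex)" by (simp add: add_divide_distrib)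
    ultimately show ?thesis
      using T.GL[OF AABB_in_S(1)[of "p - n"], of 1 "- n"] by (simp only: i)
  qed
  have t2: "T.G 1 (T.G (-1 - i) (BB (p - 1 - i))) = - sc (kap + of_int (p - 2 - i) + 4 * hh) (T.G (-1 - i) (AA (p - 2 - i)))
      + sc 2 (T.L (1 - i) (BB (p - 1 - i))) + (if i = 1 then sc (c / 3 * 2) (BB (p - 2)) else 0)" if "i \<ge> 0" for i
  proof -
    have i: "p - 1 - i - 1 = p - 2 - i" "1 + (-1 - i) + 1 = 1 - i" by simp_all
    have "T.G 1 (BB (p - 1 - i)) = sc (kap + of_int (p - 2 - i) + 4 * hh) (AA (p - 2 - i))"
      using B[of "p - 1 - i"] that unfolding i by simp
    moreover have "sc (if 1 - i = 0 then c / 3 * of_int (1 * (1 + 1)) else 0) (BB (p - 1 - i))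
       = (if i = 1 then sc (c / 3 * 2) (BB (p - 2)) else 0)" by simp
    ultimately show ?thesis
      using T.GG[OF AABB_in_S(2)[of "p - 1 - i"], of 1 "-1 - i"] by (simp only: i T.J_scale)
  qed
  have s1: "(\<Sum>n\<in>{1..N}. sc ((of_int n + 3) / 2) (T.G (1 - n) (AA (p - n))))
      = sc 2 (BB (p - 2)) + (\<Sum>i\<in>{0..N}. sc ((of_int i + 5) / 2) (T.G (-1 - i) (AA (p - 2 - i))))"
  proof -
    let ?F = "\<lambda>n. sc ((of_int n + 3) / 2) (T.G (1 - n) (AA (p - n)))"
    have "(\<Sum>n\<in>{1..N}. ?F n) = (\<Sum>i\<in>{0..N}. ?F (i + 1))"
      by (rule sum_shift) (use N in \<open>auto simp: AA_neg N_def\<close>)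
    also have "\<dots> = ?F (0 + 1) + (\<Sum>i\<in>{1..N}. ?F (i + 1))"
      by (rule sum_split0) (use N in auto)
    also have "(\<Sum>i\<in>{1..N}. ?F (i + 1)) = (\<Sum>i\<in>{0..N}. ?F (i + 1 + 1))"
      by (rule sum_shift) (use N in \<open>auto simp: AA_neg N_def\<close>)
    also have "\<dots> = (\<Sum>i\<in>{0..N}. sc ((of_int i + 5) / 2) (T.G (-1 - i) (AA (p - 2 - i))))"
    proof (rule sum.cong[OF refl])
      fix i
      have "1 - (i + 1 + 1) = -1 - i" "p - (i + 1 + 1) = p - 2 - i" "of_int (i + 1 + 1) + 3 = (of_int i + 5 :: complex)" by simp_all
      then show "?F (i + 1 + 1) = sc ((of_int i + 5) / 2) (T.G (-1 - i) (AA (p - 2 - i)))" by (simp only:)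
    qed
    also have "?F (0 + 1) = sc 2 (BB (p - 2))" using G0[of "p - 1"] by simp
    finally show ?thesis .
  qed
  have e: "sc (ca p) (T.G 1 (AA p)) = sc (2 * tau) (\<Sum>n\<in>{1..N}. T.G 1 (T.L (- n) (AA (p - n))))
     - sc tau (\<Sum>i\<in>{0..N}. T.G 1 (T.G (-1 - i) (BB (p - 1 - i))))"
    unfolding T.J_scale[symmetric] rec_A[OF N(1,2)] T.J_diff T.J_sum T.J_scale ..
  have e1: "(\<Sum>n\<in>{1..N}. T.G 1 (T.L (- n) (AA (p - n)))) = (\<Sum>n\<in>{1..N}. T.L (- n) (BB (p - 2 - n)))
       + (sc 2 (BB (p - 2)) + (\<Sum>i\<in>{0..N}. sc ((of_int i + 5) / 2) (T.G (-1 - i) (AA (p - 2 - i)))))"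
    unfolding s1[symmetric] sum.distrib[symmetric] by (rule sum.cong) (use t1 in auto)
  have l: "(\<Sum>i\<in>{0..N}. T.L (1 - i) (BB (p - 1 - i))) = T.L 1 (BB (p - 1)) + (T.L 0 (BB (p - 2)) + (\<Sum>n\<in>{1..N}. T.L (- n) (BB (p - 2 - n))))"
  proof -
    let ?F = "\<lambda>i. T.L (1 - i) (BB (p - 1 - i))"
    have "(\<Sum>i\<in>{0..N}. ?F i) = ?F 0 + (\<Sum>i\<in>{1..N}. ?F i)" by (rule sum_split0) (use N in auto)
    also have "(\<Sum>i\<in>{1..N}. ?F i) = (\<Sum>i\<in>{0..N}. ?F (i + 1))"
      by (rule sum_shift) (use N in \<open>auto simp: BB_neg N_def\<close>)
    also have "\<dots> = (\<Sum>i\<in>{0..N}. T.L (- i) (BB (p - 2 - i)))"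
    proof (rule sum.cong[OF refl])
      fix i
      have "1 - (i + 1) = - i" "p - 1 - (i + 1) = p - 2 - i" by simp_all
      then show "?F (i + 1) = T.L (- i) (BB (p - 2 - i))" by (simp only:)
    qed
    also have "\<dots> = T.L 0 (BB (p - 2)) + (\<Sum>n\<in>{1..N}. T.L (- n) (BB (p - 2 - n)))"
      using sum_split0[OF N(2), of "\<lambda>i. T.L (- i) (BB (p - 2 - i))"] by simp
    finally show ?thesis by simp
  qed
  have e2: "(\<Sum>i\<in>{0..N}. T.G 1 (T.G (-1 - i) (BB (p - 1 - i)))) =
       - (\<Sum>i\<in>{0..N}. sc (kap + of_int (p - 2 - i) + 4 * hh) (T.G (-1 - i) (AA (p - 2 - i))))
       + sc 2 (T.L 1 (BB (p - 1)) + (T.L 0 (BB (p - 2)) + (\<Sum>n\<in>{1..N}. T.L (- n) (BB (p - 2 - n)))))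
       + sc (c / 3 * 2) (BB (p - 2))"
  proof -
    have d: "(\<Sum>i\<in>{0..N}. if i = 1 then sc (c / 3 * 2) (BB (p - 2)) else 0) = sc (c / 3 * 2) (BB (p - 2))"
      using N by (subst sum.delta) auto
    have "(\<Sum>i\<in>{0..N}. T.G 1 (T.G (-1 - i) (BB (p - 1 - i)))) =
       (\<Sum>i\<in>{0..N}. - sc (kap + of_int (p - 2 - i) + 4 * hh) (T.G (-1 - i) (AA (p - 2 - i)))
      + sc 2 (T.L (1 - i) (BB (p - 1 - i))) + (if i = 1 then sc (c / 3 * 2) (BB (p - 2)) else 0))"
      by (rule sum.cong) (use t2 in auto)
    then show ?thesis
      unfolding sum.distrib sum_negf d T.scale_sum_right[symmetric] l .
  qed
  have s2: "(\<Sum>i\<in>{0..N}. sc (kap + of_int (p - 2 - i) + 4 * hh) (T.G (-1 - i) (AA (p - 2 - i))))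
     + sc 2 (\<Sum>i\<in>{0..N}. sc ((of_int i + 5) / 2) (T.G (-1 - i) (AA (p - 2 - i))))
    = sc (kap + of_int p + 3 + 4 * hh) (\<Sum>i\<in>{0..N}. T.G (-1 - i) (AA (p - 2 - i)))"
  proof -
    have cf: "kap + of_int (p - 2 - i) + 4 * hh + 2 * ((of_int i + 5) / 2) = kap + of_int p + 3 + 4 * hh" for i
      by (simp add: field_simps)
    show ?thesis
      by (simp only: T.scale_sum_right sum.distrib[symmetric] T.scale_scale T.scale_left_distrib[symmetric] cf)
  qed
  have r: "sc tau (\<Sum>i\<in>{0..N}. T.G (-1 - i) (AA (p - 2 - i))) = sc (cb (p - 2)) (BB (p - 2))"
    using rec_B[OF N(3,2)] by simp
  have l1: "T.L 1 (BB (p - 1)) = sc (kap + of_int (p - 1) + 2 * hh) (BB (p - 2))"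
    using L1(1)[of "p - 1"] by simp
  have "sc (ca p) (T.G 1 (AA p)) = sc (ca p) (BB (p - 2))"
  proof (rule functional_eqI[OF T.vector_space_axioms])
    fix f :: "'v \<Rightarrow> complex" assume "Vector_Spaces.linear sc (*) f"
    then interpret f: Vector_Spaces.linear sc "(*)" f .
    obtain X where X: "f (\<Sum>n\<in>{1..N}. T.L (- n) (BB (p - 2 - n))) = X" by blast
    obtain Y where Y: "f (\<Sum>i\<in>{0..N}. sc ((of_int i + 5) / 2) (T.G (-1 - i) (AA (p - 2 - i)))) = Y" by blast
    obtain W where W: "f (\<Sum>i\<in>{0..N}. sc (kap + of_int (p - 2 - i) + 4 * hh) (T.G (-1 - i) (AA (p - 2 - i)))) = W" by blast
    obtain V where V: "f (\<Sum>i\<in>{0..N}. T.G (-1 - i) (AA (p - 2 - i))) = V" by blast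
    obtain b where b: "f (BB (p - 2)) = b" by blast
    have 1: "W + 2 * Y = (kap + of_int p + 3 + 4 * hh) * V" using arg_cong[OF s2, of f] by (simp only: f.add f.scale W Y V)
    have 2: "tau * V = cb (p - 2) * b" using arg_cong[OF r, of f] by (simp only: f.scale V b)
    have 3: "2 * hh = 2 * tau - 1" using hh by simp
    have 4: "2 * (hT + of_int (p - 2) + 1 / 2) = 2 * (kap + hh + wS) + 2 * (of_int p - 2) + 1" using kap by simp
    have 5: "3 * (c / 3 * 2) = 2 * c" by simp
    have "f (sc (ca p) (T.G 1 (AA p))) = 2 * tau * (X + (2 * b + Y)) - tau * (- W + 2 * ((kap + of_int (p - 1) + 2 * hh) * b + ((hT + of_int (p - 2) + 1 / 2) * b + X)) + (c / 3 * 2) * b)"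
      unfolding e e1 e2 l1 L0_levels f.add f.diff f.scale f.neg X Y W b ..
    also have "\<dots> = ca p * b"
    proof -
      have "3 * (2 * tau * (X + (2 * b + Y)) - tau * (- W + 2 * ((kap + of_int (p - 1) + 2 * hh) * b + ((hT + of_int (p - 2) + 1 / 2) * b + X)) + (c / 3 * 2) * b)) = 3 * (ca p * b)"
        using 1 2 3 4 5 tau_c unfolding ca_def cb_def of_int_diff of_int_1 of_int_numeral by algebra
      then show ?thesis by (simp only: mult_cancel_left) simp
    qed
    finally show "f (sc (ca p) (T.G 1 (AA p))) = f (sc (ca p) (BB (p - 2)))" by (simp only: f.scale b)
  qed
  then show ?thesis unfolding T.scale_cancel_left using ca_neq_0[of p] False by simp
qed

lemma G1_BB:
  assumes A: "\<And>q. q \<le> p \<Longrightarrow> T.G 1 (AA q) = BB (q - 2)"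
  shows "T.G 1 (BB p) = sc (kap + of_int (p - 1) + 4 * hh) (AA (p - 1))"
proof (cases "p < 0")
  case True
  then show ?thesis by (simp add: AA_neg BB_neg)
next
  case False
  define N where "N = p + 1"
  have N: "N \<ge> p" "N \<ge> 0" "N \<ge> p - 1" "N \<ge> 1" using False by (simp_all add: N_def)
  have t: "T.G 1 (T.G (-1 - i) (AA (p - i))) = - T.G (-1 - i) (BB (p - 1 - 1 - i)) + sc 2 (T.L (1 - i) (AA (p - i)))
      + (if i = 1 then sc (c / 3 * 2) (AA (p - 1)) else 0)"
    if "i \<ge> 0" for i
  proof -
    have i: "p - i - 2 = p - 1 - 1 - i" "1 + (-1 - i) + 1 = 1 - i" by simp_all
    have "T.G 1 (AA (p - i)) = BB (p - 1 - 1 - i)" using A[of "p - i"] that unfolding i by simp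
    moreover have "sc (if 1 - i = 0 then c / 3 * of_int (1 * (1 + 1)) else 0) (AA (p - i))
       = (if i = 1 then sc (c / 3 * 2) (AA (p - 1)) else 0)" by simp
    ultimately show ?thesis using T.GG[OF AABB_in_S(1)[of "p - i"], of 1 "-1 - i"] by (simp only: i)
  qed
  have l: "(\<Sum>i\<in>{0..N}. T.L (1 - i) (AA (p - i))) = T.L 1 (AA p) + (T.L 0 (AA (p - 1)) + (\<Sum>n\<in>{1..N}. T.L (- n) (AA (p - 1 - n))))"
  proof -
    let ?F = "\<lambda>i. T.L (1 - i) (AA (p - i))"
    have "(\<Sum>i\<in>{0..N}. ?F i) = ?F 0 + (\<Sum>i\<in>{1..N}. ?F i)" by (rule sum_split0) (use N in auto)
    also have "(\<Sum>i\<in>{1..N}. ?F i) = (\<Sum>i\<in>{0..N}. ?F (i + 1))"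
      by (rule sum_shift) (use N in \<open>auto simp: AA_neg N_def\<close>)
    also have "\<dots> = (\<Sum>i\<in>{0..N}. T.L (- i) (AA (p - 1 - i)))"
    proof (rule sum.cong[OF refl])
      fix i
      have "1 - (i + 1) = - i" "p - (i + 1) = p - 1 - i" by simp_all
      then show "?F (i + 1) = T.L (- i) (AA (p - 1 - i))" by (simp only:)
    qed
    also have "\<dots> = T.L 0 (AA (p - 1)) + (\<Sum>n\<in>{1..N}. T.L (- n) (AA (p - 1 - n)))"
      using sum_split0[OF N(2), of "\<lambda>i. T.L (- i) (AA (p - 1 - i))"] by simp
    finally show ?thesis by simp
  qed
  have e1: "(\<Sum>i\<in>{0..N}. T.G 1 (T.G (-1 - i) (AA (p - i)))) = - (\<Sum>i\<in>{0..N}. T.G (-1 - i) (BB (p - 1 - 1 - i)))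
      + sc 2 (T.L 1 (AA p) + (T.L 0 (AA (p - 1)) + (\<Sum>n\<in>{1..N}. T.L (- n) (AA (p - 1 - n))))) + sc (c / 3 * 2) (AA (p - 1))"
  proof -
    have d: "(\<Sum>i\<in>{0..N}. if i = 1 then sc (c / 3 * 2) (AA (p - 1)) else 0) = sc (c / 3 * 2) (AA (p - 1))"
      using N by (subst sum.delta) auto
    have "(\<Sum>i\<in>{0..N}. T.G 1 (T.G (-1 - i) (AA (p - i)))) =
       (\<Sum>i\<in>{0..N}. - T.G (-1 - i) (BB (p - 1 - 1 - i)) + sc 2 (T.L (1 - i) (AA (p - i)))
      + (if i = 1 then sc (c / 3 * 2) (AA (p - 1)) else 0))"
      by (rule sum.cong) (use t in auto)
    then show ?thesis
      unfolding sum.distrib sum_negf d T.scale_sum_right[symmetric] l .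
  qed
  have e: "sc (cb p) (T.G 1 (BB p)) = sc tau (\<Sum>i\<in>{0..N}. T.G 1 (T.G (-1 - i) (AA (p - i))))"
    unfolding T.J_scale[symmetric] rec_B[OF N(1,2)] T.J_sum T.J_scale ..
  have "sc (cb p) (T.G 1 (BB p)) = sc (cb p) (sc (kap + of_int (p - 1) + 4 * hh) (AA (p - 1)))"
  proof (rule functional_eqI[OF T.vector_space_axioms])
    fix f :: "'v \<Rightarrow> complex" assume "Vector_Spaces.linear sc (*) f"
    then interpret f: Vector_Spaces.linear sc "(*)" f .
    obtain X where X: "f (\<Sum>n\<in>{1..N}. T.L (- n) (AA (p - 1 - n))) = X" by blast
    obtain Y where Y: "f (\<Sum>i\<in>{0..N}. T.G (-1 - i) (BB (p - 1 - 1 - i))) = Y" by blast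
    obtain a where a: "f (AA (p - 1)) = a" by blast
    have 1: "ca (p - 1) * a = 2 * tau * X - tau * Y"
      using arg_cong[OF rec_A[OF N(3,2)], of f] by (simp only: f.diff f.scale X Y a)
    have 2: "2 * hh = 2 * tau - 1" using hh by simp
    have 5: "3 * (c / 3 * 2) = 2 * c" by simp
    have "f (sc (cb p) (T.G 1 (BB p))) = tau * (- Y + 2 * ((kap + of_int (p - 1) + 2 * hh) * a + ((hT + of_int (p - 1)) * a + X)) + (c / 3 * 2) * a)"
      unfolding e e1 L0_levels L1 f.add f.diff f.scale f.neg X Y a ..
    also have "\<dots> = cb p * ((kap + of_int (p - 1) + 4 * hh) * a)"
    proof -
      have "3 * (tau * (- Y + 2 * ((kap + of_int (p - 1) + 2 * hh) * a + ((hT + of_int (p - 1)) * a + X)) + (c / 3 * 2) * a))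
         = 3 * (cb p * ((kap + of_int (p - 1) + 4 * hh) * a))"
        using 1 2 5 kap tau_c unfolding ca_def cb_def of_int_diff of_int_1 by algebra
      then show ?thesis by (simp only: mult_cancel_left) simp
    qed
    finally show "f (sc (cb p) (T.G 1 (BB p))) = f (sc (cb p) (sc (kap + of_int (p - 1) + 4 * hh) (AA (p - 1))))" by (simp only: f.scale a)
  qed
  then show ?thesis unfolding T.scale_cancel_left using cb_neq_0[of p] False by simp
qed

lemma G1: "T.G 1 (AA p) = BB (p - 2) \<and> T.G 1 (BB p) = sc (kap + of_int (p - 1) + 4 * hh) (AA (p - 1))"
proof -
  have "T.G 1 (AA (int p)) = BB (int p - 2) \<and> T.G 1 (BB (int p)) = sc (kap + of_int (int p - 1) + 4 * hh) (AA (int p - 1))" for p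
  proof (induct p rule: less_induct)
    case (less p)
    have IH: "T.G 1 (AA q) = BB (q - 2) \<and> T.G 1 (BB q) = sc (kap + of_int (q - 1) + 4 * hh) (AA (q - 1))" if "q < int p" for q
      using less[of "nat q"] that by (cases "q < 0") (simp_all add: AA_neg BB_neg)
    have A: "T.G 1 (AA (int p)) = BB (int p - 2)" by (rule G1_AA) (use IH in auto)
    have "T.G 1 (AA q) = BB (q - 2)" if "q \<le> int p" for q
      using IH[of q] A that by (cases "q = int p") auto
    with A show ?case using G1_BB by blast
  qed
  from this[of "nat p"] show ?thesis by (cases "p < 0") (simp_all add: AA_neg BB_neg)
qed

definition XX :: "(int \<Rightarrow> 'v) \<times> (int \<Rightarrow> 'v)" where "XX = (AA, BB)"

lemma XX_in_S2: "XX \<in> S2"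
  by (simp add: XX_def S2_def AABB_in_S)

lemma XX_positive: "a > 0 \<Longrightarrow> TJ a XX = 0"
proof (rule D.positive_modes_vanish[OF XX_in_S2])
  have "TG 0 XX = 0" using G0 by (auto simp: TG_def XX_def fun_eq_iff zero_prod_def)
  then show "TJ 1 XX = 0" using TJ_odd[of 0] by simp
  have "k - 1 - 1 = k - 2" for k :: int by simp
  then have "TG 1 XX = 0" using G1 by (auto simp: TG_def XX_def fun_eq_iff zero_prod_def)
  then show "TJ 3 XX = 0" using TJ_odd[of 1] by simp
qed

lemma XX_weight: "TJ 0 XX = sc2 wS XX"
proof -
  have e: "hT + of_int k - (kap + of_int k + hh) = wS" "hT + of_int k + 1 / 2 - (kap + of_int k + hh + 1 / 2) = wS" for k
    using kap by simp_all
  have l: "T.L 0 (AA k) - sc (kap + of_int k + hh) (AA k) = sc wS (AA k)"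
    "T.L 0 (BB k) - sc (kap + of_int k + hh + 1 / 2) (BB k) = sc wS (BB k)" for k
    unfolding L0_levels T.scale_left_diff_distrib[symmetric] e by (rule refl)+
  have "fst (TL 0 XX) k = fst (sc2 wS XX) k \<and> snd (TL 0 XX) k = snd (sc2 wS XX) k" for k
    using l[of k] by (simp add: TL_def XX_def sc2_def add.assoc)
  then have "TL 0 XX = sc2 wS XX" by (simp add: prod_eq_iff fun_eq_iff)
  then show ?thesis using TJ_even[of 0] by simp
qed

lemma XX_smooth: "smooth XX 0"
  using XX_positive[of "2 * _"] XX_positive[of "2 * _ + 1"] by (simp add: smooth_def)

text \<open>For R = 0 the null equations are the recursion itself, read backwards through
  \<open>hw_recursion\<close>, and larger windows change nothing.\<close>

lemma XX_kill: "XX \<in> kill"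
proof (rule killI[OF XX_in_S2 order_refl XX_smooth])
  show "lbd XX 0" by (simp add: lbd_def XX_def AA_neg BB_neg)
  fix R M m :: int assume R: "R \<ge> 0" "M \<ge> 0" "M \<ge> m + 2 - 0"
  have g: "TG 0 XX = 0" "TL 0 XX = sc2 wS XX"
    using XX_positive[of 1] XX_weight TJ_odd[of 0] TJ_even[of 0] by simp_all
  have R': "R = 0 + int (nat R)" using R by simp
  have "NN M 0 XX m = 0"
    using hw_recursion(1)[OF XX_smooth g R(2), of m] rec_B[of "m + 1" "M - 1"] R
    by (cases "M = 0") (simp_all add: XX_def cb_def BB_neg)
  moreover have "NP M 0 XX m = 0"
  proof -
    have "(\<Sum>n\<in>{1..M}. T.L (- n) (AA (m - n))) = (\<Sum>n\<in>{1..M - 1}. T.L (- n) (AA (m - n)))"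
      by (rule sum.mono_neutral_right) (use R in \<open>auto simp: AA_neg\<close>)
    then show ?thesis
      using hw_recursion(2)[OF XX_smooth g R(2), of m] rec_A[of m "M - 1"] R
      by (cases "M = 0") (simp_all add: XX_def ca_def AA_neg)
  qed
  ultimately show "NN M R XX m = 0 \<and> NP M R XX m = 0"
    using NN_shift[OF XX_smooth, of M "nat R"] NP_shift[OF XX_smooth, of M "nat R"] R by simp
qed

end

section \<open>Transfer of singular vectors from label sig to label sig + 2 tau\<close>

definition kac_weight :: "complex \<Rightarrow> complex \<Rightarrow> complex" where
  "kac_weight tau sig = (sig\<^sup>2 - (1 - tau)\<^sup>2) / (8 * tau)"

definition verma_singular :: "complex \<Rightarrow> complex \<Rightarrow> complex \<Rightarrow> bool" where
  "verma_singular c h l \<longleftrightarrow> (\<exists>v. pbw.singular c h 0 l v)"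

lemma verma: "pbw h 0" by (simp add: pbw_def)

lemma verma_singular_level:
  assumes "verma_singular c h l"
  obtains n :: nat where "l = of_nat n / 2"
proof -
  interpret pbw c h 0 by (rule verma)
  obtain v where v: "singular l v" using assms by (auto simp: verma_singular_def)
  then obtain W where W: "W \<in> Poly_Mapping.keys v" using singular_lowest_word by blast
  have "wt W = l" using wt_eigen[OF _ _ W] v by (auto simp: singular_def)
  have "valid W" using v W by (auto simp: singular_def carrier_def)
  then have "\<And>x. x \<in> set W \<Longrightarrow> x < 0" by (rule valid_lt)
  moreover have "(\<forall>x\<in>set W. x < 0) \<longrightarrow> sum_list W \<le> 0" by (induct W) auto
  ultimately have "sum_list W \<le> 0" by blast
  with \<open>wt W = l\<close> show ?thesis using that[of "nat (- sum_list W)"] by (simp add: wt_def)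
qed

text \<open>\<open>nonres1\<close> and \<open>nonres2\<close> are the nonresonance conditions of the
  recursion in factored form; \<open>nonres3\<close> keeps the factor 2 - tau / \<open>cb n\<close>
  in the recursion for \<open>al\<close> from vanishing.\<close>

locale verma_fusion =
  fixes c tau sig :: complex
  assumes tau: "tau \<noteq> 0" and c: "c = 3 / 2 * (5 - 2 * tau - 2 / tau)"
    and nonres1: "p \<ge> 1 \<Longrightarrow> of_nat p + sig \<noteq> 0"
    and nonres2: "sig + tau + 1 + 2 * of_nat p \<noteq> 0"
    and nonres3: "sig + 1 + 2 * of_nat p \<noteq> 0"
begin

abbreviation hS where "hS \<equiv> kac_weight tau sig"
abbreviation hT where "hT \<equiv> kac_weight tau (sig + 2 * tau)"
definition kappa where "kappa = (sig - tau + 1) / 2"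

sublocale T: pbw c hT 0 by (rule verma)

lemma hT_hS: "hT - hS = (sig + tau) / 2"
  using tau by (simp add: kac_weight_def field_simps power2_eq_square)

lemma kappa_indicial: "kappa * (kappa - 1 + tau) = 2 * tau * hS"
  using tau by (simp add: kappa_def kac_weight_def field_simps power2_eq_square)

text \<open>\<open>kappa\<close> makes 0 a root of the indicial polynomial, and the other root is
  then -sig.\<close>

lemma ca_eq: "(kappa + x) * (kappa + x - 1 + tau) - 2 * tau * hS = x * (x + sig)"
  unfolding kappa_indicial[symmetric] kappa_def by (simp add: field_simps)

lemma cb_eq: "kappa + x + tau = (sig + tau + 1 + 2 * x) / 2"
  by (simp add: kappa_def field_simps)

sublocale X: fusion_vector scv T.carrier c T.J kappa "tau - 1 / 2" tau hT hS "ev []"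
proof unfold_locales
  show "2 * (tau - 1 / 2) = tau * (tau - 1 / 2 + c / 3)"
    using tau by (simp add: c field_simps)
  show "ev [] \<in> T.carrier" by simp
  show "T.J a (ev []) = 0" if "a > 0" for a using T.J_empty[of a] that by simp
  show "T.J 0 (ev []) = scv hT (ev [])" using T.J_empty[of 0] by simp
  show "kappa = hT - (tau - 1 / 2) - hS" using hT_hS by (simp add: kappa_def field_simps)
  show "kappa * (kappa - 1 + tau) = 2 * tau * hS" by (rule kappa_indicial)
  show "(kappa + of_nat p) * (kappa + of_nat p - 1 + tau) - 2 * tau * hS \<noteq> 0" if "p \<ge> 1" for p :: nat
    unfolding ca_eq using that nonres1[OF that] by simp
  show "kappa + of_nat p + tau \<noteq> 0" for p :: nat
    unfolding cb_eq using nonres2[of p] by simp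
qed simp

sublocale M: pbw_map c hS 0 X.sc2 X.S2 X.TJ X.XX
proof unfold_locales
  show "X.XX \<in> X.S2" by (rule X.XX_in_S2)
  show "X.TJ a X.XX = X.sc2 (if a = 0 then hS else 0) X.XX" if "a \<ge> 0" for a
    using X.XX_positive[of a] X.XX_weight that by (cases "a = 0") (simp_all add: X.sc2_def zero_prod_def zero_fun_def)
qed simp

section \<open>Growth of the character along the fusion vector\<close>

definition al :: "nat \<Rightarrow> complex" where "al n = T.phi (X.AA (int n))"

lemma phi_sum: "T.phi (sum f A) = (\<Sum>x\<in>A. T.phi (f x))"
  by (induct A rule: infinite_finite_induct) (simp_all add: T.phi_add T.phi_scale[of 0 0, simplified])

lemma phi_mode: "v \<in> T.carrier \<Longrightarrow> a < 0 \<Longrightarrow> T.phi (T.J a v) = T.chi a * T.phi v"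
  by (rule T.phi_J) simp_all

lemma phi_diff: "T.phi (v - w) = T.phi v - T.phi w"
  using T.phi_add[of "v - w" w] by simp

lemma phi_B: "X.cb (int n) * T.phi (X.BB (int n)) = tau * al n"
proof -
  have "X.cb (int n) * T.phi (X.BB (int n)) = T.phi (scv (X.cb (int n)) (X.BB (int n)))" by (simp add: T.phi_scale)
  also have "\<dots> = tau * (\<Sum>i\<in>{0..int n}. T.phi (T.G (-1 - i) (X.AA (int n - i))))"
    by (subst X.rec_B[of "int n" "int n"]) (simp_all add: T.phi_scale phi_sum)
  also have "(\<Sum>i\<in>{0..int n}. T.phi (T.G (-1 - i) (X.AA (int n - i)))) = (\<Sum>i\<in>{0..int n}. if i = 0 then al n else 0)"
    by (rule sum.cong) (auto simp: phi_mode X.AABB_in_S T.chi_def al_def)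
  finally show ?thesis by simp
qed

text \<open>\<open>phi\<close> turns the recursion of vectors into one of numbers: of all negative
  modes in the sums only L_{-1} and G_{-1/2} survive.\<close>

lemma al_Suc: "of_nat (Suc n) * (of_nat (Suc n) + sig) * al (Suc n) = tau * (2 - tau / X.cb (int n)) * al n"
proof -
  have ca: "X.ca (int (Suc n)) = of_nat (Suc n) * (of_nat (Suc n) + sig)"
    unfolding X.ca_def ca_eq by simp
  have "X.ca (int (Suc n)) * al (Suc n) = T.phi (scv (X.ca (int (Suc n))) (X.AA (int (Suc n))))" by (simp add: T.phi_scale al_def)
  also have "\<dots> = 2 * tau * (\<Sum>i\<in>{1..int (Suc n)}. T.phi (T.L (- i) (X.AA (int (Suc n) - i))))
     - tau * (\<Sum>i\<in>{0..int (Suc n)}. T.phi (T.G (-1 - i) (X.BB (int (Suc n) - 1 - i))))"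
    by (subst X.rec_A[of "int (Suc n)" "int (Suc n)"]) (simp_all add: T.phi_scale phi_sum phi_diff)
  also have "(\<Sum>i\<in>{1..int (Suc n)}. T.phi (T.L (- i) (X.AA (int (Suc n) - i)))) = (\<Sum>i\<in>{1..int (Suc n)}. if i = 1 then al n else 0)"
    by (rule sum.cong) (auto simp: phi_mode X.AABB_in_S T.chi_def al_def)
  also have "(\<Sum>i\<in>{0..int (Suc n)}. T.phi (T.G (-1 - i) (X.BB (int (Suc n) - 1 - i)))) = (\<Sum>i\<in>{0..int (Suc n)}. if i = 0 then T.phi (X.BB (int n)) else 0)"
    by (rule sum.cong) (auto simp: phi_mode X.AABB_in_S T.chi_def)
  also have "T.phi (X.BB (int n)) = tau * al n / X.cb (int n)"
    using phi_B[of n] X.cb_neq_0[of "int n"] by (simp add: field_simps)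
  finally show ?thesis unfolding ca by (simp add: field_simps)
qed

lemma al_0: "al 0 = 1"
  by (simp add: al_def X.AA_0 T.phi_ev)

lemma cb_int: "X.cb (int n) = (sig + tau + 1 + 2 * of_nat n) / 2"
  using cb_eq[of "of_nat n"] by (simp add: X.cb_def)

lemma al_neq_0: "al n \<noteq> 0"
proof (induct n)
  case (Suc n)
  have "2 - tau / X.cb (int n) \<noteq> 0"
  proof
    assume "2 - tau / X.cb (int n) = 0"
    then have "tau = 2 * X.cb (int n)" using X.cb_neq_0[of "int n"] by (simp add: field_simps)
    then have "sig + 1 + 2 * of_nat n = 0" unfolding cb_int by algebra
    then show False using nonres3[of n] by simp
  qed
  then have "tau * (2 - tau / X.cb (int n)) * al n \<noteq> 0" using Suc tau by simp
  then show ?case using al_Suc[of n] by auto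
qed (simp add: al_0)

lemma inverse_shift_tendsto: "(\<lambda>n. 1 / (of_nat n + z :: complex)) \<longlonglongrightarrow> 0"
proof -
  have "filterlim (\<lambda>n. of_nat n + z) at_infinity sequentially"
    by (rule tendsto_add_filterlim_at_infinity'[OF tendsto_of_nat tendsto_const])
  then show ?thesis using tendsto_inverse_0 filterlim_compose by (fastforce simp: inverse_eq_divide)
qed

lemma linear_ratio_tendsto: "(\<lambda>n. (of_nat n + y) / (of_nat n + z :: complex)) \<longlonglongrightarrow> 1"
proof -
  have "(\<lambda>n. 1 + (y - z) * (1 / (of_nat n + z))) \<longlonglongrightarrow> 1 + (y - z) * 0"
    by (intro tendsto_intros inverse_shift_tendsto)
  moreover have "\<forall>\<^sub>F n in sequentially. 1 + (y - z) * (1 / (of_nat n + z)) = (of_nat n + y) / (of_nat n + z)"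
  proof (rule eventually_mono)
    show "\<forall>\<^sub>F n in sequentially. norm (of_nat n :: complex) > norm z"
      using filterlim_at_infinity_imp_norm_at_top[OF tendsto_of_nat] unfolding filterlim_at_top_dense by auto
    fix n assume "norm (of_nat n :: complex) > norm z"
    then have "of_nat n + z \<noteq> 0" using add_eq_0_iff by force
    then show "1 + (y - z) * (1 / (of_nat n + z)) = (of_nat n + y) / (of_nat n + z)" by (simp add: field_simps)
  qed
  ultimately show ?thesis using Lim_transform_eventually by fastforce
qed

text \<open>By \<open>al_Suc\<close> the quotient is of order 1 / n^2, so it stays negligible after
  multiplication by the linear factor that the derivative in a mode produces.\<close>

lemma al_ratio_1: "(\<lambda>n. (of_nat n + x) * (al (Suc n) / al n)) \<longlonglongrightarrow> 0"
proof -
  have "(\<lambda>n. tau * (2 - tau * (1 / (of_nat n + (sig + tau + 1) / 2))) * ((of_nat n + x) / (of_nat n + 1)) * (1 / (of_nat n + (1 + sig))))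
    \<longlonglongrightarrow> tau * (2 - tau * 0) * 1 * 0"
    by (intro tendsto_intros inverse_shift_tendsto linear_ratio_tendsto)
  moreover have "tau * (2 - tau * (1 / (of_nat n + (sig + tau + 1) / 2))) * ((of_nat n + x) / (of_nat n + 1)) * (1 / (of_nat n + (1 + sig)))
    = (of_nat n + x) * (al (Suc n) / al n)" for n
  proof -
    have 0: "of_nat n + 1 \<noteq> (0::complex)" "of_nat n + (1 + sig) \<noteq> 0"
      using nonres1[of "Suc n"] of_nat_neq_0[of n, where 'a = complex] by (simp_all add: add_ac)
    have e: "X.cb (int n) = of_nat n + (sig + tau + 1) / 2" unfolding cb_int by (simp add: field_simps)
    have "(of_nat n + 1) * (of_nat n + (1 + sig)) * al (Suc n) = tau * (2 - tau / X.cb (int n)) * al n"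
      using al_Suc[of n] by (simp add: add_ac)
    then have "al (Suc n) / al n = tau * (2 - tau / X.cb (int n)) / ((of_nat n + 1) * (of_nat n + (1 + sig)))"
    proof -
      assume *: "(of_nat n + 1) * (of_nat n + (1 + sig)) * al (Suc n) = tau * (2 - tau / X.cb (int n)) * al n"
      have "(of_nat n + 1) * (of_nat n + (1 + sig)) \<noteq> 0" using 0 by simp
      then show ?thesis using * al_neq_0[of n] unfolding nonzero_divide_eq_eq[OF al_neq_0] times_divide_eq_left
        by (metis nonzero_mult_div_cancel_left)
    qed
    then show ?thesis unfolding e by simp
  qed
  ultimately show ?thesis by simp
qed

lemma al_ratio_0: "(\<lambda>n. al (Suc n) / al n) \<longlonglongrightarrow> 0"
proof -
  have "(\<lambda>n. (of_nat n + 1) * (al (Suc n) / al n) - (of_nat n + 0) * (al (Suc n) / al n)) \<longlonglongrightarrow> 0 - 0"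
    by (intro tendsto_diff al_ratio_1)
  moreover have "(of_nat n + 1) * r - (of_nat n + 0) * r = r" for n and r :: complex by (simp add: ring_distribs)
  ultimately show ?thesis by (simp only: diff_0_right)
qed

lemma al_ratio: "(\<lambda>n. al (n + d) / al n) \<longlonglongrightarrow> (if d = 0 then 1 else 0)"
proof (induct d)
  case (Suc d)
  have "(\<lambda>n. al (n + d) / al n) \<longlonglongrightarrow> (if d = 0 then 1 else 0)" by (rule Suc)
  then have "(\<lambda>n. al (Suc n + d) / al (Suc n)) \<longlonglongrightarrow> (if d = 0 then 1 else 0)" by (rule LIMSEQ_Suc)
  from tendsto_mult[OF this al_ratio_0] show ?case using al_neq_0 by simp
qed (simp add: al_neq_0)

lemma al_ratio_linear:
  assumes "d \<ge> 1"
  shows "(\<lambda>n. (of_nat n + x) * (al (n + d) / al n)) \<longlonglongrightarrow> 0"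
proof -
  obtain e where e: "d = Suc e" using assms by (cases d) auto
  have "(\<lambda>n. al (Suc n + e) / al (Suc n)) \<longlonglongrightarrow> (if e = 0 then 1 else 0)" by (rule LIMSEQ_Suc[OF al_ratio])
  from tendsto_mult[OF al_ratio_1[of x] this] show ?thesis using al_neq_0 e by simp
qed

text \<open>Nonvanishing is detected by the growth of the character phi along the two component series.\<close>

definition cls :: "complex \<Rightarrow> (int \<Rightarrow> wvec) \<times> (int \<Rightarrow> wvec) \<Rightarrow> bool" where
  "cls lam Z \<longleftrightarrow> Z \<in> X.S2 \<and> (\<lambda>n. T.phi (fst Z (int n)) / al n) \<longlonglongrightarrow> lam \<and> (\<lambda>n. T.phi (snd Z (int n)) / al n) \<longlonglongrightarrow> 0"

lemma cls_XX: "cls 1 X.XX"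
proof -
  have "T.phi (X.BB (int n)) / al n = tau * (1 / (of_nat n + (sig + tau + 1) / 2))" for n
  proof -
    have e: "X.cb (int n) = of_nat n + (sig + tau + 1) / 2" unfolding cb_int by (simp add: field_simps)
    show ?thesis unfolding e[symmetric] using phi_B[of n] X.cb_neq_0[of "int n"] al_neq_0[of n] by (simp add: field_simps)
  qed
  moreover have "(\<lambda>n. tau * (1 / (of_nat n + (sig + tau + 1) / 2))) \<longlonglongrightarrow> tau * 0"
    by (intro tendsto_intros inverse_shift_tendsto)
  moreover have "T.phi (X.AA (int n)) / al n = 1" for n using al_neq_0[of n] by (simp add: al_def)
  ultimately show ?thesis unfolding cls_def X.XX_def using X.XX_in_S2[unfolded X.XX_def] by simp
qed

lemma cls_add: "cls x Z \<Longrightarrow> cls y W \<Longrightarrow> cls (x + y) (Z + W)"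
  unfolding cls_def using tendsto_add[of "\<lambda>n. T.phi (snd Z (int n)) / al n" 0 sequentially "\<lambda>n. T.phi (snd W (int n)) / al n" 0]
  by (auto simp: T.phi_add add_divide_distrib tendsto_add intro: X.D.subspace_add[OF X.D.S_subspace])

lemma cls_scale: "cls x Z \<Longrightarrow> cls (y * x) (X.sc2 y Z)"
  unfolding cls_def using tendsto_mult_left[of "\<lambda>n. T.phi (snd Z (int n)) / al n" 0 sequentially y]
    tendsto_mult_left[of "\<lambda>n. T.phi (fst Z (int n)) / al n" x sequentially y]
  by (auto simp: X.sc2_def T.phi_scale X.D.subspace_scale[OF X.D.S_subspace, unfolded X.sc2_def])

lemma shifted_tendsto:
  assumes "(\<lambda>n. f (int n) / al n) \<longlonglongrightarrow> lam"
  shows "(\<lambda>n. f (int n + int d) / al n) \<longlonglongrightarrow> (if d = 0 then lam else 0)"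
proof -
  have "(\<lambda>n. f (int (n + d)) / al (n + d)) \<longlonglongrightarrow> lam" using assms by (rule LIMSEQ_ignore_initial_segment)
  from tendsto_mult[OF this al_ratio[of d]] show ?thesis using al_neq_0 by (auto simp: if_distrib)
qed

lemma shifted_linear_tendsto:
  assumes "(\<lambda>n. f (int n) / al n) \<longlonglongrightarrow> lam" "d \<ge> 1"
  shows "(\<lambda>n. (of_nat n + x) * f (int n + int d) / al n) \<longlonglongrightarrow> 0"
proof -
  have "(\<lambda>n. f (int (n + d)) / al (n + d)) \<longlonglongrightarrow> lam" using assms(1) by (rule LIMSEQ_ignore_initial_segment)
  from tendsto_mult[OF this al_ratio_linear[OF assms(2), of x]] show ?thesis using al_neq_0 by (auto simp: mult_ac)
qed

text \<open>A negative mode contributes the mode of the module, on which \<open>phi\<close> is the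
  character, and terms from the field. The latter are later coefficients, possibly with a linear
  factor, or the odd component without such a factor, and all of them vanish in the limit.\<close>

lemma cls_TJ:
  assumes Z: "cls lam Z" and a: "a < 0"
  shows "cls (T.chi a * lam) (X.TJ a Z)"
proof (cases "even a")
  case True
  then obtain n where n: "a = 2 * n" by auto
  then obtain d where d: "n = - int d" "d \<ge> 1" using a by (metis int_ops(2) mult_less_0_iff neg_int_cases of_nat_0_less_iff less_one linorder_not_less zero_less_numeral not_less_iff_gr_or_eq)
  have A: "(\<lambda>n. T.phi (fst Z (int n)) / al n) \<longlonglongrightarrow> lam" and B: "(\<lambda>n. T.phi (snd Z (int n)) / al n) \<longlonglongrightarrow> 0"
    and S: "fst Z k \<in> T.carrier" "snd Z k \<in> T.carrier" for k using Z by (auto simp: cls_def X.S2_def)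
  let ?x = "kappa + of_nat d + of_int (n + 1) * (tau - 1 / 2)"
  let ?y = "kappa + of_nat d + of_int (n + 1) * (tau - 1 / 2 + 1 / 2)"
  have "(\<lambda>k. T.chi a * (T.phi (fst Z (int k)) / al k) - (of_nat k + ?x) * T.phi (fst Z (int k + int d)) / al k) \<longlonglongrightarrow> T.chi a * lam - 0"
    by (intro tendsto_intros A shifted_linear_tendsto[OF A d(2)])
  moreover have "(\<lambda>k. T.chi a * (T.phi (snd Z (int k)) / al k) - (of_nat k + ?y) * T.phi (snd Z (int k + int d)) / al k) \<longlonglongrightarrow> T.chi a * 0 - 0"
    by (intro tendsto_intros B shifted_linear_tendsto[OF B d(2)])
  moreover have "T.phi (fst (X.TL n Z) (int k)) / al k = T.chi a * (T.phi (fst Z (int k)) / al k) - (of_nat k + ?x) * T.phi (fst Z (int k + int d)) / al k"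
     "T.phi (snd (X.TL n Z) (int k)) / al k = T.chi a * (T.phi (snd Z (int k)) / al k) - (of_nat k + ?y) * T.phi (snd Z (int k + int d)) / al k" for k
  proof -
    have e: "int k - n = int k + int d" "kappa + of_int (int k - n) + z = of_nat k + (kappa + of_nat d + z)" for z using d by simp_all
    show "T.phi (fst (X.TL n Z) (int k)) / al k = T.chi a * (T.phi (fst Z (int k)) / al k) - (of_nat k + ?x) * T.phi (fst Z (int k + int d)) / al k"
     "T.phi (snd (X.TL n Z) (int k)) / al k = T.chi a * (T.phi (snd Z (int k)) / al k) - (of_nat k + ?y) * T.phi (snd Z (int k + int d)) / al k"
      unfolding X.TL_def fst_conv snd_conv phi_diff T.phi_scale n[symmetric] phi_mode[OF S(1) a] phi_mode[OF S(2) a] e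
      by (simp_all add: diff_divide_distrib)
  qed
  moreover have "X.TJ a Z \<in> X.S2" using Z X.TJ_S2 by (simp add: cls_def)
  ultimately show ?thesis unfolding cls_def n by simp
next
  case False
  then obtain j where n: "a = 2 * j + 1" by (auto elim: oddE)
  then obtain d where d: "j = - int d" "d \<ge> 1" using a by (intro that[of "nat (- j)"]) auto
  have A: "(\<lambda>n. T.phi (fst Z (int n)) / al n) \<longlonglongrightarrow> lam" and B: "(\<lambda>n. T.phi (snd Z (int n)) / al n) \<longlonglongrightarrow> 0"
    and S: "fst Z k \<in> T.carrier" "snd Z k \<in> T.carrier" for k using Z by (auto simp: cls_def X.S2_def)
  let ?x = "kappa + of_nat d + of_int (2 * j + 2) * (tau - 1 / 2)"
  have "(\<lambda>k. T.chi a * (T.phi (fst Z (int k)) / al k) - T.phi (snd Z (int k + int (d - 1))) / al k) \<longlonglongrightarrow> T.chi a * lam - (if d - 1 = 0 then 0 else 0)"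
    by (intro tendsto_diff tendsto_mult tendsto_const A shifted_tendsto[OF B])
  then have "(\<lambda>k. T.chi a * (T.phi (fst Z (int k)) / al k) - T.phi (snd Z (int k + int (d - 1))) / al k) \<longlonglongrightarrow> T.chi a * lam" by simp
  moreover have "(\<lambda>k. - (T.chi a * (T.phi (snd Z (int k)) / al k)) + (of_nat k + ?x) * T.phi (fst Z (int k + int d)) / al k) \<longlonglongrightarrow> - (T.chi a * 0) + 0"
    by (intro tendsto_intros B shifted_linear_tendsto[OF A d(2)])
  moreover have "T.phi (fst (X.TG j Z) (int k)) / al k = T.chi a * (T.phi (fst Z (int k)) / al k) - T.phi (snd Z (int k + int (d - 1))) / al k"
     "T.phi (snd (X.TG j Z) (int k)) / al k = - (T.chi a * (T.phi (snd Z (int k)) / al k)) + (of_nat k + ?x) * T.phi (fst Z (int k + int d)) / al k" for k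
  proof -
    have e: "int k - j = int k + int d" "int k + int d - 1 = int k + int (d - 1)"
      "kappa + of_int (int k + int d) + z = of_nat k + (kappa + of_nat d + z)" for z
      using d by (simp_all add: of_nat_diff)
    have m: "T.phi (- v) = - T.phi v" for v using phi_diff[of 0 v] T.phi_scale[of 0 0] by simp
    show "T.phi (fst (X.TG j Z) (int k)) / al k = T.chi a * (T.phi (fst Z (int k)) / al k) - T.phi (snd Z (int k + int (d - 1))) / al k"
     "T.phi (snd (X.TG j Z) (int k)) / al k = - (T.chi a * (T.phi (snd Z (int k)) / al k)) + (of_nat k + ?x) * T.phi (fst Z (int k + int d)) / al k"
      unfolding X.TG_def fst_conv snd_conv T.phi_add phi_diff m T.phi_scale n[symmetric] phi_mode[OF S(1) a] phi_mode[OF S(2) a] e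
      by (simp_all only: diff_divide_distrib add_divide_distrib times_divide_eq_right minus_divide_left)
  qed
  moreover have "X.TJ a Z \<in> X.S2" using Z X.TJ_S2 by (simp add: cls_def)
  ultimately show ?thesis unfolding cls_def n by simp
qed

lemma foldr_TJ:
  assumes "\<And>x. x \<in> set W \<Longrightarrow> x < 0"
  shows "cls (if set W \<subseteq> {-2, -1} then 1 else 0) (foldr X.TJ W X.XX)" "foldr X.TJ W X.XX \<in> X.kill"
proof -
  have "cls (if set W \<subseteq> {-2, -1} then 1 else 0) (foldr X.TJ W X.XX) \<and> foldr X.TJ W X.XX \<in> X.kill"
    using assms
  proof (induct W)
    case Nil
    then show ?case using cls_XX X.XX_kill by simp
  next
    case (Cons a W)
    then have c: "cls (if set W \<subseteq> {-2, -1} then 1 else 0) (foldr X.TJ W X.XX)" and k: "foldr X.TJ W X.XX \<in> X.kill" by auto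
    have "T.chi a * (if set W \<subseteq> {-2, -1} then 1 else 0) = (if set (a # W) \<subseteq> {-2, -1} then 1 else 0)"
      by (auto simp: T.chi_def)
    with cls_TJ[OF c, of a] X.kill_TJ[OF k, of a] Cons.prems show ?case by auto
  qed
  then show "cls (if set W \<subseteq> {-2, -1} then 1 else 0) (foldr X.TJ W X.XX)" "foldr X.TJ W X.XX \<in> X.kill" by auto
qed

lemma hom_cls:
  assumes v: "v \<in> M.carrier"
  shows "cls (M.phi v) (M.hom v)"
proof -
  have "cls (\<Sum>W\<in>A. Poly_Mapping.lookup v W * (if set W \<subseteq> {-2, -1} then 1 else 0))
      (\<Sum>W\<in>A. X.sc2 (Poly_Mapping.lookup v W) (foldr X.TJ W X.XX))" if "A \<subseteq> Poly_Mapping.keys v" for A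
    using finite_subset[OF that finite_keys] that
  proof (induct A)
    case empty
    show ?case using cls_scale[OF cls_XX, of 0] by (simp add: X.sc2_def zero_prod_def zero_fun_def)
  next
    case (insert W A)
    have "M.valid W" using insert.prems v by (auto simp: M.carrier_def)
    then have W: "x < 0" if "x \<in> set W" for x using M.valid_lt[of W x] that by simp
    have A: "A \<subseteq> Poly_Mapping.keys v" using insert.prems by simp
    show ?case unfolding sum.insert[OF insert.hyps(1,2)]
      by (intro cls_add cls_scale foldr_TJ(1) insert.hyps(3)[OF A] W)
  qed
  from this[OF order_refl] show ?thesis unfolding M.phi_def M.hom_def wlin_def .
qed

lemma hom_kill:
  assumes v: "v \<in> M.carrier"
  shows "M.hom v \<in> X.kill"
  unfolding M.hom_def wlin_def
proof (intro X.D.subspace_sum[OF X.kill_subspace] X.D.subspace_scale[OF X.kill_subspace] foldr_TJ(2))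
  fix W x assume "W \<in> Poly_Mapping.keys v" "x \<in> set W"
  then show "x < 0" using v M.valid_lt[of W x] by (auto simp: M.carrier_def)
qed

text \<open>Acting with v on the fusion vector gives a nonzero highest weight vector, whose leading coefficient is singular
  in the target.\<close>

theorem singular_transfer:
  assumes "verma_singular c hS l"
  shows "(\<exists>p::int. of_int p * (of_int p + sig) = 2 * tau * l \<and> verma_singular c hT (l + of_int p))
     \<or> (\<exists>p::int. sig + tau + 1 + 2 * of_int p = 0 \<and> verma_singular c hT (l + of_int p + 1 / 2))"
proof -
  obtain v where v: "M.singular l v" using assms by (auto simp: verma_singular_def)
  then have vc: "v \<in> M.carrier" and v0: "M.J 0 v = scv (hS + l) v" and vp: "\<And>a. a > 0 \<Longrightarrow> M.J a v = 0"
    by (auto simp: M.singular_def)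
  define y where "y = M.hom v"
  have yk: "y \<in> X.kill" unfolding y_def by (rule hom_kill[OF vc])
  have y2: "fst y k \<in> T.carrier" "snd y k \<in> T.carrier" for k using yk by (auto simp: X.kill_def X.S2_def)
  have yp: "X.TJ a y = 0" if "a > 0" for a
    unfolding y_def M.hom_J[OF vc, symmetric] vp[OF that] by (simp add: M.hom_def wlin_def)
  have y0: "X.TJ 0 y = X.sc2 (hS + l) y"
    unfolding y_def M.hom_J[OF vc, symmetric] v0 by (rule M.hom_scale)
  have G: "X.TG j y = 0" if "j \<ge> 0" for j using yp[of "2 * j + 1"] that by simp
  have L: "X.TL n y = 0" if "n > 0" for n using yp[of "2 * n"] that by simp
  have L0: "X.TL 0 y = X.sc2 (hS + l) y" using y0 X.TJ_even[of 0] by simp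
  have sm: "X.smooth y 0" using G L by (auto simp: X.smooth_def)
  obtain R0 k0 where R0: "R0 \<ge> 0" and lb: "X.lbd y k0"
    and N: "\<And>R M m. R \<ge> R0 \<Longrightarrow> M \<ge> 0 \<Longrightarrow> M \<ge> m + 2 - k0 \<Longrightarrow> X.NN M R y m = 0 \<and> X.NP M R y m = 0"
    using yk unfolding X.kill_def by blast
  \<comment> \<open>If y were zero, the limit of the character quotients would be 0, but it is
    \<open>phi v\<close>, which is nonzero for a singular v.\<close>
  have ne: "\<exists>k. fst y k \<noteq> 0 \<or> snd y k \<noteq> 0"
  proof (rule ccontr)
    assume "\<not> ?thesis"
    moreover have "T.phi 0 = 0" using T.phi_scale[of 0 0] by simp
    ultimately have "(\<lambda>n. T.phi (fst y (int n)) / al n) = (\<lambda>n. 0)" by simp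
    moreover have "(\<lambda>n. T.phi (fst y (int n)) / al n) \<longlonglongrightarrow> M.phi v"
      using hom_cls[OF vc] by (simp add: cls_def y_def)
    ultimately have "M.phi v = 0" using LIMSEQ_unique[OF tendsto_const] by metis
    then show False using M.phi_singular[OF refl v] by simp
  qed
  then obtain k1 where k1: "fst y k1 \<noteq> 0 \<or> snd y k1 \<noteq> 0" by blast
  have ge: "k \<ge> k0" if "fst y k \<noteq> 0 \<or> snd y k \<noteq> 0" for k using lb that unfolding X.lbd_def by force
  \<comment> \<open>The index of the leading coefficient, counted from the lower bound k0 so that a
    least natural number can be taken.\<close>
  define p where "p = k0 + int (LEAST n. fst y (k0 + int n) \<noteq> 0 \<or> snd y (k0 + int n) \<noteq> 0)"
  have pe: "fst y p \<noteq> 0 \<or> snd y p \<noteq> 0"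
    unfolding p_def by (rule LeastI[of _ "nat (k1 - k0)"]) (use k1 ge[OF k1] in simp)
  have low: "fst y k = 0 \<and> snd y k = 0" if "k < p" for k
  proof (rule ccontr)
    assume *: "\<not> ?thesis"
    then have k: "k \<ge> k0" using ge by blast
    have "(LEAST n. fst y (k0 + int n) \<noteq> 0 \<or> snd y (k0 + int n) \<noteq> 0) \<le> nat (k - k0)"
      by (rule Least_le) (use * k in auto)
    then show False using that k unfolding p_def by linarith
  qed
  define N0 where "N0 = max 1 (p + 2 - k0)"
  have R: "R0 = 0 + int (nat R0)" using R0 by simp
  have NN: "X.NN N0 0 y (p - 1) = 0" and NP: "X.NP N0 0 y p = 0"
    using N[of R0 N0 "p - 1"] N[of R0 N0 p] X.NN_shift[OF sm, of N0 "nat R0"] X.NP_shift[OF sm, of N0 "nat R0"] R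
    by (simp_all add: N0_def)
  have N0: "N0 \<ge> 0" by (simp add: N0_def)
  note hw = X.hw_recursion[OF sm G[OF order_refl] L0 N0]
  have s1: "(\<Sum>i\<in>{0..N0 - 1}. T.G (-1 - i) (fst y (p - 1 + 1 - i))) = T.G (-1) (fst y p)"
  proof -
    have "(\<Sum>i\<in>{0..N0 - 1}. T.G (-1 - i) (fst y (p - 1 + 1 - i))) = (\<Sum>i\<in>{0..N0 - 1}. if i = 0 then T.G (-1) (fst y p) else 0)"
      by (rule sum.cong) (auto simp: low)
    moreover have "0 \<le> N0 - 1" by (simp add: N0_def)
    ultimately show ?thesis by simp
  qed
  have s2: "(\<Sum>n\<in>{1..N0}. T.L (- n) (fst y (p - n))) = 0" by (rule sum.neutral) (auto simp: low)
  have s3: "(\<Sum>i\<in>{0..N0 - 1}. T.G (-1 - i) (snd y (p - 1 - i))) = 0" by (rule sum.neutral) (auto simp: low)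
  have B: "scv (kappa + of_int p + tau) (snd y p) = scv tau (T.G (-1) (fst y p))"
    using hw(1)[of "p - 1"] unfolding NN s1 by simp
  \<comment> \<open>For y the weight hS + l takes the place of hS in the recursion. At the leading
    index the sums over lower coefficients vanish, which leaves the indicial equation.\<close>
  have A: "scv (of_int p * (of_int p + sig) - 2 * tau * l) (fst y p) = 0"
  proof -
    have "(kappa + of_int p) * (kappa + of_int p - 1 + tau) - 2 * tau * (hS + l) = of_int p * (of_int p + sig) - 2 * tau * l"
      unfolding ca_eq[symmetric] by (simp add: ring_distribs)
    then show ?thesis using hw(2)[of p] unfolding NP s2 s3 by simp
  qed
  have comp: "fst (X.TG j y) k = fst 0 k" "snd (X.TG j y) k = snd 0 k" if "j \<ge> 0" for j k unfolding G[OF that] by simp_all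
  have compL: "fst (X.TL n y) k = fst 0 k" "snd (X.TL n y) k = snd 0 k" if "n > 0" for n k unfolding L[OF that] by simp_all
  have GA: "T.G j (fst y p) = 0" if "j \<ge> 0" for j
    using comp(1)[OF that, of p] low[of "p - j - 1"] that by (simp add: X.TG_def)
  have LA: "T.L n (fst y p) = 0" if "n > 0" for n
    using compL(1)[OF that, of p] low[of "p - n"] that by (simp add: X.TL_def)
  have GB: "T.G j (snd y p) = 0" if "j \<ge> 0" "fst y p = 0" for j
    using comp(2)[OF that(1), of p] low[of "p - j"] that by (cases "j = 0") (simp_all add: X.TG_def)
  have LB: "T.L n (snd y p) = 0" if "n > 0" for n
    using compL(2)[OF that, of p] low[of "p - n"] that by (simp add: X.TL_def)
  have e: "hS + l + (kappa + of_int p + (tau - 1 / 2)) = hT + (l + of_int p)"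
      "hS + l + (kappa + of_int p + (tau - 1 / 2 + 1 / 2)) = hT + (l + of_int p + 1 / 2)"
  proof -
    have h: "hT = hS + (sig + tau) / 2" using hT_hS by (simp only: diff_eq_eq) (simp only: add.commute)
    show "hS + l + (kappa + of_int p + (tau - 1 / 2)) = hT + (l + of_int p)"
      "hS + l + (kappa + of_int p + (tau - 1 / 2 + 1 / 2)) = hT + (l + of_int p + 1 / 2)"
      unfolding h kappa_def by (simp_all add: field_simps)
  qed
  have cw: "fst (X.TL 0 y) p = scv (hS + l) (fst y p)" "snd (X.TL 0 y) p = scv (hS + l) (snd y p)"
    unfolding L0 by (simp_all add: X.sc2_def)
  have wA: "T.L 0 (fst y p) = scv (hT + (l + of_int p)) (fst y p)"
    using cw(1) unfolding e(1)[symmetric] by (simp add: X.TL_def diff_eq_eq wv.scale_left_distrib)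
  have wB: "T.L 0 (snd y p) = scv (hT + (l + of_int p + 1 / 2)) (snd y p)"
    using cw(2) unfolding e(2)[symmetric] by (simp add: X.TL_def diff_eq_eq wv.scale_left_distrib)
  have modes: "T.J a x = 0" if "\<And>j. j \<ge> 0 \<Longrightarrow> T.G j x = 0" "\<And>n. n > 0 \<Longrightarrow> T.L n x = 0" "a > 0" for a x
    using that(1)[of "a div 2"] that(2)[of "a div 2"] that(3) by (cases "even a") auto
  show ?thesis
  proof (cases "fst y p = 0")
    case False
    have "T.singular (l + of_int p) (fst y p)"
      unfolding T.singular_def using False y2 wA modes[OF GA LA] by simp
    moreover have "of_int p * (of_int p + sig) = 2 * tau * l" using A False by simp
    ultimately show ?thesis unfolding verma_singular_def by blast
  next
    \<comment> \<open>Now the odd component leads; its recursion has right hand side 0, so its own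
      factor must vanish.\<close>
    case True
    have "T.singular (l + of_int p + 1 / 2) (snd y p)"
      unfolding T.singular_def using True pe y2 wB modes[OF GB[OF _ True] LB] by simp
    moreover have "sig + tau + 1 + 2 * of_int p = 0" using B pe unfolding True cb_eq by simp
    ultimately show ?thesis unfolding verma_singular_def by blast
  qed
qed

end

section \<open>Chains of singular vectors\<close>

text \<open>Here x and m are b times the label sig and twice the level, for tau = a / b.\<close>

definition kac_singular :: "int \<Rightarrow> int \<Rightarrow> int \<Rightarrow> int \<Rightarrow> bool" where
  "kac_singular a b x m \<longleftrightarrow>
     verma_singular (c_pq a b) (of_int (x\<^sup>2 - (a - b)\<^sup>2) / of_int (8 * a * b)) (of_int m / 2)"

lemma kac_singular_nonneg:
  assumes "kac_singular a b x m"
  shows "m \<ge> 0"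
proof -
  obtain n :: nat where "of_int m / 2 = (of_nat n / 2 :: complex)"
    using assms verma_singular_level unfolding kac_singular_def by blast
  then have "of_int m = (of_int (int n) :: complex)" by simp
  then show ?thesis by (simp only: of_int_eq_iff)
qed

text \<open>Exchanging a and b replaces tau by 1 / tau, which preserves c and the weights; it turns
  moves in one direction of the Kac table into moves in the other.\<close>

lemma kac_singular_swap: "kac_singular a b x m \<longleftrightarrow> kac_singular b a x m"
proof -
  have "c_pq a b = c_pq b a" by (simp add: c_pq_def power2_commute mult.commute)
  then show ?thesis unfolding kac_singular_def power2_commute[of a b] by (simp add: mult_ac)
qed

lemma kac_singular_minus: "kac_singular a b (- x) m \<longleftrightarrow> kac_singular a b x m"
  by (simp add: kac_singular_def)

text \<open>\<open>singular_transfer\<close> with denominators cleared. The cases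
  \<open>even\<close> and \<open>odd\<close> name the component that carries the leading
  coefficient.\<close>

lemma kac_singular_step:
  assumes a: "a > 0" and b: "b > 0" and V: "kac_singular a b x m"
    and n1: "\<And>n. n \<ge> 1 \<Longrightarrow> n * b + x \<noteq> 0" and n2: "\<And>n. n \<ge> 0 \<Longrightarrow> x + a + b + 2 * n * b \<noteq> 0"
    and n3: "\<And>n. n \<ge> 0 \<Longrightarrow> x + b + 2 * n * b \<noteq> 0"
  obtains (even) p where "p * (p * b + x) = a * m" "kac_singular a b (x + 2 * a) (m + 2 * p)"
    | (odd) p where "x + a + b + 2 * p * b = 0" "kac_singular a b (x + 2 * a) (m + 2 * p + 1)"
proof -
  define A B X :: complex where AB: "A = of_int a" "B = of_int b" "X = of_int x"
  have A0: "A \<noteq> 0" and B0: "B \<noteq> 0" using a b by (simp_all add: AB)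
  have kw: "kac_weight (A / B) ((of_int y) / B) = of_int (y\<^sup>2 - (a - b)\<^sup>2) / of_int (8 * a * b)" for y
    using A0 B0 unfolding kac_weight_def of_int_mult of_int_diff of_int_power of_int_numeral AB[symmetric]
    by (simp add: field_simps power2_eq_square)
  have c: "c_pq a b = 3 / 2 * (5 - 2 * (A / B) - 2 / (A / B))"
    using A0 B0 unfolding c_pq_def AB[symmetric] by (simp add: field_simps power2_eq_square)
  interpret verma_fusion "c_pq a b" "A / B" "X / B"
  proof unfold_locales
    show "A / B \<noteq> 0" using A0 B0 by simp
    show "of_nat n + X / B \<noteq> 0" if "n \<ge> 1" for n :: nat
    proof
      assume "of_nat n + X / B = 0"
      then have "of_int (int n * b + x) = (0 :: complex)" using B0 by (simp add: AB field_simps)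
      then show False using n1[of "int n"] that by (simp only: of_int_eq_0_iff)
    qed
    show "X / B + A / B + 1 + 2 * of_nat n \<noteq> 0" for n :: nat
    proof
      assume "X / B + A / B + 1 + 2 * of_nat n = 0"
      then have "of_int (x + a + b + 2 * int n * b) = (0 :: complex)" using B0 by (simp add: AB field_simps)
      then show False using n2[of "int n"] by (simp only: of_int_eq_0_iff)
    qed
    show "X / B + 1 + 2 * of_nat n \<noteq> 0" for n :: nat
    proof
      assume "X / B + 1 + 2 * of_nat n = 0"
      then have "of_int (x + b + 2 * int n * b) = (0 :: complex)" using B0 by (simp add: AB field_simps)
      then show False using n3[of "int n"] by (simp only: of_int_eq_0_iff)
    qed
  qed (fact c)
  have "X / B + 2 * (A / B) = of_int (x + 2 * a) / B" using B0 by (simp add: AB field_simps)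
  then have T: "kac_weight (A / B) (X / B + 2 * (A / B)) = of_int ((x + 2 * a)\<^sup>2 - (a - b)\<^sup>2) / of_int (8 * a * b)"
    by (simp only: kw)
  have "verma_singular (c_pq a b) (kac_weight (A / B) (X / B)) (of_int m / 2)"
    using V unfolding kac_singular_def kw[symmetric] AB(3) .
  from singular_transfer[OF this] show thesis unfolding T
  proof (elim disjE exE conjE)
    fix p :: int
    assume 1: "of_int p * (of_int p + X / B) = 2 * (A / B) * (of_int m / 2)"
    assume 2: "verma_singular (c_pq a b) (of_int ((x + 2 * a)\<^sup>2 - (a - b)\<^sup>2) / of_int (8 * a * b)) (of_int m / 2 + of_int p)"
    have "of_int (p * (p * b + x)) = (of_int (a * m) :: complex)"
      using 1 B0 by (simp add: AB field_simps)
    then have "p * (p * b + x) = a * m" by (simp only: of_int_eq_iff)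
    moreover have e: "(of_int (m + 2 * p) / 2 :: complex) = of_int m / 2 + of_int p" by (simp add: field_simps)
    have "kac_singular a b (x + 2 * a) (m + 2 * p)" unfolding kac_singular_def e by (rule 2)
    ultimately show thesis by (rule even)
  next
    fix p :: int
    assume 1: "X / B + A / B + 1 + 2 * of_int p = 0"
    assume 2: "verma_singular (c_pq a b) (of_int ((x + 2 * a)\<^sup>2 - (a - b)\<^sup>2) / of_int (8 * a * b)) (of_int m / 2 + of_int p + 1 / 2)"
    have "of_int (x + a + b + 2 * p * b) = (0 :: complex)"
      using 1 B0 by (simp add: AB field_simps)
    then have "x + a + b + 2 * p * b = 0" by (simp only: of_int_eq_0_iff)
    moreover have e: "(of_int (m + 2 * p + 1) / 2 :: complex) = of_int m / 2 + of_int p + 1 / 2" by (simp add: field_simps)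
    have "kac_singular a b (x + 2 * a) (m + 2 * p + 1)" unfolding kac_singular_def e by (rule 2)
    ultimately show thesis by (rule odd)
  qed
qed

text \<open>For level r s / 2 the quadratic equation factors as (p - r) (p b + s a) = 0, and the
  second factor is excluded because b does not divide s a. The last hypothesis excludes both a
  resonance and a leading odd component.\<close>

lemma kac_step:
  assumes a: "a > 0" and b: "b > 0" and V: "kac_singular a b (s * a - r * b) (r * s)"
    and 1: "\<not> b dvd s * a" and 2: "\<And>k. (s + 1) * a \<noteq> (r - 1 - 2 * k) * b"
  shows "kac_singular a b ((s + 2) * a - r * b) (r * (s + 2))"
proof -
  have d: "s * a \<noteq> k * b" for k using 1 by (metis dvd_triv_right)
  from a b V show ?thesis
  proof (rule kac_singular_step)
    show "n * b + (s * a - r * b) \<noteq> 0" for n using d[of "r - n"] by (simp add: algebra_simps)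
    show "s * a - r * b + a + b + 2 * n * b \<noteq> 0" for n using 2[of n] by (simp add: algebra_simps)
    show "s * a - r * b + b + 2 * n * b \<noteq> 0" for n using d[of "r - 1 - 2 * n"] by (simp add: algebra_simps)
    fix p assume p: "p * (p * b + (s * a - r * b)) = a * (r * s)" "kac_singular a b (s * a - r * b + 2 * a) (r * s + 2 * p)"
    have "(p - r) * (p * b + s * a) = 0" using p(1) by algebra
    moreover have "p * b + s * a \<noteq> 0" using d[of "- p"] by simp
    ultimately have "p = r" by simp
    moreover have "s * a - r * b + 2 * a = (s + 2) * a - r * b" "r * s + 2 * r = r * (s + 2)" by (simp_all add: algebra_simps)
    ultimately show ?thesis using p(2) by (simp only:)
  next
    fix p assume "s * a - r * b + a + b + 2 * p * b = 0"
    then show ?thesis using 2[of p] by (simp add: algebra_simps)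
  qed
qed

lemma kac_chain:
  assumes "\<And>s. s0 \<le> s \<Longrightarrow> s < s0 + 2 * int k \<Longrightarrow> even (s - s0) \<Longrightarrow> kac_singular a b (s * a - r * b) (r * s)
      \<Longrightarrow> kac_singular a b ((s + 2) * a - r * b) (r * (s + 2))"
    and "kac_singular a b (s0 * a - r * b) (r * s0)"
  shows "kac_singular a b ((s0 + 2 * int k) * a - r * b) (r * (s0 + 2 * int k))"
  using assms
proof (induct k)
  case (Suc k)
  have e: "s0 + 2 * int (Suc k) = s0 + 2 * int k + 2" by simp
  show ?case unfolding e
    by (rule Suc.prems(1)) (use Suc in auto)
qed simp

lemma kac_singular_11:
  assumes "a > 0" "b > 0"
  shows "kac_singular a b (a - b) 1"
proof -
  interpret pbw "c_pq a b" 0 0 by (rule verma)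
  let ?e = "ev [] :: wvec"
  have e: "?e \<in> carrier" by simp
  have z: "J 1 ?e = 0" "J 2 ?e = 0" "J 3 ?e = 0" "J 0 ?e = 0" using J_empty[of 1] J_empty[of 2] J_empty[of 3] J_empty[of 0] by simp_all
  have v: "J (-1) ?e = ev [-1]" by (rule J_in_order) simp
  have "J 1 (J (-1) ?e) = 0" using GG[OF e, of 0 "-1"] z by simp
  moreover have "J 3 (J (-1) ?e) = 0" using GG[OF e, of 1 "-1"] z by simp
  ultimately have "J k (J (-1) ?e) = 0" if "k > 0" for k
    using positive_modes_vanish[OF J_closed[OF e]] that by blast
  moreover have "J 0 (J (-1) ?e) = scv (0 + 1 / 2) (J (-1) ?e)"
    unfolding v by (subst J0_ev) (simp_all add: wt_def)
  ultimately have "singular (1 / 2) (J (-1) ?e)" unfolding singular_def v by simp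
  then show ?thesis unfolding kac_singular_def verma_singular_def by auto
qed

lemma kac_singular_22:
  assumes "a > 0" "b > 0"
  shows "kac_singular a b (2 * a - 2 * b) 4"
proof -
  define h :: complex where "h = of_int ((2 * a - 2 * b)\<^sup>2 - (a - b)\<^sup>2) / of_int (8 * a * b)"
  interpret pbw "c_pq a b" h 0 by (rule verma)
  have ch: "2 * c_pq a b = 3 - 16 * h"
    using assms unfolding h_def c_pq_def by (simp add: field_simps power2_eq_square)
  let ?e = "ev [] :: wvec"
  have e: "?e \<in> carrier" by simp
  have z: "G 0 ?e = 0" "G 1 ?e = 0" "L 1 ?e = 0" "L 0 ?e = scv h ?e" using J_empty[of 1] J_empty[of 2] J_empty[of 3] J_empty[of 0] by simp_all
  have v: "L (-1) (L (-1) ?e) = ev [-2, -2]" "L (-2) ?e = ev [-4]" "G (-2) (G (-1) ?e) = ev [-3, -1]" "G (-1) ?e = ev [-1]"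
    using J_in_order[of "-2" "[]"] J_in_order[of "-4" "[]"] J_in_order[of "-1" "[]"] J_in_order[of "-2" "[-2]"] J_in_order[of "-3" "[-1]"]
    by simp_all
  \<comment> \<open>Up to scale, these coefficients are forced at level 2 by G_{1/2}; G_{3/2} then
    kills w because 2 c = 3 - 16 h for this label.\<close>
  define w where "w = L (-1) (L (-1) ?e) - scv (4 * h / 3) (L (-2) ?e) - G (-2) (G (-1) ?e)"
  have c: "L k ?e \<in> carrier" "G k ?e \<in> carrier" for k using e by (simp_all add: J_closed)
  have 1: "G 0 (L (-1) (L (-1) ?e)) = scv 2 (L (-1) (G (-1) ?e))"
    using GL[OF c(1), of 0 "-1" "-1"] GL[OF e, of 0 "-1"] GL[OF e, of "-1" "-1"] z
    by (simp add: wv.scale_left_distrib[of 1 1, simplified])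
  have 2: "G 0 (L (-2) ?e) = scv (3 / 2) (G (-2) ?e)" using GL[OF e, of 0 "-2"] z by simp
  have 3: "G 0 (G (-1) ?e) = scv (2 * h) ?e" using GG[OF e, of 0 "-1"] z by simp
  have 4: "G 0 (G (-2) (G (-1) ?e)) = - scv (2 * h) (G (-2) ?e) + scv 2 (L (-1) (G (-1) ?e))"
    using GG[OF c(2)[of "-1"], of 0 "-2"] unfolding 3 by (simp add: J_scale)
  have 5: "G 1 (L (-1) (L (-1) ?e)) = scv 2 (G (-1) ?e)"
    using GL[OF c(1), of 1 "-1" "-1"] GL[OF e, of 1 "-1"] GL[OF e, of 0 "-1"] z by (simp add: J_scale)
  have 6: "G 1 (L (-2) ?e) = scv (5 / 2) (G (-1) ?e)" using GL[OF e, of 1 "-2"] z by simp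
  have 7: "G 1 (G (-1) ?e) = 0" using GG[OF e, of 1 "-1"] z by simp
  have 8: "L 0 (G (-1) ?e) = scv (h + 1 / 2) (G (-1) ?e)" unfolding v(4) using J0_ev[of "[-1]"] by (simp add: wt_def)
  have 9: "G 1 (G (-2) (G (-1) ?e)) = scv (2 * h + 1 + 2 * c_pq a b / 3) (G (-1) ?e)"
    using GG[OF c(2)[of "-1"], of 1 "-2"] 8 unfolding 7 by (simp add: wv.scale_left_distrib wv.scale_right_distrib mult.commute)
  have w: "w \<in> carrier" unfolding w_def
    by (intro wv.subspace_diff[OF S_subspace] wv.subspace_scale[OF S_subspace] J_closed e)
  have "G 0 w = 0" unfolding w_def J_diff J_scale 1 2 4 by simp
  moreover have "G 1 w = 0"
  proof -
    have "G 1 w = scv (2 - (4 * h / 3) * (5 / 2) - (2 * h + 1 + 2 * c_pq a b / 3)) (G (-1) ?e)"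
      unfolding w_def J_diff J_scale 5 6 9 by (simp only: wv.scale_left_diff_distrib wv.scale_scale)
    also have "2 - (4 * h / 3) * (5 / 2) - (2 * h + 1 + 2 * c_pq a b / 3) = 0" unfolding ch by (simp add: field_simps)
    finally show ?thesis by simp
  qed
  ultimately have "J k w = 0" if "k > 0" for k using positive_modes_vanish[OF w] that by simp
  moreover have "J 0 w = scv (h + 2) w"
    unfolding w_def J_diff J_scale v(1-3) using J0_ev[of "[-2,-2]"] J0_ev[of "[-4]"] J0_ev[of "[-3,-1]"]
    by (simp add: wt_def wv.scale_right_diff_distrib mult.commute)
  moreover have "w \<noteq> 0"
  proof
    assume "w = 0"
    moreover have "Poly_Mapping.lookup w [-2, -2] = 1" unfolding w_def v(1-3) by (simp add: lookup_minus lookup_ev)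
    ultimately show False by simp
  qed
  ultimately have "singular 2 w" unfolding singular_def using w by simp
  then show ?thesis unfolding kac_singular_def verma_singular_def h_def by auto
qed

text \<open>These labels and levels arise from label a b - b by choosing the root -a. From there on
  no step is resonant and -a remains the only possible root, so twice the level drops by 2 a each
  time and becomes negative.\<close>

lemma kac_singular_resonance:
  fixes a b :: int
  assumes a: "a \<ge> 2" and b: "odd b" "b > 0" and co: "coprime a b" and j: "j \<ge> 0"
  shows "\<not> kac_singular a b (a * b - b + 2 * (j + 1) * a) (b - 2 * (j + 1) * a)"
proof
  assume V: "kac_singular a b (a * b - b + 2 * (j + 1) * a) (b - 2 * (j + 1) * a)"
  have "kac_singular a b (a * b - b + 2 * (j + int k + 1) * a) (b - 2 * (j + int k + 1) * a)" for k
  proof (induct k)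
    case (Suc k)
    define i where "i = j + int k + 1"
    have i: "i \<ge> 1" using j by (simp add: i_def)
    have V: "kac_singular a b (a * b - b + 2 * i * a) (b - 2 * i * a)" using Suc by (simp add: i_def)
    have le: "2 * i * a \<le> b" using kac_singular_nonneg[OF V] by simp
    have ia: "2 * i * 2 \<le> 2 * i * a" using a i by (intro mult_left_mono) auto
    have x: "a * b - b + 2 * i * a > 0"
    proof -
      have "(a - 1) * b > 0" "2 * i * a \<ge> 0" using a b i by simp_all
      moreover have "(a - 1) * b = a * b - b" by algebra
      ultimately show ?thesis by linarith
    qed
    have nd: "\<not> b dvd i" "\<not> b dvd 2 * i + 1" using zdvd_imp_le[of b i] zdvd_imp_le[of b "2 * i + 1"] i ia le by auto
    have "kac_singular a b (a * b - b + 2 * (i + 1) * a) (b - 2 * (i + 1) * a)"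
      using _ b(2) V
    proof (rule kac_singular_step)
      show "a > 0" using a by simp
      show "n * b + (a * b - b + 2 * i * a) \<noteq> 0" if "n \<ge> 1" for n
        using x b that mult_pos_pos[of n b] by linarith
      show "a * b - b + 2 * i * a + a + b + 2 * n * b \<noteq> 0" if "n \<ge> 0" for n
        using x a b that mult_nonneg_nonneg[of "2 * n" b] by linarith
      show "a * b - b + 2 * i * a + b + 2 * n * b \<noteq> 0" if "n \<ge> 0" for n
        using x b that mult_nonneg_nonneg[of "2 * n" b] by linarith
      fix p assume p: "p * (p * b + (a * b - b + 2 * i * a)) = a * (b - 2 * i * a)"
        "kac_singular a b (a * b - b + 2 * i * a + 2 * a) (b - 2 * i * a + 2 * p)"
      have "(p + a) * (p * b - b + 2 * i * a) = 0" using p(1) by algebra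
      moreover have "p * b - b + 2 * i * a \<noteq> 0"
      proof
        assume "p * b - b + 2 * i * a = 0"
        then have "(2 * i) * a = (1 - p) * b" by algebra
        then have "b dvd (2 * i) * a" by simp
        then have "b dvd 2 * i" using co coprime_dvd_mult_left_iff[of b a "2 * i"] by (simp add: coprime_commute)
        then have "b dvd i" using b coprime_dvd_mult_right_iff[of b 2 i] by (simp add: coprime_right_2_iff_odd)
        then show False using nd by simp
      qed
      ultimately have "p = - a" by (simp add: add_eq_0_iff)
      moreover have "a * b - b + 2 * i * a + 2 * a = a * b - b + 2 * (i + 1) * a" "b - 2 * i * a + 2 * (- a) = b - 2 * (i + 1) * a"
        by (simp_all add: algebra_simps)
      ultimately show ?thesis using p(2) by (simp only:)
    next
      fix p assume p: "a * b - b + 2 * i * a + a + b + 2 * p * b = 0"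
      then have "(2 * i + 1) * a = (- a - 2 * p) * b" by algebra
      then have "b dvd (2 * i + 1) * a" by simp
      then have "b dvd 2 * i + 1" using co coprime_dvd_mult_left_iff[of b a "2 * i + 1"] by (simp add: coprime_commute)
      then show ?thesis using nd by simp
    qed
    moreover have "i + 1 = j + int (Suc k) + 1" by (simp add: i_def)
    ultimately show ?case by (simp only:)
  qed (use V in simp)
  from kac_singular_nonneg[OF this[of "nat b"]] have "2 * (j + b + 1) * a \<le> b" using b by simp
  moreover have "2 * (j + b + 1) * 2 \<le> 2 * (j + b + 1) * a" using a b j by (intro mult_left_mono) auto
  ultimately have "2 * (j + b + 1) * 2 \<le> b" by (rule order_trans[rotated])
  then show False using b j by presburger
qed

text \<open>From (2, 2) the steps run through even labels up to b - 1, which is even since b is odd.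
  All multipliers of a stay below b, so coprimality excludes every resonance. This is done for one
  direction and then, after a swap, for the other.\<close>

lemma kac_singular_vacuum_odd:
  assumes p: "p \<ge> 2" "odd p" and q: "q \<ge> 2" "odd q" and co: "coprime p q"
  shows "kac_singular p q (p - q) ((p - 1) * (q - 1))"
proof -
  have step: "kac_singular a b ((b - 1) * a - r * b) (r * (b - 1))"
    if "kac_singular a b (2 * a - r * b) (r * 2)" "a \<ge> 2" "b \<ge> 2" "odd b" "coprime a b" for a b r :: int
  proof -
    obtain t where t: "b = 2 * t + 1" using \<open>odd b\<close> by (rule oddE)
    define k where "k = nat (t - 1)"
    have k: "b - 1 = 2 + 2 * int k" using t \<open>b \<ge> 2\<close> by (simp add: k_def)
    show ?thesis unfolding k
    proof (rule kac_chain)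
      show "kac_singular a b (2 * a - r * b) (r * 2)" by fact
      fix s assume s: "2 \<le> s" "s < 2 + 2 * int k" "even (s - 2)" and V: "kac_singular a b (s * a - r * b) (r * s)"
      have nd: "\<not> b dvd t * a" if "0 < t" "t < b" for t
        using that \<open>coprime a b\<close> coprime_dvd_mult_left_iff[of b a t] zdvd_imp_le[of b t] by (auto simp: coprime_commute)
      show "kac_singular a b ((s + 2) * a - r * b) (r * (s + 2))"
      proof (rule kac_step[OF _ _ V])
        show "\<not> b dvd s * a" using nd s k by simp
        show "(s + 1) * a \<noteq> (r - 1 - 2 * i) * b" for i using nd[of "s + 1"] s k by (metis add_less_cancel_right diff_add_cancel dvd_triv_right less_trans zless_add1_eq add.commute add_strict_increasing zero_less_one less_le_trans zero_less_numeral)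
      qed (use that in simp_all)
    qed
  qed
  have "kac_singular q p (2 * q - 2 * p) (2 * 2)" using kac_singular_22[of q p] p q by simp
  from step[OF this] have "kac_singular q p ((p - 1) * q - 2 * p) (2 * (p - 1))" using p q co by (simp add: coprime_commute)
  then have "kac_singular p q (2 * p - (p - 1) * q) ((p - 1) * 2)"
    using kac_singular_swap kac_singular_minus[of p q "2 * p - (p - 1) * q"] by (simp add: mult.commute)
  from step[OF this] have "kac_singular p q ((q - 1) * p - (p - 1) * q) ((p - 1) * (q - 1))" using p q co by simp
  moreover have "(q - 1) * p - (p - 1) * q = - (p - q)" by (simp add: algebra_simps)
  ultimately show ?thesis using kac_singular_minus by metis
qed

text \<open>From (1, 1) the steps run through odd labels up to 2 a - 1 and then up to 2 b - 1. In
  the first direction r = a is the only label that a divides, and this step is treated separately;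
  in the second b is even and never divides an odd label times a.\<close>

lemma kac_singular_vacuum_even:
  fixes a b :: int
  assumes a: "a \<ge> 1" "odd a" and b: "b \<ge> 2" "even b" and co: "coprime a b"
  shows "kac_singular a b (a - b) ((2 * a - 1) * (2 * b - 1))"
proof -
  have "kac_singular b a ((1 + 2 * int (nat (a - 1))) * b - 1 * a) (1 * (1 + 2 * int (nat (a - 1))))"
  proof (rule kac_chain)
    show "kac_singular b a (1 * b - 1 * a) (1 * 1)" using kac_singular_11[of b a] a b by simp
    fix r assume r: "1 \<le> r" "r < 1 + 2 * int (nat (a - 1))" "even (r - 1)" and V: "kac_singular b a (r * b - 1 * a) (1 * r)"
    have r2: "r < 2 * a - 1" using r a by simp
    have nd: "\<not> a dvd t * b" if "0 < t" "t < 2 * a" "t \<noteq> a" for t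
    proof
      assume "a dvd t * b"
      then have "a dvd t" using co coprime_dvd_mult_left_iff[of a b t] by simp
      then obtain i where i: "t = a * i" by blast
      then have "0 < i" "i < 2" using that a by (simp_all add: zero_less_mult_iff mult.commute[of _ a] mult_less_cancel_left)
      then show False using i that by (cases "i = 1") auto
    qed
    have "r + 1 \<noteq> a" using r a by auto
    then have nd1: "\<not> a dvd (r + 1) * b" using nd[of "r + 1"] r r2 by simp
    show "kac_singular b a ((r + 2) * b - 1 * a) (1 * (r + 2))"
    proof (cases "r = a")
      case False
      show ?thesis
      proof (rule kac_step[OF _ _ V])
        show "\<not> a dvd r * b" using nd[of r] r r2 False by simp
        show "(r + 1) * b \<noteq> (1 - 1 - 2 * i) * a" for i using nd1 by (metis dvd_triv_right)
      qed (use a b in simp_all)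
    next
      \<comment> \<open>The quadratic equation has the two integral roots 1 and -b; the second would
        start a chain that \<open>kac_singular_resonance\<close> excludes.\<close>
      case True
      have x: "a * b - 1 * a > 0" using mult_strict_left_mono[of 1 b a] a b by simp
      have "b > 0" "a > 0" using a b by simp_all
      moreover have "kac_singular b a (a * b - 1 * a) (1 * a)" using V True by simp
      ultimately have "kac_singular b a ((a + 2) * b - 1 * a) (1 * (a + 2))"
      proof (rule kac_singular_step)
        show "n * a + (a * b - 1 * a) \<noteq> 0" if "n \<ge> 1" for n
          using x a that mult_pos_pos[of n a] by linarith
        show "a * b - 1 * a + b + a + 2 * n * a \<noteq> 0" if "n \<ge> 0" for n
          using x a b that mult_nonneg_nonneg[of "2 * n" a] by linarith
        show "a * b - 1 * a + a + 2 * n * a \<noteq> 0" if "n \<ge> 0" for n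
          using x a that mult_nonneg_nonneg[of "2 * n" a] by linarith
        fix p assume p: "p * (p * a + (a * b - 1 * a)) = b * (1 * a)"
          "kac_singular b a (a * b - 1 * a + 2 * b) (1 * a + 2 * p)"
        have "a * ((p - 1) * (p + b)) = 0" using p(1) by algebra
        then have "p = 1 \<or> p = - b" using a by auto
        moreover have "p \<noteq> - b"
        proof
          assume "p = - b"
          then have "kac_singular b a (b * a - a + 2 * (0 + 1) * b) (a - 2 * (0 + 1) * b)" using p(2) by (simp add: mult.commute)
          then show False using kac_singular_resonance[of b a 0] a b co by (simp add: coprime_commute)
        qed
        ultimately have "p = 1" by simp
        moreover have "a * b - 1 * a + 2 * b = (a + 2) * b - 1 * a" "1 * a + 2 * 1 = 1 * (a + 2)" by (simp_all add: algebra_simps)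
        ultimately show "kac_singular b a ((a + 2) * b - 1 * a) (1 * (a + 2))" using p(2) by (simp only:)
      next
        fix p assume "a * b - 1 * a + b + a + 2 * p * a = 0"
        then have "(a + 1) * b = (- 2 * p) * a" by algebra
        then show "kac_singular b a ((a + 2) * b - 1 * a) (1 * (a + 2))" using nd1 True by (metis dvd_triv_right)
      qed
      then show ?thesis using True by simp
    qed
  qed
  then have "kac_singular b a ((2 * a - 1) * b - a) (2 * a - 1)" using a by simp
  then have 1: "kac_singular a b (1 * a - (2 * a - 1) * b) ((2 * a - 1) * 1)"
    using kac_singular_swap kac_singular_minus[of a b "1 * a - (2 * a - 1) * b"] by simp
  have "kac_singular a b ((1 + 2 * int (nat (b - 1))) * a - (2 * a - 1) * b) ((2 * a - 1) * (1 + 2 * int (nat (b - 1))))"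
  proof (rule kac_chain[OF _ 1])
    fix s assume s: "1 \<le> s" "s < 1 + 2 * int (nat (b - 1))" "even (s - 1)"
      and V: "kac_singular a b (s * a - (2 * a - 1) * b) ((2 * a - 1) * s)"
    have s2: "s < 2 * b - 1" and so: "odd s" using s b by auto
    show "kac_singular a b ((s + 2) * a - (2 * a - 1) * b) ((2 * a - 1) * (s + 2))"
    proof (rule kac_step[OF _ _ V])
      show "\<not> b dvd s * a" using so a b by (meson dvd_trans even_mult_iff)
      \<comment> \<open>Here b can divide s + 1, namely if s + 1 = b; but then the odd number a
        would equal an even cofactor.\<close>
      show "(s + 1) * a \<noteq> (2 * a - 1 - 1 - 2 * i) * b" for i
      proof
        assume e: "(s + 1) * a = (2 * a - 1 - 1 - 2 * i) * b"
        then have "b dvd (s + 1) * a" by simp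
        then have "b dvd s + 1" using co coprime_dvd_mult_left_iff[of b a "s + 1"] by (simp add: coprime_commute)
        then obtain j where j: "s + 1 = b * j" by blast
        with s s2 have bj: "0 < b * j" "b * j < b * 2" by linarith+
        have "b > 0" using b by simp
        then have "0 < j" "j < 2" using bj by (simp_all only: mult_less_cancel_left_pos zero_less_mult_pos)
        then have "j = 1" by simp
        then have "b * a = b * (2 * a - 1 - 1 - 2 * i)" using e j by (simp add: mult.commute)
        then have "a = 2 * a - 1 - 1 - 2 * i" using b by simp
        then show False using a by presburger
      qed
    qed (use a b in simp_all)
  qed
  then have "kac_singular a b ((2 * b - 1) * a - (2 * a - 1) * b) ((2 * a - 1) * (2 * b - 1))" using b by simp
  moreover have "(2 * b - 1) * a - (2 * a - 1) * b = - (a - b)" by (simp add: algebra_simps)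
  ultimately show ?thesis using kac_singular_minus by metis
qed

text \<open>a + b is the label of weight 1/2; e is 1 for odd p, q and 2 for even ones. At each step
  parity or size forces the root -e a, so m drops by 2 e a until it is negative. A leading odd
  component is possible only for e = 2 and i = b - 1, where the level is negative at once.\<close>

lemma kac_singular_not_descendant:
  fixes a b e :: int
  assumes a: "a \<ge> 1" and b: "b \<ge> 2" and e: "e = 1 \<or> (e = 2 \<and> even b)" and co: "coprime a b"
  shows "\<not> kac_singular a b (a + b) ((e * a - 1) * (e * b - 1) - 1)"
proof
  assume V: "kac_singular a b (a + b) ((e * a - 1) * (e * b - 1) - 1)"
  define m where "m k = e * a * (e * b) - e * b - (2 * k + 1) * (e * a)" for k :: int
  have e0: "e > 0" using e by auto
  have "kac_singular a b (b + (2 * int k + 1) * a) (m (int k))" for k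
  proof (induct k)
    case 0
    have "(e * a - 1) * (e * b - 1) - 1 = m 0" "a + b = b + (2 * 0 + 1) * a" unfolding m_def by (simp_all add: algebra_simps)
    then show ?case using V by (simp add: add.commute)
  next
    case (Suc k)
    define i where "i = int k"
    have i: "i \<ge> 0" by (simp add: i_def)
    have V: "kac_singular a b (b + (2 * i + 1) * a) (m i)" using Suc by (simp add: i_def)
    have ea: "e * a > 0" using e0 a by simp
    have m0: "m i \<ge> 0" using kac_singular_nonneg[OF V] .
    have "(2 * i + 1) * (e * a) < e * b * (e * a)"
    proof -
      have "e * b > 0" using e0 b by simp
      then have "(2 * i + 1) * (e * a) < e * a * (e * b)" using m0 unfolding m_def by linarith
      then show ?thesis by (simp only: mult.commute[of "e * b"])
    qed
    then have lt: "2 * i + 1 < e * b" using ea by (simp add: mult_less_cancel_right)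
    have x: "b + (2 * i + 1) * a > 0" using a b i by (simp add: add_pos_nonneg)
    have "kac_singular a b (b + (2 * (i + 1) + 1) * a) (m (i + 1))"
      using _ _ V
    proof (rule kac_singular_step)
      show "a > 0" "b > 0" using a b by simp_all
      show "n * b + (b + (2 * i + 1) * a) \<noteq> 0" if "n \<ge> 1" for n
        using x b that mult_pos_pos[of n b] by linarith
      show "b + (2 * i + 1) * a + a + b + 2 * n * b \<noteq> 0" if "n \<ge> 0" for n
        using x a b that mult_nonneg_nonneg[of "2 * n" b] by linarith
      show "b + (2 * i + 1) * a + b + 2 * n * b \<noteq> 0" if "n \<ge> 0" for n
        using x b that mult_nonneg_nonneg[of "2 * n" b] by linarith
      fix p assume p: "p * (p * b + (b + (2 * i + 1) * a)) = a * m i"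
        "kac_singular a b (b + (2 * i + 1) * a + 2 * a) (m i + 2 * p)"
      have "(p + e * a) * (p * b + (b + (2 * i + 1) * a) - e * a * b) = 0" using p(1) unfolding m_def by algebra
      moreover have "p * b + (b + (2 * i + 1) * a) - e * a * b \<noteq> 0"
      proof
        assume "p * b + (b + (2 * i + 1) * a) - e * a * b = 0"
        then have "(2 * i + 1) * a = (e * a - 1 - p) * b" by algebra
        then have "b dvd (2 * i + 1) * a" by simp
        then have d: "b dvd 2 * i + 1" using co coprime_dvd_mult_left_iff[of b a "2 * i + 1"] by (simp add: coprime_commute)
        show False
        proof (cases "e = 1")
          case True
          then show False using zdvd_imp_le[OF d] lt i by simp
        next
          case False
          then have "even b" using e by auto
          then have "even (2 * i + 1)" using d dvd_trans by blast
          then show False by simp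
        qed
      qed
      ultimately have "p = - (e * a)" by (simp add: add_eq_0_iff2)
      moreover have "b + (2 * i + 1) * a + 2 * a = b + (2 * (i + 1) + 1) * a" "m i + 2 * (- (e * a)) = m (i + 1)"
        unfolding m_def by (simp_all add: algebra_simps)
      ultimately show ?thesis using p(2) by (simp only:)
    next
      fix p assume p: "b + (2 * i + 1) * a + a + b + 2 * p * b = 0" "kac_singular a b (b + (2 * i + 1) * a + 2 * a) (m i + 2 * p + 1)"
      have ip: "(i + 1) * a = (- 1 - p) * b" using p(1) by algebra
      then have "b dvd (i + 1) * a" by simp
      then have "b dvd i + 1" using co coprime_dvd_mult_left_iff[of b a "i + 1"] by (simp add: coprime_commute)
      then have le: "b \<le> i + 1" using zdvd_imp_le i by simp
      then have e2: "e = 2" using lt e i by auto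
      have i1: "i + 1 = b" using lt le e2 by simp
      then have "b * a = b * (- 1 - p)" using ip by (simp add: mult.commute)
      then have pa: "p = - 1 - a" using b by simp
      have ib: "i = b - 1" using i1 by simp
      have "m i + 2 * p + 1 = - 2 * b - 1" unfolding m_def pa ib e2 by (simp add: algebra_simps)
      then have False using kac_singular_nonneg[OF p(2)] b by simp
      then show ?thesis ..
    qed
    moreover have "i + 1 = int (Suc k)" by (simp add: i_def)
    ultimately show ?case by (simp only:)
  qed
  from kac_singular_nonneg[OF this[of "nat (e * b)"]] have "0 \<le> e * a * (e * b) - e * b - (2 * (e * b) + 1) * (e * a)"
    using e0 b by (simp add: m_def)
  moreover have "e * a * (e * b) - e * b - (2 * (e * b) + 1) * (e * a) = - (e * a * (e * b)) - e * b - e * a" by algebra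
  moreover have "e * a * (e * b) \<ge> 0" "e * b > 0" "e * a > 0" using e0 a b by simp_all
  ultimately show False by linarith
qed

text \<open>For even p and q one of their halves is even, and it may be taken to be that of q.\<close>

theorem vacuum_singular:
  assumes p: "p \<ge> 2" and q: "q \<ge> 2" and ev: "even (p - q)" and gcd: "gcd p ((p - q) div 2) = 1"
  shows "verma_singular (c_pq p q) 0 (of_int ((p - 1) * (q - 1)) / 2)"
    and "\<not> verma_singular (c_pq p q) (1 / 2) (of_int ((p - 1) * (q - 1) - 1) / 2)"
proof -
  have scaled: "c_pq (2 * a) (2 * b) = c_pq a b" for a b
    unfolding c_pq_def of_int_mult of_int_numeral right_diff_distrib[symmetric]
    by (simp add: power2_eq_square) (simp add: algebra_simps)
  have 0: "verma_singular (c_pq a b) 0 (of_int m / 2)" if "kac_singular a b (a - b) m" for a b m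
    using that by (simp add: kac_singular_def)
  have half: "kac_singular a b (a + b) m" if "verma_singular (c_pq a b) (1 / 2) (of_int m / 2)" "a > 0" "b > 0" for a b m
  proof -
    have "(a + b)\<^sup>2 - (a - b)\<^sup>2 = 4 * a * b" by (simp add: power2_eq_square algebra_simps)
    moreover have "of_int (4 * a * b) / of_int (8 * a * b) = (1 / 2 :: complex)" using that by simp
    ultimately show ?thesis using that(1) unfolding kac_singular_def by (simp only:)
  qed
  have "verma_singular (c_pq p q) 0 (of_int ((p - 1) * (q - 1)) / 2)
     \<and> \<not> verma_singular (c_pq p q) (1 / 2) (of_int ((p - 1) * (q - 1) - 1) / 2)"
  proof (cases "odd p")
    case True
    then have oq: "odd q" using ev by simp
    have co: "coprime p q"
    proof (rule coprimeI)
      fix d assume d: "d dvd p" "d dvd q"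
      then have "d dvd p - q" by simp
      moreover have "p - q = 2 * ((p - q) div 2)" using ev by simp
      ultimately have "d dvd 2 * ((p - q) div 2)" by metis
      moreover have "odd d" using d(1) True dvd_trans by blast
      ultimately have "d dvd (p - q) div 2" using coprime_dvd_mult_right_iff[of d 2] by (simp add: coprime_right_2_iff_odd)
      then show "is_unit d" using d(1) gcd by (metis gcd_greatest)
    qed
    show ?thesis
      using 0[OF kac_singular_vacuum_odd[OF p True q oq co]] half[of p q] kac_singular_not_descendant[of p q 1] p q co by auto
  next
    case False
    define a b where "a = p div 2" and "b = q div 2"
    have ab: "p = 2 * a" "q = 2 * b" unfolding a_def b_def using ev False by presburger+
    have "(p - q) div 2 = a - b" unfolding ab by simp
    then have g: "gcd (2 * a) (a - b) = 1" using gcd by (simp only: ab)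
    have co: "coprime a b"
    proof (rule coprimeI)
      fix d assume d: "d dvd a" "d dvd b"
      then have "d dvd 2 * a" "d dvd a - b" by auto
      then show "is_unit d" using g by (metis gcd_greatest)
    qed
    have par: "odd (a - b)"
    proof
      assume "even (a - b)"
      then have "2 dvd gcd (2 * a) (a - b)" by simp
      then show False using g by simp
    qed
    have main: "verma_singular (c_pq a b) 0 (of_int ((2 * a - 1) * (2 * b - 1)) / 2)
        \<and> \<not> verma_singular (c_pq a b) (1 / 2) (of_int ((2 * a - 1) * (2 * b - 1) - 1) / 2)"
      if "a \<ge> 1" "b \<ge> 1" "odd a" "even b" "coprime a b" for a b :: int
    proof -
      have b: "b \<ge> 2" using that by presburger
      show ?thesis
        using 0[OF kac_singular_vacuum_even[OF that(1,3) b that(4,5)]] half[of a b] kac_singular_not_descendant[of a b 2] b that by auto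
    qed
    have c: "c_pq b a = c_pq a b" by (simp add: c_pq_def power2_commute mult.commute)
    have m: "(2 * b - 1) * (2 * a - 1) = (2 * a - 1) * (2 * b - 1)" by (rule mult.commute)
    have ge: "a \<ge> 1" "b \<ge> 1" using p q ab by simp_all
    show ?thesis unfolding ab scaled
    proof (cases "odd a")
      case True
      then have "even b" using par by simp
      with main[OF ge True _ co] show "verma_singular (c_pq a b) 0 (of_int ((2 * a - 1) * (2 * b - 1)) / 2)
        \<and> \<not> verma_singular (c_pq a b) (1 / 2) (of_int ((2 * a - 1) * (2 * b - 1) - 1) / 2)" by blast
    next
      case False
      then have ob: "odd b" "even a" using par by simp_all
      have "coprime b a" using co by (simp add: coprime_commute)
      from main[OF ge(2,1) ob this] show "verma_singular (c_pq a b) 0 (of_int ((2 * a - 1) * (2 * b - 1)) / 2)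
        \<and> \<not> verma_singular (c_pq a b) (1 / 2) (of_int ((2 * a - 1) * (2 * b - 1) - 1) / 2)"
        unfolding c m .
    qed
  qed
  then show "verma_singular (c_pq p q) 0 (of_int ((p - 1) * (q - 1)) / 2)"
    "\<not> verma_singular (c_pq p q) (1 / 2) (of_int ((p - 1) * (q - 1) - 1) / 2)" by auto
qed

section \<open>The simple quotient\<close>

lemma lookup_wlin_ev:
  assumes "inj_on t (insert U (Poly_Mapping.keys x))"
  shows "Poly_Mapping.lookup (wlin scv (\<lambda>W. ev (t W)) x) (t U) = Poly_Mapping.lookup x U"
proof -
  have "Poly_Mapping.lookup (wlin scv (\<lambda>W. ev (t W)) x) (t U)
      = (\<Sum>W\<in>Poly_Mapping.keys x. Poly_Mapping.lookup x W * (if t U = t W then 1 else 0))"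
    unfolding wlin_def by (simp add: lookup_sum lookup_ev)
  also have "\<dots> = (\<Sum>W\<in>Poly_Mapping.keys x. if W = U then Poly_Mapping.lookup x U else 0)"
    using assms by (intro sum.cong) (auto simp: inj_on_def)
  also have "\<dots> = Poly_Mapping.lookup x U"
    by (simp add: in_keys_iff)
  finally show ?thesis .
qed

lemma wlin_cong: "(\<And>W. W \<in> Poly_Mapping.keys v \<Longrightarrow> f W = g W) \<Longrightarrow> wlin sc f v = wlin sc g v"
  unfolding wlin_def by simp

lemma (in pbw) foldr_in_order: "valid (U @ V) \<Longrightarrow> foldr J U (ev V) = ev (U @ V)"
  by (induct U) (simp_all add: J_in_order)

lemma (in pbw) valid_snoc: "valid (U @ [x]) \<longleftrightarrow> x < th \<and> valid U \<and> (\<forall>y\<in>set U. y < x \<or> (y = x \<and> even x))"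
  by (induct U) auto

lemma (in pbw) valid_last:
  assumes "valid W" "x \<in> set W"
  shows "x \<le> last W"
  using assms
proof (induct W)
  case (Cons a W)
  show ?case
  proof (cases "W = []")
    case False
    then have "a < last W \<or> a = last W" using Cons.prems(1) last_in_set by auto
    then show ?thesis using Cons False by auto
  qed (use Cons in simp)
qed simp

text \<open>The singular vector of weight 1/2 generates the kernel of the projection onto the vacuum module; a singular vector in
  this kernel comes from the Verma module of weight 1/2.\<close>

locale vacuum_projection =
  fixes c :: complex
begin

sublocale M: pbw c 0 0 by (rule verma)
sublocale Q: pbw c 0 "-2" by unfold_locales simp
sublocale H: pbw c "1 / 2" 0 by (rule verma)

sublocale P: pbw_map c 0 0 scv Q.carrier Q.J "ev []"
  by unfold_locales (simp_all add: Q.J_empty)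

lemma g_half: "M.J (-1) (ev []) = ev [-1]"
  by (rule M.J_in_order) simp

sublocale I: pbw_map c "1 / 2" 0 scv M.carrier M.J "ev [-1]"
proof unfold_locales
  let ?e = "ev [] :: wvec"
  have e: "?e \<in> M.carrier" by simp
  have z: "M.J 1 ?e = 0" "M.J 2 ?e = 0" "M.J 3 ?e = 0" "M.J 0 ?e = 0"
    using M.J_empty[of 1] M.J_empty[of 2] M.J_empty[of 3] M.J_empty[of 0] by simp_all
  show v: "ev [-1] \<in> M.carrier" by simp
  have "M.J 1 (M.J (-1) ?e) = 0" using M.GG[OF e, of 0 "-1"] z by simp
  moreover have "M.J 3 (M.J (-1) ?e) = 0" using M.GG[OF e, of 1 "-1"] z by simp
  ultimately have pos: "M.J k (ev [-1]) = 0" if "k > 0" for k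
    using M.positive_modes_vanish[OF v] that unfolding g_half by blast
  have "M.J 0 (ev [-1]) = scv (1 / 2) (ev [-1])"
    by (subst M.J0_ev) (simp_all add: M.wt_def)
  then show "M.J a (ev [-1]) = scv (if a = 0 then 1 / 2 else 0) (ev [-1])" if "a \<ge> 0" for a
    using pos[of a] that by (cases "a = 0") simp_all
qed

text \<open>The effect of appending G_{-1/2} to a word: a final G_{-1/2} merges with the new one to
  L_{-1}.\<close>

definition emb :: "int list \<Rightarrow> int list" where
  "emb U = (if U \<noteq> [] \<and> last U = -1 then butlast U @ [-2] else U @ [-1])"

lemma I_ev:
  assumes U: "M.valid U"
  shows "I.hom (ev U) = ev (emb U)"
proof (cases "U \<noteq> [] \<and> last U = -1")
  case True
  then obtain U' where U': "U = U' @ [-1]" by (metis append_butlast_last_id)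
  have v: "M.valid (U' @ [-2])" using U unfolding U' M.valid_snoc by force
  have "M.J (-1) (ev [-1]) = ev [-2]"
    using M.J_square[of "-1" "[]"] M.J_in_order[of "-2" "[]"] g_half by simp
  then show ?thesis using M.foldr_in_order[OF v] by (simp add: I.hom_ev U' emb_def)
next
  case False
  have "y < -1" if "y \<in> set U" for y
  proof -
    have "U \<noteq> []" using that by auto
    then have "last U < 0" using M.valid_lt[OF U] by simp
    then have "last U < -1" using False \<open>U \<noteq> []\<close> by simp
    then show ?thesis using M.valid_last[OF U that] by simp
  qed
  then have "M.valid (U @ [-1])" using U by (simp add: M.valid_snoc)
  then show ?thesis using M.foldr_in_order False by (auto simp: I.hom_ev emb_def)
qed

definition unemb :: "int list \<Rightarrow> int list" where
  "unemb W = (if last W = -1 then butlast W else butlast W @ [-1])"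

lemma emb_inj: "inj_on emb A"
proof (rule inj_on_inverseI)
  fix U
  show "unemb (emb U) = U"
  proof (cases "U \<noteq> [] \<and> last U = -1")
    case True
    then have "butlast U @ [-1] = U" using append_butlast_last_id[of U] by simp
    with True show ?thesis by (simp add: emb_def unemb_def)
  next
    case False
    then have "emb U = U @ [-1]" unfolding emb_def by (rule if_not_P)
    then show ?thesis by (simp add: unemb_def)
  qed
qed

text \<open>Distinct ordered words have distinct ordered images, so the submodule generated by
  G_{-1/2} is itself a Verma module.\<close>

lemma I_inj:
  assumes x: "x \<in> H.carrier" and 0: "I.hom x = 0"
  shows "x = 0"
proof (rule poly_mapping_eqI)
  fix U
  have k: "Poly_Mapping.keys x \<subseteq> {U. M.valid U}" using x by (auto simp: H.carrier_def)
  have "wlin scv (\<lambda>W. ev (emb W)) x = I.hom x"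
    unfolding I.hom_def by (rule wlin_cong) (use k I_ev in \<open>auto simp: I.hom_ev\<close>)
  then have "wlin scv (\<lambda>W. ev (emb W)) x = 0" using 0 by simp
  then show "Poly_Mapping.lookup x U = Poly_Mapping.lookup 0 U"
    using lookup_wlin_ev[of emb U x, OF emb_inj] by simp
qed

text \<open>An ordered word ends in its largest letter, so a letter that is at least -2 makes the
  word act first by a mode that kills the vacuum. The other words go to distinct ordered words of
  the vacuum module, hence none of them can occur in the kernel.\<close>

lemma kernel_words:
  assumes v: "v \<in> M.carrier" and 0: "P.hom v = 0" and W: "W \<in> Poly_Mapping.keys v"
  shows "\<exists>x\<in>set W. x \<ge> -2"
proof (rule ccontr)
  assume "\<not> ?thesis"
  then have small: "\<forall>x\<in>set W. x < -2" by auto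
  have val: "M.valid V" if "V \<in> Poly_Mapping.keys v" for V using v that by (auto simp: M.carrier_def)
  have Qval: "Q.valid V" if "M.valid V" "\<forall>x\<in>set V. x < -2" for V using that by (induct V) auto
  have hom: "P.hom (ev V) = (if \<forall>x\<in>set V. x < -2 then ev V else 0)" if V: "M.valid V" for V
  proof (cases "\<forall>x\<in>set V. x < -2")
    case True
    then show ?thesis using Q.foldr_in_order[of V "[]"] Qval[OF V] by (simp add: P.hom_ev)
  next
    case False
    then obtain x where x: "x \<in> set V" "x \<ge> -2" by auto
    then have l: "last V \<ge> -2" "V \<noteq> []" using M.valid_last[OF V, of x] by auto
    then obtain U where U: "V = U @ [last V]" by (metis append_butlast_last_id)
    have "foldr Q.J U 0 = 0" by (induct U) simp_all
    then show ?thesis using False l Q.J_empty[of "last V"] by (subst U) (simp add: P.hom_ev)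
  qed
  have "Poly_Mapping.lookup (P.hom v) W = (\<Sum>V\<in>Poly_Mapping.keys v. Poly_Mapping.lookup v V * Poly_Mapping.lookup (P.hom (ev V)) W)"
    unfolding P.hom_ev by (simp add: P.hom_def wlin_def lookup_sum)
  also have "\<dots> = (\<Sum>V\<in>Poly_Mapping.keys v. if V = W then Poly_Mapping.lookup v W else 0)"
    using small by (intro sum.cong refl) (auto simp: hom val lookup_ev)
  finally show False using 0 W by (simp add: in_keys_iff)
qed

text \<open>A kernel vector only contains words ending in -1 or -2, so it is the image of a vector
  over the generator of weight 1/2. By injectivity that vector is singular too, with level lower by
  1/2.\<close>

lemma projection_neq_0:
  assumes v: "M.singular l v" and n: "\<not> verma_singular c (1 / 2) (l - 1 / 2)"
  shows "P.hom v \<noteq> 0"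
proof
  assume 0: "P.hom v = 0"
  have vc: "v \<in> M.carrier" using v by (simp add: M.singular_def)
  have u: "M.valid (unemb W) \<and> emb (unemb W) = W" if W: "W \<in> Poly_Mapping.keys v" for W
  proof -
    have val: "M.valid W" using vc W by (auto simp: M.carrier_def)
    obtain x where x: "x \<in> set W" "x \<ge> -2" using kernel_words[OF vc 0 W] by blast
    then have ne: "W \<noteq> []" by auto
    have l: "last W \<ge> -2" "last W < 0" "W \<noteq> []"
      using M.valid_last[OF val x(1)] x M.valid_lt[OF val last_in_set[OF ne]] ne by auto
    obtain U y where U: "W = U @ [y]" using l(3) by (metis append_butlast_last_id)
    have vU: "M.valid U" "\<forall>z\<in>set U. z < y \<or> (z = y \<and> even y)" using val unfolding U M.valid_snoc by auto
    consider "y = -1" | "y = -2" using l U by force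
    then show ?thesis
    proof cases
      case 1
      then have "\<not> (U \<noteq> [] \<and> last U = -1)" using vU last_in_set by fastforce
      then show ?thesis using 1 vU U by (auto simp: unemb_def emb_def)
    next
      case 2
      then show ?thesis using vU U by (auto simp: unemb_def emb_def M.valid_snoc)
    qed
  qed
  define w where "w = wlin scv (\<lambda>W. ev (unemb W)) v"
  have wc: "w \<in> H.carrier"
    unfolding w_def wlin_def
    by (intro wv.subspace_sum[OF H.S_subspace] wv.subspace_scale[OF H.S_subspace]) (simp add: u)
  have Iw: "I.hom w = v"
  proof -
    interpret I': Vector_Spaces.linear scv scv I.hom by (rule I.hom_linear)
    have "I.hom w = (\<Sum>W\<in>Poly_Mapping.keys v. scv (Poly_Mapping.lookup v W) (I.hom (ev (unemb W))))"
      unfolding w_def wlin_def by (simp only: I'.sum I'.scale)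
    also have "\<dots> = (\<Sum>W\<in>Poly_Mapping.keys v. scv (Poly_Mapping.lookup v W) (ev W))"
      by (rule sum.cong) (simp_all add: I_ev u)
    finally show ?thesis using wvec_expand[of v] by simp
  qed
  have "H.singular (l - 1 / 2) w"
    unfolding H.singular_def
  proof (intro conjI allI impI)
    show "w \<in> H.carrier" by (rule wc)
    show "w \<noteq> 0" using Iw v by (auto simp: M.singular_def I.hom_def wlin_def)
    show "H.J a w = 0" if "a > 0" for a
      by (rule I_inj) (use wc that v in \<open>simp_all add: H.J_closed I.hom_J Iw M.singular_def\<close>)
    have "H.J 0 w - scv l w = 0"
    proof (rule I_inj)
      show "H.J 0 w - scv l w \<in> H.carrier"
        by (intro wv.subspace_diff[OF H.S_subspace] wv.subspace_scale[OF H.S_subspace] H.J_closed wc)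
      interpret I': Vector_Spaces.linear scv scv I.hom by (rule I.hom_linear)
      show "I.hom (H.J 0 w - scv l w) = 0"
        using v by (simp add: I'.diff I'.scale I.hom_J[OF wc] Iw M.singular_def)
    qed
    then show "H.J 0 w = scv (1 / 2 + (l - 1 / 2)) w" by simp
  qed
  then show False using n unfolding verma_singular_def by blast
qed

lemma projection_singular:
  assumes v: "M.singular l v" and n: "\<not> verma_singular c (1 / 2) (l - 1 / 2)"
  shows "Q.singular l (P.hom v)"
proof -
  have z: "P.hom 0 = 0" by (simp add: P.hom_def wlin_def)
  show ?thesis
    unfolding Q.singular_def
    using v projection_neq_0[OF assms] P.hom_closed[of v]
    by (auto simp: M.singular_def P.hom_scale P.hom_J[symmetric] z)
qed

end

section \<open>Spanning the simple quotient modulo C2\<close>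

locale simple_vacuum_module = R: ns_rep sc UNIV c K
  for sc :: "complex \<Rightarrow> 'v::ab_group_add \<Rightarrow> 'v" and c K +
  fixes vac :: 'v
  assumes vac: "vac \<noteq> 0" and K_vac: "a \<ge> -2 \<Longrightarrow> K a vac = 0"
    and irreducible: "R.subspace W \<Longrightarrow> (\<And>a w. w \<in> W \<Longrightarrow> K a w \<in> W) \<Longrightarrow> W = {0} \<or> W = UNIV"
begin

sublocale F: pbw_map c 0 "-2" sc UNIV K vac
  by unfold_locales (simp_all add: K_vac)

lemma image_submodule:
  assumes "pbw_map c h t sc UNIV K w"
  shows "pbw_map.hom sc K w ` pbw.carrier t = {0} \<or> pbw_map.hom sc K w ` pbw.carrier t = UNIV"
proof -
  interpret X: pbw_map c h t sc UNIV K w by fact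
  show ?thesis
  proof (rule irreducible)
    have "module_hom scv sc X.hom" using X.hom_linear by (simp add: linear_def module_hom_iff_linear)
    then show "R.subspace (X.hom ` X.carrier)"
      using X.S_subspace by (rule module_hom.subspace_image)
    show "K a y \<in> X.hom ` X.carrier" if "y \<in> X.hom ` X.carrier" for a y
      using that by (auto simp: X.hom_J[symmetric] intro!: X.J_closed)
  qed
qed

lemma hom_surj: "F.hom ` F.carrier = UNIV"
proof -
  have "vac \<in> F.hom ` F.carrier"
    by (rule image_eqI[of _ _ "ev []"]) (simp_all add: F.hom_ev)
  then show ?thesis using image_submodule[OF F.pbw_map_axioms] vac by blast
qed

text \<open>K 0 minus the scalar e j removes the term y j and rescales the others, which remain
  eigenvectors with the same nonzero eigenvalues. Coincident eigenvalues do no harm.\<close>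

lemma eigenvector_sum:
  assumes "finite A" "\<And>i. i \<in> A \<Longrightarrow> K 0 (y i) = sc (e i) (y i) \<and> e i \<noteq> 0" "K 0 z = 0" "(\<Sum>i\<in>A. y i) = z"
  shows "z = 0"
  using assms
proof (induct A arbitrary: y z)
  case (insert j A)
  have z: "z = y j + (\<Sum>i\<in>A. y i)" using insert.prems(3) insert.hyps by simp
  have "sc (e j) (y j) + (\<Sum>i\<in>A. sc (e i) (y i)) = K 0 z"
    unfolding z R.J_add R.J_sum using insert.prems(1) by simp
  then have "sc (e j) (y j) + (\<Sum>i\<in>A. sc (e i) (y i)) = 0" using insert.prems(2) by simp
  then have "(\<Sum>i\<in>A. sc (e i) (y i)) = - sc (e j) (y j)" by (simp add: add_eq_0_iff)
  then have sum: "(\<Sum>i\<in>A. sc (e i - e j) (y i)) = sc (- e j) z"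
    by (simp add: z R.scale_left_diff_distrib sum_subtractf R.scale_right_distrib R.scale_sum_right sum_negf)
  have "sc (- e j) z = 0"
  proof (rule insert.hyps(3)[OF _ _ sum])
    show "K 0 (sc (e i - e j) (y i)) = sc (e i) (sc (e i - e j) (y i)) \<and> e i \<noteq> 0" if "i \<in> A" for i
      using insert.prems(1)[of i] that by (simp add: R.J_scale mult.commute)
    show "K 0 (sc (- e j) z) = 0" using insert.prems(2) by (simp add: R.J_scale R.J_minus)
  qed
  then show ?case using insert.prems(1)[of j] by simp
qed simp

text \<open>Such a vector generates a submodule with weights at least n / 2 > 0, which misses the
  vacuum and is therefore zero.\<close>

lemma singular_vector_vanishes:
  assumes x: "K 0 x = sc (of_nat n / 2) x" "\<And>a. a > 0 \<Longrightarrow> K a x = 0" and n: "n > 0"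
  shows "x = 0"
proof -
  interpret X: pbw_map c "of_nat n / 2" 0 sc UNIV K x
    by unfold_locales (use x in \<open>auto simp: less_le\<close>)
  have "vac \<notin> X.hom ` X.carrier"
  proof
    assume "vac \<in> X.hom ` X.carrier"
    then obtain u where u: "u \<in> X.carrier" "vac = X.hom u" by blast
    have "vac = 0"
    proof (rule eigenvector_sum[where e = "\<lambda>W. of_nat n / 2 + X.wt W"])
      show "finite (Poly_Mapping.keys u)" by simp
      show "K 0 vac = 0" by (rule K_vac) simp
      show "(\<Sum>W\<in>Poly_Mapping.keys u. sc (Poly_Mapping.lookup u W) (X.hom (ev W))) = vac"
        unfolding u(2) X.hom_ev by (simp add: X.hom_def wlin_def)
      fix W assume "W \<in> Poly_Mapping.keys u"
      then have W: "X.valid W" using u by (auto simp: X.carrier_def)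
      have "(\<forall>x\<in>set W. x < 0) \<longrightarrow> sum_list W \<le> 0" by (induct W) auto
      then have s: "sum_list W \<le> 0" using X.valid_lt[OF W] by blast
      have "of_nat n / 2 + X.wt W = of_int (int n - sum_list W) / 2" by (simp add: X.wt_def diff_divide_distrib)
      moreover have "int n - sum_list W \<noteq> 0" using s n by simp
      ultimately have "of_nat n / 2 + X.wt W \<noteq> 0" by (simp only: of_int_eq_0_iff divide_eq_0_iff) simp
      moreover have "K 0 (X.hom (ev W)) = sc (of_nat n / 2 + X.wt W) (X.hom (ev W))"
        using X.hom_J[of "ev W" 0] W X.J0_ev[OF W] by (simp add: X.hom_scale)
      ultimately show "K 0 (sc (Poly_Mapping.lookup u W) (X.hom (ev W)))
           = sc (of_nat n / 2 + X.wt W) (sc (Poly_Mapping.lookup u W) (X.hom (ev W))) \<and> of_nat n / 2 + X.wt W \<noteq> 0"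
        by (simp add: R.J_scale mult.commute)
    qed
    then show False using vac by simp
  qed
  then have "X.hom ` X.carrier = {0}" using image_submodule[OF X.pbw_map_axioms] by blast
  moreover have "X.hom (ev []) \<in> X.hom ` X.carrier" by (rule imageI) simp
  ultimately show ?thesis by (simp add: X.hom_ev)
qed

text \<open>The part of \<open>C2\<close> that the two generating fields produce, by L_{-3},
  G_{-5/2} and lower modes; it is expressed without vertex operators.\<close>

definition DD :: "'v set" where
  "DD = R.span {K b y | b y. b \<le> -5}"

lemma DD_subspace: "R.subspace DD"
  by (simp add: DD_def)

lemma DD_mode: "b \<le> -5 \<Longrightarrow> K b y \<in> DD"
  unfolding DD_def by (rule R.span_base) blast

text \<open>Commuting a nonpositive mode past one of index at most -5 yields only modes in the same
  range and no central term.\<close>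

lemma DD_stable:
  assumes a: "a \<le> 0" and y: "y \<in> DD"
  shows "K a y \<in> DD"
  using y unfolding DD_def
proof (induct rule: R.span_induct_alt)
  case base
  show ?case by (simp add: R.span_zero)
next
  case (step x z y)
  then obtain b u where z: "z = K b u" "b \<le> -5" by blast
  have "K a z = sc (ns_sg a b) (K b (K a u)) + sc (ns_st a b) (K (a + b) u) + sc (ns_ct c a b) u"
    unfolding z by (rule R.J_rel) simp
  moreover have "ns_ct c a b = 0" using a z by (simp add: ns_ct_def)
  ultimately have "K a z \<in> DD"
    using a z by (auto intro!: R.subspace_add[OF DD_subspace] R.subspace_scale[OF DD_subspace] DD_mode)
  then show ?case using step
    by (auto simp: R.J_add R.J_scale DD_def intro!: R.span_add R.span_scale)
qed

definition lpow :: "nat \<Rightarrow> 'v" where "lpow i = (K (-4) ^^ i) vac"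

lemma foldr_replicate: "foldr K (replicate d (-4)) y = (K (-4) ^^ d) y"
  by (induct d) simp_all

lemma mode_commute:
  assumes "a = -3 \<or> a = -1"
  shows "K a ((K (-4) ^^ d) y) - (K (-4) ^^ d) (K a y) \<in> DD"
proof (induct d)
  case 0
  then show ?case using R.subspace_0[OF DD_subspace] by simp
next
  case (Suc d)
  let ?y = "(K (-4) ^^ d) y"
  have "K a (K (-4) ?y) = K (-4) (K a ?y) + sc (ns_st a (-4)) (K (a - 4) ?y)"
    using R.J_rel[of ?y a "-4"] assms by (auto simp: ns_sg_def ns_ct_def)
  then have "K a ((K (-4) ^^ Suc d) y) - (K (-4) ^^ Suc d) (K a y)
     = sc (ns_st a (-4)) (K (a - 4) ?y) + K (-4) (K a ?y - (K (-4) ^^ d) (K a y))"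
    by (simp add: R.J_diff)
  moreover have "K (a - 4) ?y \<in> DD" using assms by (intro DD_mode) auto
  ultimately show ?case
    using Suc by (auto intro!: R.subspace_add[OF DD_subspace] R.subspace_scale[OF DD_subspace] DD_stable)
qed

text \<open>An ordered word begins with its smallest letter, so a letter that is at most -5 anywhere
  puts the monomial into \<open>DD\<close>.\<close>

lemma word_cases:
  assumes W: "F.valid W"
  obtains (low) "foldr K W vac \<in> DD"
  | (short) "set W \<subseteq> {-4, -3}"
proof (cases "set W \<subseteq> {-4, -3}")
  case False
  then obtain x where x: "x \<in> set W" "x \<notin> {-4, -3}" by blast
  then have x5: "x \<le> -5" using F.valid_lt[OF W x(1)] by auto
  obtain b V where b: "W = b # V" using x by (cases W) auto
  then have "b \<le> x" using W x by force
  then show thesis using low DD_mode[of b] x5 b by simp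
qed (rule short)

text \<open>The singular vector is zero in the simple module. As its weight is fixed, only one of
  its words is made of the letters -4 and -3; the monomials of all others lie in \<open>DD\<close>,
  and solving for the remaining one puts it there too.\<close>

lemma top_monomial:
  assumes v: "F.singular (of_nat n / 2) v" and n: "n > 0"
  obtains d where "n = 4 * d" "lpow d \<in> DD" | d where "n = 4 * d + 3" "(K (-4) ^^ d) (K (-3) vac) \<in> DD"
proof -
  have vc: "v \<in> F.carrier" and v0: "F.J 0 v = scv (0 + of_nat n / 2) v" and vp: "\<And>a. a > 0 \<Longrightarrow> F.J a v = 0"
    using v by (auto simp: F.singular_def)
  obtain W where W: "W \<in> Poly_Mapping.keys v" "set W \<subseteq> {-4, -3}"
    using F.singular_lowest_word[OF v] by auto
  have val: "F.valid V" and wt: "F.wt V = of_nat n / 2" if "V \<in> Poly_Mapping.keys v" for V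
    using that vc F.wt_eigen[OF vc v0 that] by (auto simp: F.carrier_def)
  have "F.hom v = 0"
  proof (rule singular_vector_vanishes[OF _ _ n])
    show "K 0 (F.hom v) = sc (of_nat n / 2) (F.hom v)"
      unfolding F.hom_J[OF vc, symmetric] v0 F.hom_scale by simp
    show "K a (F.hom v) = 0" if "a > 0" for a
      unfolding F.hom_J[OF vc, symmetric] vp[OF that] by (simp add: F.hom_def wlin_def)
  qed
  then have "0 = (\<Sum>V\<in>Poly_Mapping.keys v. sc (Poly_Mapping.lookup v V) (foldr K V vac))"
    by (simp add: F.hom_def wlin_def)
  also have "\<dots> = sc (Poly_Mapping.lookup v W) (foldr K W vac)
      + (\<Sum>V\<in>Poly_Mapping.keys v - {W}. sc (Poly_Mapping.lookup v V) (foldr K V vac))"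
    by (rule sum.remove) (use W in auto)
  finally have e: "sc (Poly_Mapping.lookup v W) (foldr K W vac)
      = - (\<Sum>V\<in>Poly_Mapping.keys v - {W}. sc (Poly_Mapping.lookup v V) (foldr K V vac))"
    by (simp add: eq_neg_iff_add_eq_0)
  have "foldr K V vac \<in> DD" if V: "V \<in> Poly_Mapping.keys v - {W}" for V
  proof (rule word_cases[of V])
    show "F.valid V" using val V by simp
    assume "set V \<subseteq> {-4, -3}"
    then have "V = W" using F.lowest_word_unique[of V W] W val wt V by simp
    then show ?thesis using V by simp
  qed
  then have "sc (Poly_Mapping.lookup v W) (foldr K W vac) \<in> DD"
    unfolding e by (intro R.subspace_neg[OF DD_subspace] R.subspace_sum[OF DD_subspace] R.subspace_scale[OF DD_subspace])
  then have "sc (inverse (Poly_Mapping.lookup v W)) (sc (Poly_Mapping.lookup v W) (foldr K W vac)) \<in> DD"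
    by (rule R.subspace_scale[OF DD_subspace])
  then have D: "foldr K W vac \<in> DD" using W by (simp add: in_keys_iff)
  have s: "sum_list W = - int n"
  proof -
    have "of_int (- sum_list W) = (of_int (int n) :: complex)" using wt[OF W(1)] by (simp add: F.wt_def)
    then show ?thesis unfolding of_int_eq_iff by simp
  qed
  obtain d where "W = replicate d (-4) \<or> W = replicate d (-4) @ [-3]"
    using F.lowest_word_form[OF val[OF W(1)]] W(2) by auto
  then show thesis
  proof
    assume d: "W = replicate d (-4)"
    then have "n = 4 * d" using s by (simp add: sum_list_replicate)
    then show thesis using that(1)[of d] D d by (simp add: foldr_replicate lpow_def)
  next
    assume d: "W = replicate d (-4) @ [-3]"
    then have "n = 4 * d + 3" using s by (simp add: sum_list_replicate)
    then show thesis using that(2)[of d] D d by (simp add: foldr_replicate)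
  qed
qed

lemma lpow_le:
  assumes "lpow d \<in> DD" "d \<le> i"
  shows "lpow i \<in> DD"
  using assms(2,1)
proof (induct rule: dec_induct)
  case (step i)
  then show ?case using DD_stable[of "-4" "lpow i"] by (simp add: lpow_def)
qed

text \<open>G_{-1/2} takes G_{-3/2} applied to the vacuum to 2 L_{-2} applied to it, and it commutes
  with L_{-2} modulo \<open>DD\<close>.\<close>

lemma odd_top_monomial:
  assumes "(K (-4) ^^ d) (K (-3) vac) \<in> DD"
  shows "lpow (Suc d) \<in> DD"
proof -
  have "K (-1) (K (-3) vac) = sc 2 (K (-4) vac)"
    using R.J_rel[of vac "-1" "-3"] K_vac[of "-1"] by (simp add: ns_sg_def ns_ct_def ns_st_def)
  moreover have "(K (-4) ^^ d) (sc 2 y) = sc 2 ((K (-4) ^^ d) y)" for y by (induct d) (simp_all add: R.J_scale)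
  ultimately have "K (-1) ((K (-4) ^^ d) (K (-3) vac)) - sc 2 (lpow (Suc d)) \<in> DD"
    using mode_commute[of "-1" d "K (-3) vac"] by (simp add: lpow_def funpow_swap1)
  moreover have "K (-1) ((K (-4) ^^ d) (K (-3) vac)) \<in> DD" by (rule DD_stable) (use assms in auto)
  ultimately have "sc (1 / 2) (K (-1) ((K (-4) ^^ d) (K (-3) vac))
      - (K (-1) ((K (-4) ^^ d) (K (-3) vac)) - sc 2 (lpow (Suc d)))) \<in> DD"
    using R.subspace_scale[OF DD_subspace R.subspace_diff[OF DD_subspace]] by blast
  moreover have "sc (1 / 2) (x - (x - sc 2 y)) = y" for x y by simp
  ultimately show ?thesis by (simp only:)
qed

theorem spanning_monomials:
  assumes "lpow N \<in> DD"
  shows "R.span (DD \<union> {lpow i | i. i < N} \<union> {K (-3) (lpow i) | i. i < N}) = UNIV" (is "R.span ?S = UNIV")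
proof -
  have DS: "y \<in> R.span ?S" if "y \<in> DD" for y using that by (intro R.span_base) blast
  have m: "lpow i \<in> R.span ?S" for i
    using lpow_le[OF assms] by (cases "i < N") (auto intro: DS R.span_base)
  have g: "K (-3) (lpow i) \<in> R.span ?S" for i
    using lpow_le[OF assms] DD_stable[of "-3" "lpow i"] by (cases "i < N") (auto intro: DS R.span_base)
  have word: "foldr K W vac \<in> R.span ?S" if W: "F.valid W" for W
  proof (rule word_cases[OF W])
    assume "set W \<subseteq> {-4, -3}"
    then obtain d where "W = replicate d (-4) \<or> W = replicate d (-4) @ [-3]"
      using F.lowest_word_form[OF W] by auto
    then show ?thesis
    proof
      assume "W = replicate d (-4)"
      then show ?thesis using m[of d] by (simp add: foldr_replicate lpow_def)
    next
      assume W: "W = replicate d (-4) @ [-3]"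
      have "K (-3) (lpow d) - (K (-3) (lpow d) - foldr K W vac) \<in> R.span ?S"
        using mode_commute[of "-3" d vac] by (intro R.span_diff g DS) (simp add: W foldr_replicate lpow_def)
      then show ?thesis by simp
    qed
  qed (rule DS)
  have "y \<in> R.span ?S" for y
  proof -
    obtain u where u: "u \<in> F.carrier" "y = F.hom u" using hom_surj by (metis imageE UNIV_I)
    show ?thesis unfolding u(2) F.hom_def wlin_def
      using u(1) by (intro R.span_sum R.span_scale word) (auto simp: F.carrier_def)
  qed
  then show ?thesis by blast
qed

end

section \<open>Passage from the super vertex algebra to the module\<close>

theorem mainTheorem10:
  fixes p q :: int
    and sc :: "complex \<Rightarrow> 'v::ab_group_add \<Rightarrow> 'v"
    and V0 V1 :: "'v set"
    and Y :: "'v \<Rightarrow> int \<Rightarrow> 'v \<Rightarrow> 'v"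
    and vac :: 'v
    and Lop Gop :: "int \<Rightarrow> 'v \<Rightarrow> 'v"
  assumes "p \<ge> 2" and "q \<ge> 2" and "even (p - q)" and "gcd p ((p - q) div 2) = 1"
    and NS: "NS_module sc (c_pq p q) Lop Gop"
    and hw_L: "\<forall>n\<ge>0. Lop n vac = 0"
    and hw_G: "\<forall>k\<ge>0. Gop k vac = 0"
    and nonzero: "vac \<noteq> 0"
    and irreducible: "\<forall>W. module.subspace sc W \<and> (\<forall>n w. w \<in> W \<longrightarrow> Lop n w \<in> W \<and> Gop n w \<in> W)
                        \<longrightarrow> W = {0} \<or> W = UNIV"
    and SVA: "super_vertex_algebra sc V0 V1 Y vac"
    and parity: "Lop (-2) vac \<in> V0" "Gop (-2) vac \<in> V1"
    and field_L: "\<forall>n. Y (Lop (-2) vac) (n + 1) = Lop n"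
    and field_G: "\<forall>k. Y (Gop (-2) vac) (k + 1) = Gop k"
  shows "module.span sc (C2 sc Y
            \<union> {(Lop (-2) ^^ i) vac | i. int i < N_pq p q}
            \<union> {Gop (-2) ((Lop (-2) ^^ i) vac) | i. int i < N_pq p q}) = UNIV
         \<and> (\<exists>S. finite S \<and> module.span sc (C2 sc Y \<union> S) = UNIV)"
proof -
  interpret V: vector_space sc using NS by (simp add: NS_module_def)
  define K where "K a = (if even a then Lop (a div 2) else Gop (a div 2))" for a
  have Ke: "K (2 * n) = Lop n" and Ko: "K (2 * k + 1) = Gop k" for n k by (simp_all add: K_def)
  have lin: "Vector_Spaces.linear sc sc (K a)" for a
    using NS by (simp add: NS_module_def K_def)
  note ns = NS[unfolded NS_module_def]
  have LL: "Lop m (Lop n v) = Lop n (Lop m v) + sc (of_int m - of_int n) (Lop (m + n) v)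
      + sc (if m + n = 0 then c_pq p q / 12 * (of_int m ^ 3 - of_int m) else 0) v" for m n v
  proof -
    have "Lop m (Lop n v) - Lop n (Lop m v) = sc (of_int (m - n)) (Lop (m + n) v)
          + (if m + n = 0 then sc (c_pq p q / 12 * of_int (m ^ 3 - m)) v else 0)" using ns by blast
    then show ?thesis by (simp add: diff_eq_eq add_ac)
  qed
  have LG: "Lop m (Gop a v) = Gop a (Lop m v) + sc (of_int m / 2 - of_int a - 1 / 2) (Gop (m + a) v)" for m a v
  proof -
    have "Lop m (Gop a v) - Gop a (Lop m v) = sc (of_int m / 2 - of_int a - 1 / 2) (Gop (m + a) v)" using ns by blast
    then show ?thesis by (simp add: diff_eq_eq add.commute)
  qed
  have GG: "Gop a (Gop b v) = - Gop b (Gop a v) + sc 2 (Lop (a + b + 1) v)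
      + sc (if a + b + 1 = 0 then c_pq p q / 3 * of_int (a * (a + 1)) else 0) v" for a b v
  proof -
    have "Gop a (Gop b v) + Gop b (Gop a v) = sc 2 (Lop (a + b + 1) v)
          + (if a + b + 1 = 0 then sc (c_pq p q / 3 * of_int (a * (a + 1))) v else 0)" using ns by blast
    then have "Gop a (Gop b v) = - Gop b (Gop a v) + (sc 2 (Lop (a + b + 1) v)
          + (if a + b + 1 = 0 then sc (c_pq p q / 3 * of_int (a * (a + 1))) v else 0))" by (simp add: eq_diff_eq[symmetric])
    then show ?thesis by (simp add: add.assoc)
  qed
  have "simple_vacuum_module sc (c_pq p q) K vac"
  proof unfold_locales
    show "K a (v + w) = K a v + K a w" "K a (sc x v) = sc x (K a v)" for a v w x
      using lin[of a] by (simp_all add: Vector_Spaces.linear_iff)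
    show "K a (K b v) = sc (ns_sg a b) (K b (K a v)) + sc (ns_st a b) (K (a + b) v) + sc (ns_ct (c_pq p q) a b) v" for a b v
    proof -
      consider m n where "a = 2 * m" "b = 2 * n" | m k where "a = 2 * m" "b = 2 * k + 1"
        | j n where "a = 2 * j + 1" "b = 2 * n" | j k where "a = 2 * j + 1" "b = 2 * k + 1"
        by (meson evenE oddE)
      then show ?thesis
      proof cases
        case (1 m n)
        show ?thesis unfolding 1 ns_index ns_coeff_LL Ke using LL[of m n v] by simp
      next
        case (2 m k)
        show ?thesis unfolding 2 ns_index ns_coeff_LG Ke Ko using LG[of m k v] by (simp add: add.commute)
      next
        case (3 j n)
        have e: "of_int j + 1 / 2 - of_int n / 2 = - (of_int n / 2 - of_int j - 1 / 2 :: complex)" by simp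
        show ?thesis unfolding 3 ns_index ns_coeff_GL Ke Ko e V.scale_minus_left using LG[of n j v] by (simp add: add.commute)
      next
        case (4 j k)
        show ?thesis unfolding 4 ns_index ns_coeff_GG Ke Ko using GG[of j k v] by simp
      qed
    qed
    show "vac \<noteq> 0" by (rule nonzero)
    \<comment> \<open>L_{-1} and G_{-1/2} are the 0-th modes of the two generating states, so the
      creation axiom makes them kill the vacuum as well.\<close>
    have Y0: "Y u n vac = 0" if "n \<ge> 0" for u n using SVA that unfolding super_vertex_algebra_def by blast
    show "K a vac = 0" if "a \<ge> -2" for a
    proof (cases "even a")
      case True
      then show ?thesis using Y0[of "a div 2 + 1" "Lop (-2) vac"] field_L that by (simp add: K_def)
    next
      case False
      then have "a div 2 \<ge> -1" using that by presburger
      then show ?thesis using False Y0[of "a div 2 + 1" "Gop (-2) vac"] field_G by (simp add: K_def)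
    qed
    show "W = {0} \<or> W = UNIV" if "V.subspace W" "\<And>a w. w \<in> W \<Longrightarrow> K a w \<in> W" for W
    proof -
      have "Lop n w \<in> W \<and> Gop n w \<in> W" if "w \<in> W" for n w
        using \<open>\<And>a w. w \<in> W \<Longrightarrow> K a w \<in> W\<close>[OF that, of "2 * n"] \<open>\<And>a w. w \<in> W \<Longrightarrow> K a w \<in> W\<close>[OF that, of "2 * n + 1"]
        by (simp only: Ke Ko)
      then show ?thesis using irreducible that(1) by blast
    qed
  qed (simp_all add: V.subspace_UNIV)
  then interpret S: simple_vacuum_module sc "c_pq p q" K vac .
  interpret Pr: vacuum_projection "c_pq p q" .
  define n where "n = nat ((p - 1) * (q - 1))"
  have n: "int n = (p - 1) * (q - 1)" "n > 0" using \<open>p \<ge> 2\<close> \<open>q \<ge> 2\<close> by (simp_all add: n_def)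
  note vs = vacuum_singular[OF \<open>p \<ge> 2\<close> \<open>q \<ge> 2\<close> \<open>even (p - q)\<close> \<open>gcd p ((p - q) div 2) = 1\<close>, folded n(1)]
  obtain v where v: "Pr.M.singular (of_nat n / 2) v" using vs(1) by (auto simp: verma_singular_def)
  have "of_int (int n - 1) / 2 = (of_nat n / 2 - 1 / 2 :: complex)" by (simp add: diff_divide_distrib)
  with vs(2) have "\<not> verma_singular (c_pq p q) (1 / 2) (of_nat n / 2 - 1 / 2)" by (simp only:) simp
  from Pr.projection_singular[OF v this] have v': "S.F.singular (of_nat n / 2) (Pr.P.hom v)" .
  define N where "N = nat (N_pq p q)"
  \<comment> \<open>n = (p - 1) (q - 1) is even exactly when p and q are odd, so the two forms of
    the top monomial match the two cases of \<open>N_pq\<close>.\<close>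
  have "S.lpow N \<in> S.DD \<and> int N = N_pq p q"
    using v' n(2)
  proof (rule S.top_monomial)
    fix d assume d: "n = 4 * d" "S.lpow d \<in> S.DD"
    have "even (int n)" using d(1) by simp
    then have "even ((p - 1) * (q - 1))" unfolding n(1) .
    then have "odd p" "odd q" using \<open>even (p - q)\<close> by auto
    then have "N_pq p q = int d" using n(1) d by (simp add: N_pq_def flip: n(1))
    then show ?thesis using d by (simp add: N_def)
  next
    fix d assume d: "n = 4 * d + 3" "(K (-4) ^^ d) (K (-3) vac) \<in> S.DD"
    have "odd (int n)" using d(1) by simp
    then have "odd ((p - 1) * (q - 1))" unfolding n(1) .
    then have "\<not> odd p" by auto
    then have "N_pq p q = int (Suc d)" using d by (simp add: N_pq_def flip: n(1))
    then have "N = Suc d" "int N = N_pq p q" by (simp_all add: N_def)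
    then show ?thesis using S.odd_top_monomial[OF d(2)] by simp
  qed
  then have top: "S.lpow N \<in> S.DD" and N: "int N = N_pq p q" by auto
  have K4: "K (-4) = Lop (-2)" "K (-3) = Gop (-2)" using Ke[of "-2"] Ko[of "-2"] by simp_all
  let ?A = "{(Lop (-2) ^^ i) vac | i. int i < N_pq p q}"
  let ?B = "{Gop (-2) ((Lop (-2) ^^ i) vac) | i. int i < N_pq p q}"
  have D: "S.DD \<subseteq> C2 sc Y"
    unfolding S.DD_def C2_def
  proof (rule V.span_mono, clarify)
    fix b y assume b: "(b :: int) \<le> -5"
    \<comment> \<open>The mode of index b is the mode b div 2 + 1 of the vertex operator of a
      generating state, and b at most -5 brings this down to -2, as \<open>C2\<close>
      demands.\<close>
    have "b div 2 \<le> -3" using b by linarith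
    then have e: "- int (nat (- (b div 2) - 1)) = b div 2 + 1" "2 \<le> nat (- (b div 2) - 1)" by simp_all
    have "K b y = Y (if even b then Lop (-2) vac else Gop (-2) vac) (- int (nat (- (b div 2) - 1))) y"
      unfolding e(1) using field_L field_G by (simp add: K_def)
    then show "\<exists>u v n. K b y = Y u (- int n) v \<and> 2 \<le> n" using e(2) by blast
  qed
  have "UNIV = V.span (S.DD \<union> {S.lpow i | i. i < N} \<union> {K (-3) (S.lpow i) | i. i < N})"
    using S.spanning_monomials[OF top] by simp
  also have "\<dots> \<subseteq> V.span (C2 sc Y \<union> ?A \<union> ?B)"
    by (rule V.span_mono) (use D in \<open>auto simp: S.lpow_def K4 simp flip: N\<close>)
  finally have 1: "V.span (C2 sc Y \<union> ?A \<union> ?B) = UNIV" by blast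
  have "?A \<subseteq> (\<lambda>i. (Lop (-2) ^^ i) vac) ` {..<N}" "?B \<subseteq> (\<lambda>i. Gop (-2) ((Lop (-2) ^^ i) vac)) ` {..<N}"
    by (auto simp flip: N)
  then have "finite (?A \<union> ?B)" using finite_subset by blast
  then show ?thesis using 1 by (intro conjI exI[of _ "?A \<union> ?B"]) (simp_all add: Un_assoc)
qed

end
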